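(* In the sequence-of-problems setting described in the context (hat matrices that are projections onto selected columns, model sizes at most $K$ with $K^2\log p=O(\sqrt n)$, and the accuracy condition on $\hat M$ with constant $\delta>0$), there is a constant $C$, not depending on $n$ or $\alpha$, such that $$\frac{1}{n}\left|\mathbb{E}\left[\widehat{\mathrm{Err}}_{\alpha}\right]-\mathrm{Err}\right| = \frac1n\left|\mathrm{Err}_\alpha-\mathrm{Err}\right|\le C\alpha\qquad\text{for all } 0<\alpha<\delta .$$
   Context: Setting: $\sigma^2>0$ and $\delta>0$ are fixed. For each $n$ there are: a number of features $p=p_n$, a fixed matrix $X\in\mathbb{R}^{n\times p}$, a fixed mean vector $\mu=\mu(X)\in\mathbb{R}^n$ (not necessarily linear in $X$), a response $y\sim N(\mu,\sigma^2 I_n)$, a collection $\mathcal{M}=\{M_1,\dots,M_{|\mathcal M|}\}\subseteq 2^{\{1,\dots,p\}}$, and a surjective selection map $\hat M:\mathbb{R}^n\to\mathcal{M}$. The sets $U_i=\hat M^{-1}(M_i)$ partition $\mathbb{R}^n$, and each $U_i$ has nonempty interior and boundary of Lebesgue measure $0$. Assumptions (all $O(\cdot)$ constants are independent of $n$): (1) For every $M\in\mathcal{M}$, $H_M=X_M(X_M^TX_M)^{-1}X_M^T$, where $X_M$ is the submatrix of $X$ with columns in $M$ ($H_\emptyset=0$); so $H_M$ is symmetric and $H_M^2=H_M$. The data-dependent hat matrix is $H_{\hat M(y)}=\sum_i H_{M_i}\mathbf 1\{y\in U_i\}$. (2) There is $K=K_n$ such that $\mathrm{rank}(H_M)\le |M|\le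 K$ for every $M\in\mathcal{M}$, and $K^2\log p=O(\sqrt n)$. (3) $\mathbb{E}\big[\big(\|\mu-H_{\hat M(y')}\mu\|_2^2\big)^2\big]=O(n)$ for $y'\sim N(\mu,\tau I_n)$, uniformly over $\sigma^2\le\tau\le(1+\delta)\sigma^2$. Definitions: for $\alpha>0$, $\omega\sim N(0,\alpha\sigma^2I_n)$ is independent of $y$, $y^*=y+\omega$, $y^-=y-\frac1\alpha\omega$, and $$\widehat{\mathrm{Err}}_{\alpha}=\|y^- - H_{\hat M(y^* )}y\|_2^2+2\,\mathrm{tr}(H_{\hat M(y^* )})\sigma^2-\tfrac1\alpha n\sigma^2,$$ $$\mathrm{Err}=\mathbb{E}\|y_{new}-H_{\hat M(y)}y\|_2^2,\qquad \mathrm{Err}_\alpha=\mathbb{E}\|y_{new}-H_{\hat M(y+\omega)}y\|_2^2,$$ with $y_{new}\sim N(\mu,\sigma^2I_n)$ independent of $(y,\omega)$. *)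

theory Defs
  imports
    "HOL-Probability.Probability"
    "HOL-Library.Landau_Symbols"
    "Jordan_Normal_Form.Gauss_Jordan_Elimination"
    "Jordan_Normal_Form.DL_Rank"
    "Jordan_Normal_Form.DL_Submatrix"
begin

text \<open>
  Since the dimension varies along the sequence of problems, a vector of \<open>\<real>\<^sup>n\<close> is an extensional
  function on \<open>{..<n}\<close>; this makes \<open>\<real>\<^sup>n\<close> the space of the product measure
  \<open>\<Pi>\<^sub>M i\<in>{..<n}. lborel\<close> (Lebesgue measure) and of the corresponding product topology.
  Coordinates, and the columns of a design matrix, are numbered from 0.
\<close>

definition Rn :: "nat \<Rightarrow> (nat \<Rightarrow> real) set" where
  "Rn n = (\<Pi>\<^sub>E i\<in>{..<n}. UNIV)"

definition Rn_top :: "nat \<Rightarrow> (nat \<Rightarrow> real) topology" where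
  "Rn_top n = product_topology (\<lambda>_. euclideanreal) {..<n}"

definition Rn_lborel :: "nat \<Rightarrow> (nat \<Rightarrow> real) measure" where
  "Rn_lborel n = (\<Pi>\<^sub>M i\<in>{..<n}. lborel)"

text \<open>
  The Gaussian law \<open>N(m, v I\<^sub>n)\<close>, parametrised by the variance \<open>v > 0\<close>
  (\<^const>\<open>normal_density\<close> takes the standard deviation).
\<close>

definition iso_normal :: "nat \<Rightarrow> (nat \<Rightarrow> real) \<Rightarrow> real \<Rightarrow> (nat \<Rightarrow> real) measure" where
  "iso_normal n m v =
     (\<Pi>\<^sub>M i\<in>{..<n}. density lborel (\<lambda>x. ennreal (normal_density (m i) (sqrt v) x)))"

definition mat_trace :: "real mat \<Rightarrow> real" where
  "mat_trace A = (\<Sum>i<dim_row A. A $$ (i, i))"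

definition cols_submat :: "real mat \<Rightarrow> nat set \<Rightarrow> real mat" where
  "cols_submat X M = submatrix X UNIV M"

definition gram :: "real mat \<Rightarrow> nat set \<Rightarrow> real mat" where
  "gram X M = transpose_mat (cols_submat X M) * cols_submat X M"

text \<open>For \<open>M = {}\<close> the products below are over an empty index range, so this is the zero matrix.\<close>

definition hat_mat :: "real mat \<Rightarrow> nat set \<Rightarrow> real mat" where
  "hat_mat X M =
     cols_submat X M * the (mat_inverse (gram X M)) * transpose_mat (cols_submat X M)"

definition resid_sq :: "nat \<Rightarrow> real mat \<Rightarrow> (nat \<Rightarrow> real) \<Rightarrow> (nat \<Rightarrow> real) \<Rightarrow> real" where
  "resid_sq n A u v =
     (let r = Matrix.vec n u - A *\<^sub>v Matrix.vec n v in scalar_prod r r)"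

definition sel_region :: "nat \<Rightarrow> ((nat \<Rightarrow> real) \<Rightarrow> nat set) \<Rightarrow> nat set \<Rightarrow> (nat \<Rightarrow> real) set" where
  "sel_region n Mhat M = {y \<in> Rn n. Mhat y = M}"

definition y_star :: "nat \<Rightarrow> (nat \<Rightarrow> real) \<Rightarrow> (nat \<Rightarrow> real) \<Rightarrow> nat \<Rightarrow> real" where
  "y_star n y w = (\<lambda>i\<in>{..<n}. y i + w i)"

definition y_minus :: "nat \<Rightarrow> real \<Rightarrow> (nat \<Rightarrow> real) \<Rightarrow> (nat \<Rightarrow> real) \<Rightarrow> nat \<Rightarrow> real" where
  "y_minus n \<alpha> y w = (\<lambda>i\<in>{..<n}. y i - w i / \<alpha>)"

text \<open>
  A selection region is only required to have a Lebesgue-null boundary, which makes it Lebesgue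
  measurable but not necessarily Borel. Expectations are therefore taken with respect to the
  completed laws. Below \<open>s2\<close> is the noise variance \<open>\<sigma>\<^sup>2\<close>, and \<open>w\<close> is the randomisation \<open>\<omega>\<close>.
\<close>

definition err_hat ::
  "nat \<Rightarrow> real mat \<Rightarrow> ((nat \<Rightarrow> real) \<Rightarrow> nat set) \<Rightarrow> real \<Rightarrow> real \<Rightarrow>
     (nat \<Rightarrow> real) \<Rightarrow> (nat \<Rightarrow> real) \<Rightarrow> real" where
  "err_hat n X Mhat s2 \<alpha> y w =
     (let H = hat_mat X (Mhat (y_star n y w))
      in resid_sq n H (y_minus n \<alpha> y w) y + 2 * mat_trace H * s2 - (1 / \<alpha>) * real n * s2)"

definition expected_err_hat ::
  "nat \<Rightarrow> real mat \<Rightarrow> (nat \<Rightarrow> real) \<Rightarrow> ((nat \<Rightarrow> real) \<Rightarrow> nat set) \<Rightarrow> real \<Rightarrow> real \<Rightarrow> real" where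
  "expected_err_hat n X \<mu> Mhat s2 \<alpha> =
     (LINT (y, w) | completion (iso_normal n \<mu> s2 \<Otimes>\<^sub>M iso_normal n (\<lambda>_. 0) (\<alpha> * s2)).
        err_hat n X Mhat s2 \<alpha> y w)"

definition Err ::
  "nat \<Rightarrow> real mat \<Rightarrow> (nat \<Rightarrow> real) \<Rightarrow> ((nat \<Rightarrow> real) \<Rightarrow> nat set) \<Rightarrow> real \<Rightarrow> real" where
  "Err n X \<mu> Mhat s2 =
     (LINT (ynew, y) | completion (iso_normal n \<mu> s2 \<Otimes>\<^sub>M iso_normal n \<mu> s2).
        resid_sq n (hat_mat X (Mhat y)) ynew y)"

definition Err_rand ::
  "nat \<Rightarrow> real mat \<Rightarrow> (nat \<Rightarrow> real) \<Rightarrow> ((nat \<Rightarrow> real) \<Rightarrow> nat set) \<Rightarrow> real \<Rightarrow> real \<Rightarrow> real" where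
  "Err_rand n X \<mu> Mhat s2 \<alpha> =
     (LINT (ynew, y, w) | completion
          (iso_normal n \<mu> s2 \<Otimes>\<^sub>M (iso_normal n \<mu> s2 \<Otimes>\<^sub>M iso_normal n (\<lambda>_. 0) (\<alpha> * s2))).
        resid_sq n (hat_mat X (Mhat (y_star n y w))) ynew y)"

definition bias_moment ::
  "nat \<Rightarrow> real mat \<Rightarrow> (nat \<Rightarrow> real) \<Rightarrow> ((nat \<Rightarrow> real) \<Rightarrow> nat set) \<Rightarrow> real \<Rightarrow> real" where
  "bias_moment n X \<mu> Mhat \<tau> =
     (LINT y | completion (iso_normal n \<mu> \<tau>). (resid_sq n (hat_mat X (Mhat y)) \<mu> \<mu>)\<^sup>2)"

end

(*
  Write y + \<omega> = s. Given s, the response y is m + e with m = (s + \<alpha> \<mu>) / (1 + \<alpha>) and e independent of s,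
  e ~ N(0, \<alpha> \<sigma>^2 / (1 + \<alpha>)), and y^- = \<mu> + ((1 + \<alpha>) / \<alpha>) e. Integrating out e shows that both expectations
  equal n \<sigma>^2 + E[ |\<mu> - H \<mu>|^2 + |H (s - \<mu>)|^2 / (1 + \<alpha>)^2 + \<alpha> \<sigma>^2 tr H / (1 + \<alpha>) ] with H = H(s) and
  s ~ N(\<mu>, (1 + \<alpha>) \<sigma>^2), while Err is the same expression with \<alpha> = 0. The \<tau>-derivative of the density of
  N(\<mu>, \<tau> I) is the density times (|s - \<mu>|^2 - n \<tau>) / (2 \<tau>^2), and |s - \<mu>|^2 has variance 2 n \<tau>^2, so
  \<tau> \<mapsto> E_\<tau> g(s) has Lipschitz constant O(n) as soon as E_\<tau> g(s)^2 = O(n). For the bias this is the accuracy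
  assumption. For |H (s - \<mu>)|^2 it is a maximal inequality: |H_M z|^2 is a combination of squared
  Gaussians with weights h_ii summing to |M|, so exp (|H_M z|^2 / (4 \<tau> K)) has bounded mean by Jensen,
  and a union bound over at most (p + 1)^K models gives E max_M |H_M z|^4 = O(1 + (K^2 log p)^2).
*)

theory Submission
  imports Defs
begin

text \<open>In mean square the score of N(\<mu>, \<tau> I) and the functionals g are both of order
  sqrt n, so 2ab \<le> a^2 + b^2 already gives a derivative of order n; this is why second moments
  of |\<mu> - H \<mu>|^2 and |H (s - \<mu>)|^2 have to be controlled. The variance only moves from
  \<sigma>^2 to (1 + \<alpha>) \<sigma>^2, which supplies the factor \<alpha> and stays in the range
  of \<tau> covered by the accuracy assumption. Two obstacles shape the proof. The selection map
  need only be Lebesgue measurable, whereas Fubini and the change of variables are carried out on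
  uncompleted products. It is therefore replaced by a Borel rule that agrees with it off the
  frontiers of the regions, and only at the end are integrals over the completions identified with
  Borel ones. Secondly, the O-conditions hold only for large n, while the claim is for every n \<ge>
  1; the finitely many other n get constants of their own, for which the crude bound |\<mu> - H
  \<mu>| \<le> |\<mu>| suffices.\<close>

section \<open>The isotropic Gaussian as a density\<close>

lemma space_Rn_lborel [simp]: "space (Rn_lborel n) = Rn n"
  by (simp add: Rn_lborel_def Rn_def space_PiM)

lemma sets_iso_normal [measurable_cong]: "sets (iso_normal n m v) = sets (Rn_lborel n)"
  unfolding iso_normal_def Rn_lborel_def by (intro sets_PiM_cong) auto

lemma measurable_iso_normal_eq: "measurable (iso_normal n m v) M = measurable (Rn_lborel n) M"
  by (intro measurable_cong_sets sets_iso_normal refl)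

lemma space_iso_normal [simp]: "space (iso_normal n m v) = Rn n"
  using sets_eq_imp_space_eq[OF sets_iso_normal[of n m v]] by simp

lemma prob_space_normal: "v > 0 \<Longrightarrow> prob_space (density lborel (\<lambda>x. ennreal (normal_density m (sqrt v) x)))"
  by (intro prob_space_normal_density) simp

lemma prob_space_iso_normal: "v > 0 \<Longrightarrow> prob_space (iso_normal n m v)"
  unfolding iso_normal_def by (intro prob_space_PiM prob_space_normal)

lemma sigma_finite_Rn_lborel: "sigma_finite_measure (Rn_lborel n)"
  unfolding Rn_lborel_def
  by (intro product_sigma_finite.sigma_finite) (auto simp: product_sigma_finite_def sigma_finite_lborel)

definition sq_dist :: "nat \<Rightarrow> (nat \<Rightarrow> real) \<Rightarrow> (nat \<Rightarrow> real) \<Rightarrow> real" where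
  "sq_dist n x y = (\<Sum>i<n. (x i - y i)\<^sup>2)"

text \<open>The normalising constant is kept in the exponent as a logarithm: products of densities
  become sums, and the derivative in \<open>v\<close> is that of the exponent times the
  density.\<close>

definition gauss_dens :: "nat \<Rightarrow> (nat \<Rightarrow> real) \<Rightarrow> real \<Rightarrow> (nat \<Rightarrow> real) \<Rightarrow> real" where
  "gauss_dens n m v x = exp (- (real n / 2) * ln (2 * pi * v) - sq_dist n x m / (2 * v))"

lemma component_measurable_Rn: "i < n \<Longrightarrow> (\<lambda>x. x i) \<in> borel_measurable (Rn_lborel n)"
  unfolding Rn_lborel_def using measurable_component_singleton[of i "{..<n}" "\<lambda>_. lborel"] by simp

lemma sq_dist_measurable [measurable]: "(\<lambda>x. sq_dist n x m) \<in> borel_measurable (Rn_lborel n)"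
  unfolding sq_dist_def using component_measurable_Rn[measurable] by measurable

lemma gauss_dens_measurable [measurable]: "gauss_dens n m v \<in> borel_measurable (Rn_lborel n)"
  unfolding gauss_dens_def[abs_def] by measurable

lemma gauss_dens_nonneg [simp]: "gauss_dens n m v x \<ge> 0"
  by (simp add: gauss_dens_def)

lemma normal_density_exp:
  assumes "v > 0"
  shows "normal_density m (sqrt v) x = exp (- (1/2) * ln (2 * pi * v) - (x - m)\<^sup>2 / (2 * v))"
proof -
  have "exp (- (1/2) * ln (2 * pi * v)) = 1 / sqrt (2 * pi * v)"
    using assms by (simp add: exp_minus ln_sqrt[symmetric] divide_simps)
  moreover have "exp (a - q) = exp a * exp (- q)" for a q :: real
    by (simp add: exp_diff exp_minus divide_inverse)
  ultimately show ?thesis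
    using assms by (simp add: normal_density_def)
qed

lemma gauss_dens_prod:
  assumes "v > 0"
  shows "gauss_dens n m v x = (\<Prod>i<n. normal_density (m i) (sqrt v) (x i))"
  using assms
  by (simp add: gauss_dens_def normal_density_exp exp_sum[symmetric] sum_subtractf sq_dist_def sum_divide_distrib)

text \<open>Both sides agree on boxes. A reference measure common to all variances is what makes it
  possible to differentiate in \<open>v\<close>.\<close>

lemma iso_normal_density:
  assumes v: "v > 0"
  shows "iso_normal n m v = density (Rn_lborel n) (\<lambda>x. ennreal (gauss_dens n m v x))"
proof -
  interpret L: product_sigma_finite "\<lambda>_::nat. lborel :: real measure"
    by standard
  interpret N: product_prob_space "\<lambda>i. density lborel (\<lambda>x. ennreal (normal_density (m i) (sqrt v) x))"
    using prob_space_normal[OF v] by (auto simp: product_prob_space_def product_prob_space_axioms_def 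
      product_sigma_finite_def prob_space_imp_sigma_finite)
  show ?thesis
  proof (rule sym, subst iso_normal_def, rule N.PiM_eqI)
    show "sets (density (Rn_lborel n) (\<lambda>x. ennreal (gauss_dens n m v x))) =
      sets (Pi\<^sub>M {..<n} (\<lambda>i. density lborel (\<lambda>x. ennreal (normal_density (m i) (sqrt v) x))))"
      using sets_iso_normal[of n m v] by (simp add: iso_normal_def)
    fix A assume A: "\<And>i. i \<in> {..<n} \<Longrightarrow> A i \<in> sets (density lborel (\<lambda>x. ennreal (normal_density (m i) (sqrt v) x)))"
    then have A': "\<And>i. i < n \<Longrightarrow> A i \<in> sets borel" by simp
    have PA: "Pi\<^sub>E {..<n} A \<in> sets (Rn_lborel n)"
      unfolding Rn_lborel_def using A' by (intro sets_PiM_I_finite) auto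
    have "emeasure (density (Rn_lborel n) (\<lambda>x. ennreal (gauss_dens n m v x))) (Pi\<^sub>E {..<n} A)
      = (\<integral>\<^sup>+x. ennreal (gauss_dens n m v x) * indicator (Pi\<^sub>E {..<n} A) x \<partial>Rn_lborel n)"
      using PA by (simp add: emeasure_density)
    also have "\<dots> = (\<integral>\<^sup>+x. (\<Prod>i\<in>{..<n}. ennreal (normal_density (m i) (sqrt v) (x i)) * indicator (A i) (x i)) \<partial>Rn_lborel n)"
    proof (intro nn_integral_cong)
      fix x assume "x \<in> space (Rn_lborel n)"
      then have "(indicator (Pi\<^sub>E {..<n} A) x :: ennreal) = (\<Prod>i\<in>{..<n}. indicator (A i) (x i))"
        by (auto simp: Rn_def PiE_def Pi_def indicator_def split: if_splits intro!: prod.neutral[symmetric])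
      then show "ennreal (gauss_dens n m v x) * indicator (Pi\<^sub>E {..<n} A) x =
         (\<Prod>i\<in>{..<n}. ennreal (normal_density (m i) (sqrt v) (x i)) * indicator (A i) (x i))"
        by (simp add: gauss_dens_prod[OF v] prod_ennreal prod.distrib)
    qed
    also have "\<dots> = (\<Prod>i\<in>{..<n}. \<integral>\<^sup>+x. ennreal (normal_density (m i) (sqrt v) x) * indicator (A i) x \<partial>lborel)"
      unfolding Rn_lborel_def using A' by (intro L.product_nn_integral_prod) auto
    also have "\<dots> = (\<Prod>i\<in>{..<n}. emeasure (density lborel (\<lambda>x. ennreal (normal_density (m i) (sqrt v) x))) (A i))"
      using A' by (intro prod.cong refl emeasure_density[symmetric]) auto
    finally show "emeasure (density (Rn_lborel n) (\<lambda>x. ennreal (gauss_dens n m v x))) (Pi\<^sub>E {..<n} A) =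
      (\<Prod>i\<in>{..<n}. emeasure (density lborel (\<lambda>x. ennreal (normal_density (m i) (sqrt v) x))) (A i))" .
  qed simp
qed

section \<open>Translation invariance of Lebesgue measure\<close>

definition shift_vec :: "nat \<Rightarrow> (nat \<Rightarrow> real) \<Rightarrow> (nat \<Rightarrow> real) \<Rightarrow> nat \<Rightarrow> real" where
  "shift_vec n c x = (\<lambda>i\<in>{..<n}. c i + x i)"

lemma measurable_RnI:
  assumes "\<And>i. i < n \<Longrightarrow> (\<lambda>x. f x i) \<in> borel_measurable M"
    and "\<And>x i. x \<in> space M \<Longrightarrow> i \<ge> n \<Longrightarrow> f x i = undefined"
  shows "f \<in> M \<rightarrow>\<^sub>M Rn_lborel n"
  unfolding Rn_lborel_def using assms
  by (intro measurable_PiM_single') (auto simp: PiE_def extensional_def)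

lemma shift_vec_measurable: "shift_vec n c \<in> Rn_lborel n \<rightarrow>\<^sub>M Rn_lborel n"
  by (intro measurable_RnI) (auto simp: shift_vec_def intro!: borel_measurable_add component_measurable_Rn)

lemma distr_shift_Rn_lborel: "distr (Rn_lborel n) (Rn_lborel n) (shift_vec n c) = Rn_lborel n"
proof -
  interpret L: product_sigma_finite "\<lambda>_::nat. lborel :: real measure"
    by standard
  have "distr (Rn_lborel n) (Rn_lborel n) (shift_vec n c) = Pi\<^sub>M {..<n} (\<lambda>_. lborel)"
  proof (rule L.PiM_eqI)
    fix A assume "\<And>i. i \<in> {..<n} \<Longrightarrow> A i \<in> sets (lborel :: real measure)"
    then have A: "\<And>i. i < n \<Longrightarrow> A i \<in> sets borel" by auto
    have PA: "Pi\<^sub>E {..<n} A \<in> sets (Rn_lborel n)"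
      unfolding Rn_lborel_def using A by (intro sets_PiM_I_finite) auto
    have mt: "(\<lambda>x. c i + x) \<in> borel_measurable (lborel :: real measure)" for i by simp
    have "shift_vec n c -` (Pi\<^sub>E {..<n} A) \<inter> Rn n = Pi\<^sub>E {..<n} (\<lambda>i. (\<lambda>x. c i + x) -` A i \<inter> UNIV)"
      by (auto simp: shift_vec_def Rn_def PiE_def Pi_def extensional_def)
    then have "emeasure (distr (Rn_lborel n) (Rn_lborel n) (shift_vec n c)) (Pi\<^sub>E {..<n} A)
      = emeasure (Pi\<^sub>M {..<n} (\<lambda>_. lborel)) (Pi\<^sub>E {..<n} (\<lambda>i. (\<lambda>x. c i + x) -` A i \<inter> UNIV))"
      using PA by (simp add: emeasure_distr shift_vec_measurable Rn_lborel_def[symmetric])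
    also have "\<dots> = (\<Prod>i\<in>{..<n}. emeasure lborel ((\<lambda>x. c i + x) -` A i \<inter> UNIV))"
      using A measurable_sets[OF mt] by (intro L.emeasure_PiM) auto
    also have "\<dots> = (\<Prod>i\<in>{..<n}. emeasure (distr lborel borel (\<lambda>x. c i + x)) (A i))"
      using A by (intro prod.cong refl) (subst emeasure_distr, auto)
    also have "\<dots> = (\<Prod>i\<in>{..<n}. emeasure lborel (A i))"
      by (simp add: lborel_distr_plus)
    finally show "emeasure (distr (Rn_lborel n) (Rn_lborel n) (shift_vec n c)) (Pi\<^sub>E {..<n} A) 
      = (\<Prod>i\<in>{..<n}. emeasure lborel (A i))" .
  qed (simp_all add: Rn_lborel_def)
  then show ?thesis by (simp add: Rn_lborel_def)
qed

lemma nn_integral_Rn_shift: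
  assumes "f \<in> borel_measurable (Rn_lborel n)"
  shows "(\<integral>\<^sup>+x. f (shift_vec n c x) \<partial>Rn_lborel n) = (\<integral>\<^sup>+x. f x \<partial>Rn_lborel n)"
  using nn_integral_distr[OF shift_vec_measurable[of n c], of f] assms
  by (simp add: distr_shift_Rn_lborel)

section \<open>Separating the randomised response from its noise\<close>

text \<open>The independence of s = y + \<omega> and e = y - (s + \<alpha> \<mu>) / (1 + \<alpha>)
  shows as a factorisation of the joint density: the cross term in s and e cancels, and the two
  pairs of variances have the same product, so the normalising constants agree.\<close>

lemma gauss_dens_split:
  assumes s2: "s2 > 0" and a: "\<alpha> > 0"
  shows "gauss_dens n \<mu> s2 (shift_vec n (\<lambda>i. (s i + \<alpha> * \<mu> i) / (1 + \<alpha>)) e) *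
    gauss_dens n (\<lambda>_. 0) (\<alpha> * s2) (shift_vec n (\<lambda>i. - shift_vec n (\<lambda>i. (s i + \<alpha> * \<mu> i) / (1 + \<alpha>)) e i) s)
    = gauss_dens n \<mu> ((1 + \<alpha>) * s2) s * gauss_dens n (\<lambda>_. 0) (\<alpha> * s2 / (1 + \<alpha>)) e"
proof -
  have ln: "ln (2 * pi * s2) + ln (2 * pi * (\<alpha> * s2)) = ln (2 * pi * ((1 + \<alpha>) * s2)) + ln (2 * pi * (\<alpha> * s2 / (1 + \<alpha>)))"
    using s2 a by (simp add: ln_mult ln_div)
  have q: "((s i + \<alpha> * \<mu> i) / (1 + \<alpha>) + e i - \<mu> i)\<^sup>2 / (2 * s2) + (- ((s i + \<alpha> * \<mu> i) / (1 + \<alpha>) + e i) + s i)\<^sup>2 / (2 * (\<alpha> * s2))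
     = (s i - \<mu> i)\<^sup>2 / (2 * ((1 + \<alpha>) * s2)) + (e i)\<^sup>2 / (2 * (\<alpha> * s2 / (1 + \<alpha>)))" for i
  proof -
    \<comment> \<open>The mean of y given s is \<mu> + t in this coordinate, so t is its shift away
      from \<mu>.\<close>
    define t where "t = (s i - \<mu> i) / (1 + \<alpha>)"
    have si: "s i = \<mu> i + (1 + \<alpha>) * t" using a by (simp add: t_def)
    have 1: "(s i + \<alpha> * \<mu> i) / (1 + \<alpha>) = \<mu> i + t"
      using a by (simp add: si divide_simps) (simp add: algebra_simps)
    have 2: "- (\<mu> i + t + e i) + s i = \<alpha> * t - e i"
      by (simp add: si algebra_simps)
    have "(t + e i)\<^sup>2 / (2 * s2) + (\<alpha> * t - e i)\<^sup>2 / (2 * (\<alpha> * s2)) = (\<alpha> * (t + e i)\<^sup>2 + (\<alpha> * t - e i)\<^sup>2) / (2 * (\<alpha> * s2))"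
      using s2 a by (simp add: add_divide_distrib)
    also have "\<alpha> * (t + e i)\<^sup>2 + (\<alpha> * t - e i)\<^sup>2 = (1 + \<alpha>) * (\<alpha> * t\<^sup>2) + (1 + \<alpha>) * (e i)\<^sup>2"
      by (simp add: algebra_simps power2_eq_square)
    also have "((1 + \<alpha>) * (\<alpha> * t\<^sup>2) + (1 + \<alpha>) * (e i)\<^sup>2) / (2 * (\<alpha> * s2)) = (1 + \<alpha>) * t\<^sup>2 / (2 * s2) + (1 + \<alpha>) * (e i)\<^sup>2 / (2 * (\<alpha> * s2))"
      using s2 a by (simp add: add_divide_distrib)
    also have "(1 + \<alpha>) * t\<^sup>2 / (2 * s2) = ((1 + \<alpha>) * t)\<^sup>2 / (2 * ((1 + \<alpha>) * s2))"
      using s2 a by (simp add: power2_eq_square divide_simps)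
    also have "(1 + \<alpha>) * (e i)\<^sup>2 / (2 * (\<alpha> * s2)) = (e i)\<^sup>2 / (2 * (\<alpha> * s2 / (1 + \<alpha>)))"
      using s2 a by simp
    finally show ?thesis unfolding 1 2 unfolding si by (simp add: add_ac)
  qed
  have "sq_dist n (shift_vec n (\<lambda>i. (s i + \<alpha> * \<mu> i) / (1 + \<alpha>)) e) \<mu> / (2 * s2)
    + sq_dist n (shift_vec n (\<lambda>i. - shift_vec n (\<lambda>i. (s i + \<alpha> * \<mu> i) / (1 + \<alpha>)) e i) s) (\<lambda>_. 0) / (2 * (\<alpha> * s2))
    = sq_dist n s \<mu> / (2 * ((1 + \<alpha>) * s2)) + sq_dist n e (\<lambda>_. 0) / (2 * (\<alpha> * s2 / (1 + \<alpha>)))"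
    unfolding sq_dist_def sum_divide_distrib sum.distrib[symmetric]
    by (intro sum.cong refl) (simp only: shift_vec_def restrict_apply if_True lessThan_iff q diff_zero)
  then show ?thesis
    unfolding gauss_dens_def exp_add[symmetric] using arg_cong[OF ln, of "\<lambda>x. real n / 2 * x"]
    by (simp add: algebra_simps)
qed

lemma shift_vec_measurable_pair:
  assumes "\<And>i. i < n \<Longrightarrow> (\<lambda>x. c x i) \<in> borel_measurable M" and [measurable]: "f \<in> M \<rightarrow>\<^sub>M Rn_lborel n"
  shows "(\<lambda>x. shift_vec n (c x) (f x)) \<in> M \<rightarrow>\<^sub>M Rn_lborel n"
proof (rule measurable_RnI)
  fix i assume i [simp]: "i < n"
  have [measurable]: "(\<lambda>x. f x i) \<in> borel_measurable M"
    using measurable_compose[OF assms(2) component_measurable_Rn[OF i]] .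
  show "(\<lambda>x. shift_vec n (c x) (f x) i) \<in> borel_measurable M"
    using assms(1)[OF i] by (simp add: shift_vec_def)
qed (simp add: shift_vec_def)

text \<open>Recovers \<open>(y, \<omega>)\<close> from the independent pair \<open>(s, e)\<close>, where \<open>s = y + \<omega>\<close>.\<close>

definition unrandomize :: "nat \<Rightarrow> real \<Rightarrow> (nat \<Rightarrow> real) \<Rightarrow> (nat \<Rightarrow> real) \<times> (nat \<Rightarrow> real) \<Rightarrow> (nat \<Rightarrow> real) \<times> (nat \<Rightarrow> real)" where
  "unrandomize n \<alpha> \<mu> = (\<lambda>(s, e). let y = shift_vec n (\<lambda>i. (s i + \<alpha> * \<mu> i) / (1 + \<alpha>)) e in (y, shift_vec n (\<lambda>i. - y i) s))"

lemma Rn_coord_measurable: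
  "f \<in> M \<rightarrow>\<^sub>M Rn_lborel n \<Longrightarrow> i < n \<Longrightarrow> (\<lambda>x. f x i) \<in> borel_measurable M"
  using measurable_compose[OF _ component_measurable_Rn] .

lemma unrandomize_measurable: "unrandomize n \<alpha> \<mu> \<in> Rn_lborel n \<Otimes>\<^sub>M Rn_lborel n \<rightarrow>\<^sub>M Rn_lborel n \<Otimes>\<^sub>M Rn_lborel n"
proof -
  have [measurable]: "(\<lambda>p. fst p i) \<in> borel_measurable (Rn_lborel n \<Otimes>\<^sub>M Rn_lborel n)" 
    "(\<lambda>p. snd p i) \<in> borel_measurable (Rn_lborel n \<Otimes>\<^sub>M Rn_lborel n)" if "i < n" for i
    using that by (auto intro!: Rn_coord_measurable)
  show ?thesis
    unfolding unrandomize_def Let_def case_prod_unfold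
    by (intro measurable_Pair measurable_RnI) (simp_all add: shift_vec_def)
qed

lemma sets_iso_normal_pair: "sets (iso_normal n m v \<Otimes>\<^sub>M iso_normal n m' v') = sets (Rn_lborel n \<Otimes>\<^sub>M Rn_lborel n)"
  by (intro sets_pair_measure_cong sets_iso_normal)

lemma measurable_iso_normal_pair_eq:
  "measurable (iso_normal n m v \<Otimes>\<^sub>M iso_normal n m' v') M = measurable (Rn_lborel n \<Otimes>\<^sub>M Rn_lborel n) M"
  by (intro measurable_cong_sets sets_iso_normal_pair refl)

text \<open>The substitution is done one block at a time: first \<omega> = s - y for fixed y, then,
  after exchanging the integrals, y = (s + \<alpha> \<mu>) / (1 + \<alpha>) + e for fixed s. Each is
  a translation, so no determinant appears.\<close>

lemma nn_integral_randomized: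
  assumes s2: "s2 > 0" and a: "\<alpha> > 0"
    and f: "f \<in> borel_measurable (Rn_lborel n \<Otimes>\<^sub>M Rn_lborel n)"
  shows "(\<integral>\<^sup>+ p. f p \<partial>(iso_normal n \<mu> s2 \<Otimes>\<^sub>M iso_normal n (\<lambda>_. 0) (\<alpha> * s2)))
    = (\<integral>\<^sup>+ p. f (unrandomize n \<alpha> \<mu> p) \<partial>(iso_normal n \<mu> ((1 + \<alpha>) * s2) \<Otimes>\<^sub>M iso_normal n (\<lambda>_. 0) (\<alpha> * s2 / (1 + \<alpha>))))"
proof -
  let ?R = "Rn_lborel n"
  interpret R: sigma_finite_measure ?R by (rule sigma_finite_Rn_lborel)
  interpret RR: pair_sigma_finite ?R ?R by standard
  have pos: "\<alpha> * s2 > 0" "(1 + \<alpha>) * s2 > 0" "\<alpha> * s2 / (1 + \<alpha>) > 0" using s2 a by auto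
  have iter: "(\<integral>\<^sup>+ p. g p \<partial>(iso_normal n m v \<Otimes>\<^sub>M iso_normal n m' v'))
     = (\<integral>\<^sup>+ x. \<integral>\<^sup>+ y. ennreal (gauss_dens n m v x) * ennreal (gauss_dens n m' v' y) * g (x, y) \<partial>?R \<partial>?R)"
    if v: "v > 0" "v' > 0" and g [measurable]: "g \<in> borel_measurable (?R \<Otimes>\<^sub>M ?R)" for g m m' v v'
  proof -
    interpret N: prob_space "iso_normal n m' v'" using v by (intro prob_space_iso_normal)
    have "(\<integral>\<^sup>+ p. g p \<partial>(iso_normal n m v \<Otimes>\<^sub>M iso_normal n m' v')) = (\<integral>\<^sup>+ x. \<integral>\<^sup>+ y. g (x, y) \<partial>iso_normal n m' v' \<partial>iso_normal n m v)"
      using g by (intro N.nn_integral_fst[symmetric]) (simp add: measurable_iso_normal_pair_eq)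
    also have "\<dots> = (\<integral>\<^sup>+ x. \<integral>\<^sup>+ y. ennreal (gauss_dens n m' v' y) * g (x, y) \<partial>?R \<partial>iso_normal n m v)"
      unfolding iso_normal_density[OF v(2)]
      by (intro nn_integral_cong nn_integral_density measurable_Pair2[OF g]) (simp_all add: gauss_dens_measurable)
    also have "\<dots> = (\<integral>\<^sup>+ x. ennreal (gauss_dens n m v x) * (\<integral>\<^sup>+ y. ennreal (gauss_dens n m' v' y) * g (x, y) \<partial>?R) \<partial>?R)"
      unfolding iso_normal_density[OF v(1)] by (intro nn_integral_density) measurable
    also have "\<dots> = (\<integral>\<^sup>+ x. \<integral>\<^sup>+ y. ennreal (gauss_dens n m v x) * ennreal (gauss_dens n m' v' y) * g (x, y) \<partial>?R \<partial>?R)"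
      using measurable_Pair2[OF g]
      by (intro nn_integral_cong) (subst nn_integral_cmult[symmetric], auto simp: mult.assoc)
    finally show ?thesis .
  qed
  have fu: "(\<lambda>p. f (unrandomize n \<alpha> \<mu> p)) \<in> borel_measurable (?R \<Otimes>\<^sub>M ?R)"
    using measurable_compose[OF unrandomize_measurable f] .
  define G where "G y w = ennreal (gauss_dens n \<mu> s2 y) * ennreal (gauss_dens n (\<lambda>_. 0) (\<alpha> * s2) w) * f (y, w)" for y w
  have gd: "(\<lambda>p. gauss_dens n \<mu> s2 (fst p)) \<in> borel_measurable (?R \<Otimes>\<^sub>M ?R)"
    "(\<lambda>p. gauss_dens n (\<lambda>_. 0) (\<alpha> * s2) (snd p)) \<in> borel_measurable (?R \<Otimes>\<^sub>M ?R)"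
    by (intro measurable_compose[OF measurable_fst] measurable_compose[OF measurable_snd] gauss_dens_measurable)+
  have G: "(\<lambda>p. G (fst p) (snd p)) \<in> borel_measurable (?R \<Otimes>\<^sub>M ?R)"
    unfolding G_def prod.collapse using f gd
    by (intro borel_measurable_times_ennreal measurable_compose[OF _ measurable_ennreal])
  have sh: "(\<lambda>p. (fst p, shift_vec n (\<lambda>i. - fst p i) (snd p))) \<in> ?R \<Otimes>\<^sub>M ?R \<rightarrow>\<^sub>M ?R \<Otimes>\<^sub>M ?R"
    by (intro measurable_Pair shift_vec_measurable_pair measurable_fst measurable_snd) (auto intro!: borel_measurable_uminus Rn_coord_measurable)
  have G': "(\<lambda>(y, s). G y (shift_vec n (\<lambda>i. - y i) s)) \<in> borel_measurable (?R \<Otimes>\<^sub>M ?R)"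
    using measurable_compose[OF sh G] by (simp add: case_prod_unfold)
  have "(\<integral>\<^sup>+ p. f p \<partial>(iso_normal n \<mu> s2 \<Otimes>\<^sub>M iso_normal n (\<lambda>_. 0) (\<alpha> * s2))) = (\<integral>\<^sup>+ y. \<integral>\<^sup>+ w. G y w \<partial>?R \<partial>?R)"
    unfolding G_def using iter[OF s2 pos(1) f] .
  also have "\<dots> = (\<integral>\<^sup>+ y. \<integral>\<^sup>+ s. G y (shift_vec n (\<lambda>i. - y i) s) \<partial>?R \<partial>?R)"
    using measurable_Pair2[OF G] by (intro nn_integral_cong nn_integral_Rn_shift[symmetric]) auto
  also have "\<dots> = (\<integral>\<^sup>+ s. \<integral>\<^sup>+ y. G y (shift_vec n (\<lambda>i. - y i) s) \<partial>?R \<partial>?R)"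
    using RR.Fubini'[OF G', symmetric] by simp
  also have "\<dots> = (\<integral>\<^sup>+ s. \<integral>\<^sup>+ e. (case unrandomize n \<alpha> \<mu> (s, e) of (y, w) \<Rightarrow> G y w) \<partial>?R \<partial>?R)"
  proof (rule nn_integral_cong)
    fix s assume "s \<in> space ?R"
    from nn_integral_Rn_shift[OF measurable_Pair1[OF G' this], of "\<lambda>i. (s i + \<alpha> * \<mu> i) / (1 + \<alpha>)", symmetric]
    show "(\<integral>\<^sup>+ y. G y (shift_vec n (\<lambda>i. - y i) s) \<partial>?R) = (\<integral>\<^sup>+ e. (case unrandomize n \<alpha> \<mu> (s, e) of (y, w) \<Rightarrow> G y w) \<partial>?R)"
      by (simp add: unrandomize_def Let_def)
  qed
  also have "\<dots> = (\<integral>\<^sup>+ s. \<integral>\<^sup>+ e. ennreal (gauss_dens n \<mu> ((1 + \<alpha>) * s2) s) * ennreal (gauss_dens n (\<lambda>_. 0) (\<alpha> * s2 / (1 + \<alpha>)) e) *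
      f (unrandomize n \<alpha> \<mu> (s, e)) \<partial>?R \<partial>?R)"
    unfolding G_def unrandomize_def Let_def prod.case ennreal_mult[OF gauss_dens_nonneg gauss_dens_nonneg, symmetric]
    unfolding gauss_dens_split[OF s2 a] ..
  also have "\<dots> = (\<integral>\<^sup>+ p. f (unrandomize n \<alpha> \<mu> p) \<partial>(iso_normal n \<mu> ((1 + \<alpha>) * s2) \<Otimes>\<^sub>M iso_normal n (\<lambda>_. 0) (\<alpha> * s2 / (1 + \<alpha>))))"
    using iter[OF pos(2,3) fu] by simp
  finally show ?thesis .
qed

text \<open>As an identity of measures the change of variables also applies to signed integrands and
  to almost-everywhere statements.\<close>

lemma randomized_eq_distr:
  assumes s2: "s2 > 0" and a: "\<alpha> > 0"
  shows "iso_normal n \<mu> s2 \<Otimes>\<^sub>M iso_normal n (\<lambda>_. 0) (\<alpha> * s2)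
    = distr (iso_normal n \<mu> ((1 + \<alpha>) * s2) \<Otimes>\<^sub>M iso_normal n (\<lambda>_. 0) (\<alpha> * s2 / (1 + \<alpha>))) (Rn_lborel n \<Otimes>\<^sub>M Rn_lborel n) (unrandomize n \<alpha> \<mu>)"
proof (rule measure_eqI)
  show S: "sets (iso_normal n \<mu> s2 \<Otimes>\<^sub>M iso_normal n (\<lambda>_. 0) (\<alpha> * s2)) = sets (distr (iso_normal n \<mu> ((1 + \<alpha>) * s2) \<Otimes>\<^sub>M iso_normal n (\<lambda>_. 0) (\<alpha> * s2 / (1 + \<alpha>))) (Rn_lborel n \<Otimes>\<^sub>M Rn_lborel n) (unrandomize n \<alpha> \<mu>))"
    by (simp add: sets_iso_normal_pair)
  have um: "unrandomize n \<alpha> \<mu> \<in> iso_normal n \<mu> ((1 + \<alpha>) * s2) \<Otimes>\<^sub>M iso_normal n (\<lambda>_. 0) (\<alpha> * s2 / (1 + \<alpha>)) \<rightarrow>\<^sub>M Rn_lborel n \<Otimes>\<^sub>M Rn_lborel n"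
    using unrandomize_measurable by (simp add: measurable_iso_normal_pair_eq)
  fix A assume A: "A \<in> sets (iso_normal n \<mu> s2 \<Otimes>\<^sub>M iso_normal n (\<lambda>_. 0) (\<alpha> * s2))"
  then have A': "A \<in> sets (Rn_lborel n \<Otimes>\<^sub>M Rn_lborel n)" using S by simp
  show "emeasure (iso_normal n \<mu> s2 \<Otimes>\<^sub>M iso_normal n (\<lambda>_. 0) (\<alpha> * s2)) A = emeasure (distr (iso_normal n \<mu> ((1 + \<alpha>) * s2) \<Otimes>\<^sub>M iso_normal n (\<lambda>_. 0) (\<alpha> * s2 / (1 + \<alpha>))) (Rn_lborel n \<Otimes>\<^sub>M Rn_lborel n) (unrandomize n \<alpha> \<mu>)) A"
    using nn_integral_randomized[OF s2 a, of "indicator A" n \<mu>] A A' um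
    by (simp add: nn_integral_distr[symmetric])
qed

section \<open>Second moments\<close>

lemma has_bochner_integral_prob_const:
  assumes "prob_space M"
  shows "has_bochner_integral M (\<lambda>_. c :: real) c"
proof -
  interpret prob_space M by fact
  show ?thesis by (simp add: has_bochner_integral_iff prob_space)
qed

abbreviation normal_law :: "real \<Rightarrow> real \<Rightarrow> real measure" where
  "normal_law m v \<equiv> density lborel (\<lambda>x. ennreal (normal_density m (sqrt v) x))"

lemma normal_law_moments:
  assumes v: "v > 0"
  shows "has_bochner_integral (normal_law m v) (\<lambda>x. x - m) 0"
    "has_bochner_integral (normal_law m v) (\<lambda>x. (x - m)\<^sup>2) v"
    "has_bochner_integral (normal_law m v) (\<lambda>x. (x - m)^4) (3 * v\<^sup>2)"
proof -
  have *: "has_bochner_integral (normal_law m v) f r" if "f \<in> borel_measurable borel" "has_bochner_integral lborel (\<lambda>x. normal_density m (sqrt v) x * f x) r" for f r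
    using that by (intro has_bochner_integral_density) auto
  have s: "sqrt v > 0" using v by simp
  show "has_bochner_integral (normal_law m v) (\<lambda>x. x - m) 0"
    using normal_moment_odd[OF s, of m 0] by (intro *) auto
  show "has_bochner_integral (normal_law m v) (\<lambda>x. (x - m)\<^sup>2) v"
    using normal_moment_even[OF s, of m 1] v by (intro *) (auto simp: fact_numeral)
  show "has_bochner_integral (normal_law m v) (\<lambda>x. (x - m)^4) (3 * v\<^sup>2)"
    using normal_moment_even[OF s, of m 2] v by (intro *) (auto simp: fact_numeral power2_eq_square field_simps)
qed

text \<open>Independence kills the cross terms. The \<open>g i\<close> may be any centred functions,
  which covers both linear forms and the centred squares in |x - m|^2.\<close>

lemma has_integral_iso_normal_sum_sq:
  fixes g :: "nat \<Rightarrow> real \<Rightarrow> real"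
  assumes v: "v > 0"
    and g1: "\<And>i. i < n \<Longrightarrow> has_bochner_integral (normal_law (m i) v) (g i) 0"
    and g2: "\<And>i. i < n \<Longrightarrow> has_bochner_integral (normal_law (m i) v) (\<lambda>x. (g i x)\<^sup>2) (q i)"
  shows "has_bochner_integral (iso_normal n m v) (\<lambda>x. (c + (\<Sum>i<n. g i (x i)))\<^sup>2) (c\<^sup>2 + (\<Sum>i<n. q i))"
proof -
  interpret N: product_prob_space "\<lambda>i. normal_law (m i) v"
    using prob_space_normal[OF v] by (auto simp: product_prob_space_def product_prob_space_axioms_def 
      product_sigma_finite_def prob_space_imp_sigma_finite)
  interpret P: prob_space "iso_normal n m v" using v by (rule prob_space_iso_normal)
  have prod: "has_bochner_integral (iso_normal n m v) (\<lambda>x. \<Prod>k<n. f k (x k)) (\<Prod>k<n. \<integral>x. f k x \<partial>normal_law (m k) v)"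
    if "\<And>k. k < n \<Longrightarrow> integrable (normal_law (m k) v) (f k)" for f :: "nat \<Rightarrow> real \<Rightarrow> real"
    unfolding iso_normal_def has_bochner_integral_iff
    using that N.product_integrable_prod[of "{..<n}" f] N.product_integral_prod[of "{..<n}" f] by auto
  have N1: "has_bochner_integral (normal_law (m k) v) (\<lambda>_. 1) (1::real)" for k
    by (intro has_bochner_integral_prob_const prob_space_normal v)
  \<comment> \<open>A function of one coordinate is a product over all coordinates with factor 1 at
    the others.\<close>
  have one: "has_bochner_integral (iso_normal n m v) (\<lambda>x. f (x i)) r"
    if i: "i < n" and f: "has_bochner_integral (normal_law (m i) v) f r" for f :: "real \<Rightarrow> real" and r :: real and i
  proof -
    have "has_bochner_integral (iso_normal n m v) (\<lambda>x. \<Prod>k<n. (if k = i then f else (\<lambda>_. 1)) (x k)) (\<Prod>k<n. \<integral>x. (if k = i then f else (\<lambda>_. 1)) x \<partial>normal_law (m k) v)"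
      using f N1 by (intro prod) (auto simp: has_bochner_integral_iff)
    moreover have "(\<Prod>k<n. (if k = i then f else (\<lambda>_. 1)) (x k)) = f (x i)" for x
      using i by (subst prod.remove[of _ i]) (auto intro!: prod.neutral)
    moreover have "(\<Prod>k<n. \<integral>x. (if k = i then f else (\<lambda>_. 1)) x \<partial>normal_law (m k) v) = r"
      using i f has_bochner_integral_integral_eq[OF N1] by (subst prod.remove[of _ i]) (auto intro!: prod.neutral simp: has_bochner_integral_iff)
    ultimately show ?thesis by simp
  qed
  have two: "has_bochner_integral (iso_normal n m v) (\<lambda>x. g i (x i) * g j (x j)) (if i = j then q i else 0)"
    if i: "i < n" and j: "j < n" for i j
  proof (cases "i = j")
    case True
    then show ?thesis using one[OF i, of "\<lambda>x. (g i x)\<^sup>2" "q i"] g2[OF i] by (simp add: power2_eq_square)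
  next
    case False
    let ?f = "\<lambda>k. if k = i then g i else if k = j then g j else (\<lambda>_. 1)"
    have "has_bochner_integral (iso_normal n m v) (\<lambda>x. \<Prod>k<n. ?f k (x k)) (\<Prod>k<n. \<integral>x. ?f k x \<partial>normal_law (m k) v)"
      using g1 i j N1 by (intro prod) (auto simp: has_bochner_integral_iff)
    moreover have "(\<Prod>k<n. ?f k (x k)) = g i (x i) * g j (x j)" for x
      using i j False by (subst prod.remove[of _ i], simp, simp, subst prod.remove[of _ j]) (auto intro!: prod.neutral)
    moreover have "(\<Prod>k<n. \<integral>x. ?f k x \<partial>normal_law (m k) v) = 0"
      using i g1[OF i] by (intro prod_zero) (auto simp: has_bochner_integral_iff intro!: bexI[of _ i])
    ultimately show ?thesis using False by simp
  qed
  have c: "has_bochner_integral (iso_normal n m v) (\<lambda>_. c\<^sup>2) (c\<^sup>2)"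
    by (intro has_bochner_integral_prob_const prob_space_iso_normal v)
  have "has_bochner_integral (iso_normal n m v) (\<lambda>x. c\<^sup>2 + 2 * c * (\<Sum>i<n. g i (x i)) + (\<Sum>i<n. \<Sum>j<n. g i (x i) * g j (x j)))
     (c\<^sup>2 + 2 * c * (\<Sum>i<n. 0) + (\<Sum>i<n. \<Sum>j<n. if i = j then q i else 0))"
    by (intro has_bochner_integral_add has_bochner_integral_mult_right has_bochner_integral_sum one two c g1) auto
  moreover have "c\<^sup>2 + 2 * c * (\<Sum>i<n. 0) + (\<Sum>i<n. \<Sum>j<n. if i = j then q i else 0) = c\<^sup>2 + (\<Sum>i<n. q i)"
    by simp
  moreover have "(\<lambda>x. c\<^sup>2 + 2 * c * (\<Sum>i<n. g i (x i)) + (\<Sum>i<n. \<Sum>j<n. g i (x i) * g j (x j))) = (\<lambda>x. (c + (\<Sum>i<n. g i (x i)))\<^sup>2)"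
  proof
    fix x :: "nat \<Rightarrow> real"
    have "c\<^sup>2 + 2 * c * S + S * S = (c + S)\<^sup>2" for S by (simp add: power2_eq_square algebra_simps)
    then show "c\<^sup>2 + 2 * c * (\<Sum>i<n. g i (x i)) + (\<Sum>i<n. \<Sum>j<n. g i (x i) * g j (x j)) = (c + (\<Sum>i<n. g i (x i)))\<^sup>2"
      by (simp only: sum_product[symmetric])
  qed
  ultimately show ?thesis
    by (simp only:)
qed

text \<open>Bias plus variance, row by row: the mean joins the constant term, and the noise is
  collected by the squared Frobenius norm of the linear part. All trace terms of the conditional
  errors come from here.\<close>

lemma has_integral_iso_normal_affine_sq:
  assumes v: "v > 0"
  shows "has_bochner_integral (iso_normal n m v) (\<lambda>x. \<Sum>i<k. (c i + (\<Sum>j<n. a i j * x j))\<^sup>2)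
    ((\<Sum>i<k. (c i + (\<Sum>j<n. a i j * m j))\<^sup>2) + v * (\<Sum>i<k. \<Sum>j<n. (a i j)\<^sup>2))"
proof -
  have "has_bochner_integral (iso_normal n m v) (\<lambda>x. (c i + (\<Sum>j<n. a i j * x j))\<^sup>2)
    ((c i + (\<Sum>j<n. a i j * m j))\<^sup>2 + (\<Sum>j<n. (a i j)\<^sup>2 * v))" for i
  proof -
    have "has_bochner_integral (normal_law (m j) v) (\<lambda>x. a i j * (x - m j)) 0" 
      "has_bochner_integral (normal_law (m j) v) (\<lambda>x. (a i j * (x - m j))\<^sup>2) ((a i j)\<^sup>2 * v)" for j
      using has_bochner_integral_mult_right[OF normal_law_moments(1)[OF v, of "m j"], of "a i j"] 
        has_bochner_integral_mult_right[OF normal_law_moments(2)[OF v, of "m j"], of "(a i j)\<^sup>2"]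
      by (simp_all add: power_mult_distrib)
    from has_integral_iso_normal_sum_sq[where m=m and g = "\<lambda>j x. a i j * (x - m j)" and c = "c i + (\<Sum>j<n. a i j * m j)" and n = n, OF v this]
    show ?thesis by (simp add: algebra_simps sum_subtractf)
  qed
  then have "has_bochner_integral (iso_normal n m v) (\<lambda>x. \<Sum>i<k. (c i + (\<Sum>j<n. a i j * x j))\<^sup>2)
    (\<Sum>i<k. (c i + (\<Sum>j<n. a i j * m j))\<^sup>2 + (\<Sum>j<n. (a i j)\<^sup>2 * v))"
    by (intro has_bochner_integral_sum)
  then show ?thesis
    by (simp add: sum.distrib sum_distrib_left mult.commute)
qed

text \<open>Up to the factor 1 / (4 v^4) this is the second moment of the score in \<open>v\<close>.
  Each (x - m)^2 - v is centred with second moment 3 v^2 - 2 v^2 + v^2.\<close>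

lemma has_integral_sq_dist_deviation:
  assumes v: "v > 0"
  shows "has_bochner_integral (iso_normal n m v) (\<lambda>x. (sq_dist n x m - real n * v)\<^sup>2) (2 * real n * v\<^sup>2)"
proof -
  have N1: "has_bochner_integral (normal_law (m k) v) (\<lambda>_. c) c" for k and c :: real
    by (intro has_bochner_integral_prob_const prob_space_normal v)
  have "has_bochner_integral (normal_law (m j) v) (\<lambda>x. (x - m j)\<^sup>2 - v) (v - v)" for j
    by (intro has_bochner_integral_diff normal_law_moments N1 v)
  then have m0: "has_bochner_integral (normal_law (m j) v) (\<lambda>x. (x - m j)\<^sup>2 - v) 0" for j
    by simp
  have "has_bochner_integral (normal_law (m j) v) (\<lambda>x. (x - m j)^4 - 2 * v * (x - m j)\<^sup>2 + v\<^sup>2) (3 * v\<^sup>2 - 2 * v * v + v\<^sup>2)" for j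
    by (intro has_bochner_integral_diff has_bochner_integral_add has_bochner_integral_mult_right normal_law_moments N1 v)
  moreover have "a^4 - 2 * v * a\<^sup>2 + v\<^sup>2 = (a\<^sup>2 - v)\<^sup>2" for a :: real
    by (simp add: power2_diff power_mult[symmetric])
  ultimately have "has_bochner_integral (normal_law (m j) v) (\<lambda>x. ((x - m j)\<^sup>2 - v)\<^sup>2) (2 * v\<^sup>2)" for j
    by (simp add: power2_eq_square[of v])
  from has_integral_iso_normal_sum_sq[where m=m and g = "\<lambda>j x. (x - m j)\<^sup>2 - v" and q = "\<lambda>_. 2 * v\<^sup>2" and c = 0 and n=n, OF v m0 this]
  show ?thesis
    by (simp add: sq_dist_def sum_subtractf mult_ac)
qed

section \<open>The largest projection of a Gaussian vector\<close>

text \<open>Exponential tilting: the factor moves the centre of the density from m to m + v b, and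
  the tilted density again has total mass 1.\<close>

lemma normal_density_mgf:
  assumes v: "v > 0"
  shows "(\<integral>\<^sup>+x. ennreal (normal_density m (sqrt v) x) * ennreal (exp (b * (x - m))) \<partial>lborel) = ennreal (exp (v * b\<^sup>2 / 2))"
proof -
  have "normal_density m (sqrt v) x * exp (b * (x - m)) = exp (v * b\<^sup>2 / 2) * normal_density (m + v * b) (sqrt v) x" for x
  proof -
    have "- ((x - m)\<^sup>2 / (2 * v)) + b * (x - m) = v * b\<^sup>2 / 2 - ((x - (m + v * b))\<^sup>2 / (2 * v))"
      using v by (simp add: field_simps power2_eq_square)
    then have "exp (- (1/2) * ln (2 * pi * v) - (x - m)\<^sup>2 / (2 * v)) * exp (b * (x - m)) = exp (v * b\<^sup>2 / 2) * exp (- (1/2) * ln (2 * pi * v) - (x - (m + v * b))\<^sup>2 / (2 * v))"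
      unfolding exp_add[symmetric] by simp
    then show ?thesis using v by (simp only: normal_density_exp)
  qed
  then have "(\<integral>\<^sup>+x. ennreal (normal_density m (sqrt v) x) * ennreal (exp (b * (x - m))) \<partial>lborel)
     = (\<integral>\<^sup>+x. ennreal (exp (v * b\<^sup>2 / 2)) * ennreal (normal_density (m + v * b) (sqrt v) x) \<partial>lborel)"
    by (simp add: ennreal_mult[symmetric])
  also have "\<dots> = ennreal (exp (v * b\<^sup>2 / 2)) * emeasure (density lborel (\<lambda>x. ennreal (normal_density (m + v * b) (sqrt v) x))) UNIV"
    by (subst nn_integral_cmult) (auto simp: emeasure_density)
  also have "emeasure (density lborel (\<lambda>x. ennreal (normal_density (m + v * b) (sqrt v) x))) UNIV = 1"
    using prob_space.emeasure_space_1[OF prob_space_normal[OF v, of "m + v * b"]] by simp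
  finally show ?thesis by simp
qed

lemma iso_normal_mgf:
  assumes v: "v > 0"
  shows "(\<integral>\<^sup>+x. ennreal (exp (\<Sum>j<n. b j * (x j - m j))) \<partial>iso_normal n m v) = ennreal (exp (v * (\<Sum>j<n. (b j)\<^sup>2) / 2))"
proof -
  interpret N: product_sigma_finite "\<lambda>i. density lborel (\<lambda>x. ennreal (normal_density (m i) (sqrt v) x))"
    using prob_space_normal[OF v] by (auto simp: product_sigma_finite_def prob_space_imp_sigma_finite)
  have "(\<integral>\<^sup>+x. ennreal (exp (\<Sum>j<n. b j * (x j - m j))) \<partial>iso_normal n m v)
     = (\<integral>\<^sup>+x. (\<Prod>j\<in>{..<n}. ennreal (exp (b j * (x j - m j)))) \<partial>iso_normal n m v)"
    by (simp add: exp_sum prod_ennreal)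
  also have "\<dots> = (\<Prod>j\<in>{..<n}. \<integral>\<^sup>+x. ennreal (exp (b j * (x - m j))) \<partial>density lborel (\<lambda>x. ennreal (normal_density (m j) (sqrt v) x)))"
    unfolding iso_normal_def by (intro N.product_nn_integral_prod) auto
  also have "\<dots> = (\<Prod>j\<in>{..<n}. ennreal (exp (v * (b j)\<^sup>2 / 2)))"
    by (intro prod.cong refl) (simp add: nn_integral_density normal_density_mgf[OF v])
  also have "\<dots> = ennreal (exp (v * (\<Sum>j<n. (b j)\<^sup>2) / 2))"
    by (simp add: prod_ennreal exp_sum[symmetric] sum_distrib_left sum_divide_distrib)
  finally show ?thesis .
qed

text \<open>The product under the integral is sqrt 2 times the centred normal density of variance
  2.\<close>

lemma nn_integral_std_normal_exp_square:
  "(\<integral>\<^sup>+t. ennreal (normal_density 0 1 t) * ennreal (exp (t\<^sup>2 / 4)) \<partial>lborel) = ennreal (sqrt 2)"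
proof -
  have "normal_density 0 1 t * exp (t\<^sup>2 / 4) = sqrt 2 * normal_density 0 (sqrt 2) t" for t
    by (simp add: normal_density_def real_sqrt_mult exp_add[symmetric] field_simps)
  then have "(\<integral>\<^sup>+t. ennreal (normal_density 0 1 t) * ennreal (exp (t\<^sup>2 / 4)) \<partial>lborel) 
     = (\<integral>\<^sup>+t. ennreal (sqrt 2) * ennreal (normal_density 0 (sqrt 2) t) \<partial>lborel)"
    by (simp add: ennreal_mult[symmetric])
  also have "\<dots> = ennreal (sqrt 2) * emeasure (density lborel (\<lambda>x. ennreal (normal_density 0 (sqrt 2) x))) UNIV"
    by (subst nn_integral_cmult) (auto simp: emeasure_density)
  also have "emeasure (density lborel (\<lambda>x. ennreal (normal_density 0 (sqrt 2) x))) UNIV = 1"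
    using prob_space.emeasure_space_1[OF prob_space_normal[of 2 0]] by simp
  finally show ?thesis by simp
qed

text \<open>\<open>exp (u\<^sup>2 / 4)\<close> is itself a Gaussian average of \<open>exp (t u / sqrt 2)\<close>; exchanging the two
  averages reduces the claim to the moment generating function.\<close>

lemma iso_normal_exp_square:
  assumes v: "v > 0" and q: "q > 0" "(\<Sum>j<n. (a j)\<^sup>2) = q"
  shows "(\<integral>\<^sup>+x. ennreal (exp ((\<Sum>j<n. a j * (x j - m j))\<^sup>2 / (4 * v * q))) \<partial>iso_normal n m v) = ennreal (sqrt 2)"
proof -
  define L where "L x = (\<Sum>j<n. a j * (x j - m j))" for x
  interpret P: prob_space "iso_normal n m v" by (rule prob_space_iso_normal[OF v])
  interpret PL: pair_sigma_finite "iso_normal n m v" lborel by standard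
  have Lm: "L \<in> borel_measurable (Rn_lborel n)" unfolding L_def[abs_def] using component_measurable_Rn[measurable] by measurable
  have L [measurable]: "L \<in> borel_measurable (iso_normal n m v)"
    using Lm by (simp add: measurable_iso_normal_eq)
  \<comment> \<open>The form L has variance v q, so \<open>c * L x\<close> is its standardisation
    divided by sqrt 2. At this scale the average over t is exp (L^2 / (4 v q)), and the average over
    x leaves exp (t^2 / 4).\<close>
  define c where "c = 1 / sqrt (2 * v * q)"
  have c2: "c\<^sup>2 * v * q = 1 / 2" using v q by (simp add: c_def power_divide)
  have "ennreal (exp ((L x)\<^sup>2 / (4 * v * q))) = (\<integral>\<^sup>+t. ennreal (normal_density 0 1 t) * ennreal (exp (c * L x * t)) \<partial>lborel)" for x
  proof -
    have "c\<^sup>2 = 1 / (2 * v * q)" using v q by (simp add: c_def power_divide)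
    then show ?thesis
      using normal_density_mgf[of 1 0 "c * L x"] by (simp add: power_mult_distrib mult.commute)
  qed
  then have "(\<integral>\<^sup>+x. ennreal (exp ((L x)\<^sup>2 / (4 * v * q))) \<partial>iso_normal n m v)
    = (\<integral>\<^sup>+x. \<integral>\<^sup>+t. ennreal (normal_density 0 1 t) * ennreal (exp (c * L x * t)) \<partial>lborel \<partial>iso_normal n m v)"
    by simp
  also have "\<dots> = (\<integral>\<^sup>+t. \<integral>\<^sup>+x. ennreal (normal_density 0 1 t) * ennreal (exp (c * L x * t)) \<partial>iso_normal n m v \<partial>lborel)"
    by (intro PL.Fubini'[symmetric]) measurable
  also have "\<dots> = (\<integral>\<^sup>+t. ennreal (normal_density 0 1 t) * ennreal (exp (t\<^sup>2 / 4)) \<partial>lborel)"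
  proof (intro nn_integral_cong)
    fix t :: real
    have "(\<integral>\<^sup>+x. ennreal (normal_density 0 1 t) * ennreal (exp (c * L x * t)) \<partial>iso_normal n m v)
      = ennreal (normal_density 0 1 t) * (\<integral>\<^sup>+x. ennreal (exp (c * L x * t)) \<partial>iso_normal n m v)"
      by (intro nn_integral_cmult) measurable
    also have "(\<integral>\<^sup>+x. ennreal (exp (c * L x * t)) \<partial>iso_normal n m v) = (\<integral>\<^sup>+x. ennreal (exp (\<Sum>j<n. (t * c * a j) * (x j - m j))) \<partial>iso_normal n m v)"
      by (simp add: L_def sum_distrib_left sum_distrib_right mult_ac)
    also have "(\<integral>\<^sup>+x. ennreal (exp (\<Sum>j<n. (t * c * a j) * (x j - m j))) \<partial>iso_normal n m v) = ennreal (exp (v * (\<Sum>j<n. (t * c * a j)\<^sup>2) / 2))"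
      by (rule iso_normal_mgf[OF v])
    also have "v * (\<Sum>j<n. (t * c * a j)\<^sup>2) / 2 = t\<^sup>2 * (c\<^sup>2 * v * q) / 2"
      by (simp add: power_mult_distrib sum_distrib_left[symmetric] q)
    also have "\<dots> = t\<^sup>2 / 4" by (simp add: c2)
    finally show "(\<integral>\<^sup>+x. ennreal (normal_density 0 1 t) * ennreal (exp (c * L x * t)) \<partial>iso_normal n m v) = ennreal (normal_density 0 1 t) * ennreal (exp (t\<^sup>2 / 4))" .
  qed
  finally show ?thesis by (simp add: nn_integral_std_normal_exp_square L_def)
qed

text \<open>An orthogonal projection given by its entries below \<open>n\<close>, so that the
  probabilistic part deals with finite sums only and not with the matrix type.\<close>

locale projection =
  fixes n :: nat and h :: "nat \<Rightarrow> nat \<Rightarrow> real"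
  assumes sym: "\<And>i j. i < n \<Longrightarrow> j < n \<Longrightarrow> h i j = h j i"
    and idem: "\<And>i k. i < n \<Longrightarrow> k < n \<Longrightarrow> (\<Sum>j<n. h i j * h j k) = h i k"
begin

text \<open>The diagonal of H H^T = H. Hence the i-th coordinate of H z has variance h_ii times that
  of the isotropic z.\<close>

lemma row_sq:
  assumes i: "i < n"
  shows "(\<Sum>j<n. (h i j)\<^sup>2) = h i i"
proof -
  have "(\<Sum>j<n. (h i j)\<^sup>2) = (\<Sum>j<n. h i j * h j i)"
  proof (rule sum.cong)
    fix j assume "j \<in> {..<n}"
    then have "h j i = h i j" using sym[of j i] i by simp
    then show "(h i j)\<^sup>2 = h i j * h j i" by (simp add: power2_eq_square)
  qed simp
  then show ?thesis using idem[OF i i] by simp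
qed

lemma diag_nonneg: "i < n \<Longrightarrow> 0 \<le> h i i"
  using row_sq[of i] sum_nonneg[of "{..<n}" "\<lambda>j. (h i j)\<^sup>2"] by simp

lemma diag_le_1: assumes "i < n" shows "h i i \<le> 1"
proof -
  have "(h i i)\<^sup>2 \<le> (\<Sum>j<n. (h i j)\<^sup>2)" using assms by (intro member_le_sum) auto
  then have "h i i * h i i \<le> h i i * 1" using row_sq[OF assms] by (simp add: power2_eq_square)
  then show ?thesis using diag_nonneg[OF assms] by (cases "h i i = 0") (auto dest: mult_left_le_imp_le)
qed

text \<open>The coordinates of H z are dependent, so Jensen's inequality is applied pointwise,
  before integration. Each coordinate is then compared with its own variance v h_ii, for which
  \<open>iso_normal_exp_square\<close> gives the mean sqrt 2, rounded up to 2.\<close>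

lemma proj_exp_bound:
  assumes v: "v > 0" and \<kappa>: "(\<Sum>i<n. h i i) \<le> \<kappa>"
  shows "(\<integral>\<^sup>+x. ennreal (exp ((\<Sum>i<n. (\<Sum>j<n. h i j * (x j - m j))\<^sup>2) / (4 * v * \<kappa>))) \<partial>iso_normal n m v) \<le> ennreal 2"
proof -
  interpret P: prob_space "iso_normal n m v" by (rule prob_space_iso_normal[OF v])
  define k where "k = (\<Sum>i<n. h i i)"
  define L where "L i x = (\<Sum>j<n. h i j * (x j - m j))" for i x
  have k0: "k \<ge> 0" unfolding k_def using diag_nonneg by (intro sum_nonneg) auto
  \<comment> \<open>A row with h_ii = 0 vanishes, so such an index contributes 0 although its
    rescaled term divides by zero.\<close>
  have zero: "L i x = 0" if "i < n" "h i i = 0" for i x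
  proof -
    have "\<forall>j\<in>{..<n}. (h i j)\<^sup>2 = 0" using row_sq[OF that(1)] that(2) sum_nonneg_eq_0_iff[of "{..<n}" "\<lambda>j. (h i j)\<^sup>2"] by simp
    then show ?thesis by (auto simp: L_def)
  qed
  have L: "L i \<in> borel_measurable (iso_normal n m v)" for i
    unfolding L_def[abs_def] measurable_iso_normal_eq using component_measurable_Rn[measurable] by measurable
  have pt: "exp ((\<Sum>i<n. (L i x)\<^sup>2) / (4 * v * \<kappa>)) \<le> (\<Sum>i<n. (h i i / k) * exp ((L i x)\<^sup>2 / (4 * v * h i i)))" if k: "k > 0" for x
  proof -
    have "(\<Sum>i<n. (L i x)\<^sup>2) / (4 * v * \<kappa>) \<le> (\<Sum>i<n. (L i x)\<^sup>2) / (4 * v * k)"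
      using \<kappa> k v by (intro divide_left_mono mult_pos_pos sum_nonneg) (auto simp: k_def)
    also have "\<dots> = (\<Sum>i<n. (h i i / k) *\<^sub>R ((L i x)\<^sup>2 / (4 * v * h i i)))"
      unfolding sum_divide_distrib
    proof (intro sum.cong refl)
      fix i assume "i \<in> {..<n}"
      then show "(L i x)\<^sup>2 / (4 * v * k) = (h i i / k) *\<^sub>R ((L i x)\<^sup>2 / (4 * v * h i i))"
        using zero[of i x] by (cases "h i i = 0") auto
    qed
    finally have "exp ((\<Sum>i<n. (L i x)\<^sup>2) / (4 * v * \<kappa>)) \<le> exp (\<Sum>i<n. (h i i / k) *\<^sub>R ((L i x)\<^sup>2 / (4 * v * h i i)))" by simp
    also have "\<dots> \<le> (\<Sum>i<n. (h i i / k) * exp ((L i x)\<^sup>2 / (4 * v * h i i)))"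
    proof (rule convex_on_sum)
      show "convex_on UNIV (exp :: real \<Rightarrow> real)" using exp_convex .
      show "(\<Sum>i<n. h i i / k) = 1" using k by (simp add: sum_divide_distrib[symmetric] k_def)
      show "{..<n} \<noteq> {}" using k by (auto simp: k_def)
    qed (use k diag_nonneg in auto)
    finally show ?thesis .
  qed
  show ?thesis
  proof (cases "k = 0")
    case True
    then have "h i i = 0" if "i < n" for i
      using that diag_nonneg sum_nonneg_eq_0_iff[of "{..<n}" "\<lambda>i. h i i"] by (auto simp: k_def)
    then have "(\<Sum>i<n. (L i x)\<^sup>2) = 0" for x using zero by simp
    then show ?thesis using P.emeasure_space_1 by (simp add: L_def)
  next
    case False
    then have k: "k > 0" using k0 by simp
    have "(\<integral>\<^sup>+x. ennreal (exp ((\<Sum>i<n. (L i x)\<^sup>2) / (4 * v * \<kappa>))) \<partial>iso_normal n m v)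
      \<le> (\<integral>\<^sup>+x. (\<Sum>i<n. ennreal (h i i / k) * ennreal (exp ((L i x)\<^sup>2 / (4 * v * h i i)))) \<partial>iso_normal n m v)"
    proof (rule nn_integral_mono)
      fix x
      have "ennreal (exp ((\<Sum>i<n. (L i x)\<^sup>2) / (4 * v * \<kappa>))) \<le> ennreal (\<Sum>i<n. (h i i / k) * exp ((L i x)\<^sup>2 / (4 * v * h i i)))"
        by (intro ennreal_leI pt k)
      also have "\<dots> = (\<Sum>i<n. ennreal (h i i / k * exp ((L i x)\<^sup>2 / (4 * v * h i i))))"
        using diag_nonneg k by (intro sum_ennreal[symmetric]) simp
      also have "\<dots> = (\<Sum>i<n. ennreal (h i i / k) * ennreal (exp ((L i x)\<^sup>2 / (4 * v * h i i))))"
        using diag_nonneg k by (intro sum.cong refl ennreal_mult) auto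
      finally show "ennreal (exp ((\<Sum>i<n. (L i x)\<^sup>2) / (4 * v * \<kappa>))) \<le> (\<Sum>i<n. ennreal (h i i / k) * ennreal (exp ((L i x)\<^sup>2 / (4 * v * h i i))))" .
    qed
    also have "\<dots> = (\<Sum>i<n. ennreal (h i i / k) * (\<integral>\<^sup>+x. ennreal (exp ((L i x)\<^sup>2 / (4 * v * h i i))) \<partial>iso_normal n m v))"
      using L by (simp add: nn_integral_sum nn_integral_cmult)
    also have "\<dots> \<le> (\<Sum>i<n. ennreal (h i i / k) * ennreal 2)"
    proof (intro sum_mono)
      fix i assume i: "i \<in> {..<n}"
      show "ennreal (h i i / k) * (\<integral>\<^sup>+x. ennreal (exp ((L i x)\<^sup>2 / (4 * v * h i i))) \<partial>iso_normal n m v) \<le> ennreal (h i i / k) * ennreal 2"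
      proof (cases "h i i = 0")
        case False
        then have p: "h i i > 0" using diag_nonneg[of i] i by simp
        have "ennreal (sqrt 2) \<le> ennreal 2" using real_sqrt_le_mono[of 2 4] by (intro ennreal_leI) simp
        then show ?thesis
          using iso_normal_exp_square[OF v p row_sq, of m] i by (intro mult_left_mono) (auto simp: L_def ennreal_leI)
      qed simp
    qed
    also have "\<dots> = ennreal (\<Sum>i<n. h i i / k) * ennreal 2"
      unfolding sum_distrib_right[symmetric] using diag_nonneg k by (subst sum_ennreal) auto
    also have "(\<Sum>i<n. h i i / k) = 1" using k by (simp add: sum_divide_distrib[symmetric] k_def)
    finally show ?thesis by (simp add: L_def)
  qed
qed

end

text \<open>Replaces the squared logarithm of a random variable by the variable itself, whose mean
  is known. Apply ln y \<le> y to the square root.\<close>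

lemma ln_sq_le: assumes "x \<ge> (1::real)" shows "(ln x)\<^sup>2 \<le> 4 * x"
proof -
  have "ln x = 2 * ln (sqrt x)" using assms by (simp add: ln_sqrt)
  also have "\<dots> \<le> 2 * sqrt x" using ln_bound[of "sqrt x"] assms by simp
  finally have "(ln x)\<^sup>2 \<le> (2 * sqrt x)\<^sup>2" using assms by (intro power_mono) auto
  then show ?thesis using assms by (simp add: power_mult_distrib)
qed

text \<open>The union bound in logarithmic form. With Z the average of the exponentials over
  \<open>S\<close>, the selected one is at most N Z, so G / (4 v \<kappa>) \<le> ln N + ln Z.
  Squaring, (ln Z)^2 \<le> 4 Z and a mean of Z of at most 2 give 2 (ln N)^2 + 16; the prefactor is
  (4 v \<kappa>)^2.\<close>

lemma projection_max_bound:
  fixes h :: "'m \<Rightarrow> nat \<Rightarrow> nat \<Rightarrow> real"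
  assumes v: "v > 0" and fin: "finite S" and ne: "S \<noteq> {}"
    and pr: "\<And>M. M \<in> S \<Longrightarrow> projection n (h M)"
    and \<kappa>: "\<kappa> > 0" "\<And>M. M \<in> S \<Longrightarrow> (\<Sum>i<n. h M i i) \<le> \<kappa>"
    and sel: "\<And>x. x \<in> Rn n \<Longrightarrow> sel x \<in> S"
  shows "(\<integral>\<^sup>+x. ennreal ((\<Sum>i<n. (\<Sum>j<n. h (sel x) i j * (x j - m j))\<^sup>2)\<^sup>2) \<partial>iso_normal n m v)
     \<le> ennreal (16 * v\<^sup>2 * \<kappa>\<^sup>2 * (2 * (ln (card S))\<^sup>2 + 16))"
proof -
  interpret P: prob_space "iso_normal n m v" by (rule prob_space_iso_normal[OF v])
  define N where "N = real (card S)"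
  have N: "N \<ge> 1" using fin ne by (simp add: N_def Suc_leI card_gt_0_iff)
  define G where "G M x = (\<Sum>i<n. (\<Sum>j<n. h M i j * (x j - m j))\<^sup>2)" for M x
  define E where "E M x = exp (G M x / (4 * v * \<kappa>))" for M x
  have G0: "G M x \<ge> 0" for M x unfolding G_def by (intro sum_nonneg) auto
  have E1: "E M x \<ge> 1" for M x unfolding E_def using G0[of M x] v \<kappa>(1) by simp
  have Gm: "G M \<in> borel_measurable (Rn_lborel n)" for M
    unfolding G_def[abs_def] using component_measurable_Rn[measurable] by measurable
  then have Em: "E M \<in> borel_measurable (iso_normal n m v)" for M
    unfolding E_def[abs_def] measurable_iso_normal_eq by measurable
  define Z where "Z x = (\<Sum>M\<in>S. E M x) / N" for x
  have Zm: "Z \<in> borel_measurable (iso_normal n m v)"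
    unfolding Z_def[abs_def] using Em by (intro borel_measurable_divide borel_measurable_sum) auto
  have Z1: "Z x \<ge> 1" for x
  proof -
    have "(\<Sum>M\<in>S. 1) \<le> (\<Sum>M\<in>S. E M x)" using E1 by (intro sum_mono)
    then show ?thesis using N by (simp add: Z_def N_def)
  qed
  have pt: "(G (sel x) x)\<^sup>2 \<le> 16 * v\<^sup>2 * \<kappa>\<^sup>2 * (2 * (ln N)\<^sup>2 + 8 * Z x)" if x: "x \<in> Rn n" for x
  proof -
    have "E (sel x) x \<le> (\<Sum>M\<in>S. E M x)"
      using fin sel[OF x] E1 by (intro member_le_sum) (auto intro: order_trans[OF zero_le_one])
    also have "\<dots> = N * Z x" using N by (simp add: Z_def)
    finally have "ln (E (sel x) x) \<le> ln (N * Z x)" using E1[of "sel x" x] N Z1[of x] by (subst ln_le_cancel_iff) auto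
    then have "G (sel x) x / (4 * v * \<kappa>) \<le> ln N + ln (Z x)"
      using N Z1[of x] by (simp add: E_def ln_mult)
    then have "(G (sel x) x / (4 * v * \<kappa>))\<^sup>2 \<le> (ln N + ln (Z x))\<^sup>2"
      using G0 v \<kappa>(1) by (intro power_mono) auto
    also have "\<dots> \<le> 2 * (ln N)\<^sup>2 + 2 * (ln (Z x))\<^sup>2"
      using sum_squares_bound[of "ln N" "ln (Z x)"] by (simp add: power2_sum)
    also have "\<dots> \<le> 2 * (ln N)\<^sup>2 + 8 * Z x" using ln_sq_le[OF Z1, of x] by simp
    finally have "(4 * v * \<kappa>)\<^sup>2 * (G (sel x) x / (4 * v * \<kappa>))\<^sup>2 \<le> (4 * v * \<kappa>)\<^sup>2 * (2 * (ln N)\<^sup>2 + 8 * Z x)"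
      by (intro mult_left_mono) auto
    then show ?thesis using v \<kappa>(1) by (simp add: power_mult_distrib power_divide)
  qed
  have "(\<integral>\<^sup>+x. ennreal (Z x) \<partial>iso_normal n m v) = (\<integral>\<^sup>+x. ennreal (1 / N) * (\<Sum>M\<in>S. ennreal (E M x)) \<partial>iso_normal n m v)"
    using N E1 by (intro nn_integral_cong) (simp add: Z_def sum_ennreal order_trans[OF zero_le_one] ennreal_mult'[symmetric])
  also have "\<dots> = ennreal (1 / N) * (\<Sum>M\<in>S. \<integral>\<^sup>+x. ennreal (E M x) \<partial>iso_normal n m v)"
    using Em by (simp add: nn_integral_cmult nn_integral_sum)
  also have "\<dots> \<le> ennreal (1 / N) * (\<Sum>M\<in>S. ennreal 2)"
    using projection.proj_exp_bound[OF pr v \<kappa>(2)] by (intro mult_left_mono sum_mono) (auto simp: E_def G_def)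
  also have "(\<Sum>M\<in>S. ennreal 2) = ennreal (N * 2)"
    by (simp add: N_def ennreal_mult' ennreal_of_nat_eq_real_of_nat)
  also have "ennreal (1 / N) * ennreal (N * 2) = ennreal 2"
    using N by (subst ennreal_mult'[symmetric]) auto
  finally have Z2: "(\<integral>\<^sup>+x. ennreal (Z x) \<partial>iso_normal n m v) \<le> ennreal 2" .
  define A where "A = 16 * v\<^sup>2 * \<kappa>\<^sup>2"
  have A: "A \<ge> 0" by (simp add: A_def)
  have "(\<integral>\<^sup>+x. ennreal ((G (sel x) x)\<^sup>2) \<partial>iso_normal n m v) \<le> (\<integral>\<^sup>+x. ennreal (A * (2 * (ln N)\<^sup>2)) + ennreal (A * 8) * ennreal (Z x) \<partial>iso_normal n m v)"
  proof (rule nn_integral_mono)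
    fix x assume "x \<in> space (iso_normal n m v)"
    then have "(G (sel x) x)\<^sup>2 \<le> A * (2 * (ln N)\<^sup>2) + A * 8 * Z x"
      using pt[of x] by (simp add: A_def algebra_simps)
    then have "ennreal ((G (sel x) x)\<^sup>2) \<le> ennreal (A * (2 * (ln N)\<^sup>2) + A * 8 * Z x)"
      by (rule ennreal_leI)
    also have "\<dots> = ennreal (A * (2 * (ln N)\<^sup>2)) + ennreal (A * 8) * ennreal (Z x)"
      using A Z1[of x] by (subst ennreal_plus) (auto simp: ennreal_mult')
    finally show "ennreal ((G (sel x) x)\<^sup>2) \<le> ennreal (A * (2 * (ln N)\<^sup>2)) + ennreal (A * 8) * ennreal (Z x)" .
  qed
  also have "\<dots> = ennreal (A * (2 * (ln N)\<^sup>2)) + ennreal (A * 8) * (\<integral>\<^sup>+x. ennreal (Z x) \<partial>iso_normal n m v)"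
    using Zm P.emeasure_space_1 by (simp add: nn_integral_add nn_integral_cmult)
  also have "\<dots> \<le> ennreal (A * (2 * (ln N)\<^sup>2)) + ennreal (A * 8) * ennreal 2"
    using Z2 by (intro add_left_mono mult_left_mono) auto
  also have "\<dots> = ennreal (A * (2 * (ln N)\<^sup>2 + 16))"
  proof -
    have "ennreal (A * 8) * ennreal 2 = ennreal (A * 16)" using A by (subst ennreal_mult'[symmetric]) auto
    then show ?thesis using A by (simp only:) (subst ennreal_plus[symmetric], auto simp: algebra_simps)
  qed
  finally show ?thesis by (simp add: A_def N_def G_def)
qed

section \<open>Lipschitz dependence on the variance\<close>

lemma gauss_dens_deriv:
  assumes t: "t > 0"
  shows "((\<lambda>t. gauss_dens n m t x) has_real_derivative gauss_dens n m t x * ((sq_dist n x m - real n * t) / (2 * t\<^sup>2))) (at t)"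
proof -
  have "((\<lambda>t. - (real n / 2) * ln (2 * pi * t) - sq_dist n x m / (2 * t)) has_real_derivative (sq_dist n x m - real n * t) / (2 * t\<^sup>2)) (at t)"
    using t by (auto intro!: derivative_eq_intros) (simp_all add: field_simps power2_eq_square)
  from DERIV_fun_exp[OF this] show ?thesis
    unfolding gauss_dens_def .
qed

text \<open>The fundamental theorem of calculus at a fixed point x. A bound by a nonnegative
  integral can be integrated over x with Tonelli, so that no derivative is taken under the integral
  sign.\<close>

lemma gauss_dens_increment:
  assumes t: "0 < t1" "t1 \<le> t2"
  shows "ennreal \<bar>gauss_dens n m t2 x - gauss_dens n m t1 x\<bar>
    \<le> (\<integral>\<^sup>+t. ennreal (gauss_dens n m t x * (\<bar>sq_dist n x m - real n * t\<bar> / (2 * t\<^sup>2))) * indicator {t1..t2} t \<partial>lborel)"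
proof -
  define D where "D t = gauss_dens n m t x * ((sq_dist n x m - real n * t) / (2 * t\<^sup>2))" for t
  have "has_bochner_integral lborel (\<lambda>t. D t * indicator {t1..t2} t) (gauss_dens n m t2 x - gauss_dens n m t1 x)"
  proof (rule has_bochner_integral_FTC_Icc_real)
    fix t assume "t1 \<le> t" "t \<le> t2"
    then have t0: "t > 0" using t by simp
    show "((\<lambda>t. gauss_dens n m t x) has_real_derivative D t) (at t)"
      unfolding D_def by (rule gauss_dens_deriv[OF t0])
    show "isCont D t"
      unfolding D_def using DERIV_isCont[OF gauss_dens_deriv[OF t0]] t0
      by (intro continuous_intros) auto
  qed (rule t(2))
  then have "ennreal (norm (gauss_dens n m t2 x - gauss_dens n m t1 x)) \<le> (\<integral>\<^sup>+t. ennreal (norm (D t * indicator {t1..t2} t)) \<partial>lborel)"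
    unfolding has_bochner_integral_iff using integral_norm_bound_ennreal[of lborel "\<lambda>t. D t * indicator {t1..t2} t"] by simp
  also have "(\<integral>\<^sup>+t. ennreal (norm (D t * indicator {t1..t2} t)) \<partial>lborel) = (\<integral>\<^sup>+t. ennreal (gauss_dens n m t x * (\<bar>sq_dist n x m - real n * t\<bar> / (2 * t\<^sup>2))) * indicator {t1..t2} t \<partial>lborel)"
    by (intro nn_integral_cong) (simp add: D_def abs_mult indicator_def)
  finally show ?thesis by simp
qed

lemma gauss_dens_measurable_pair:
  "(\<lambda>p. gauss_dens n m (snd p) (fst p)) \<in> borel_measurable (Rn_lborel n \<Otimes>\<^sub>M lborel)"
proof -
  have [measurable]: "(\<lambda>p. sq_dist n (fst p) m) \<in> borel_measurable (Rn_lborel n \<Otimes>\<^sub>M (lborel :: real measure))"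
    by (rule measurable_compose[OF measurable_fst sq_dist_measurable])
  show ?thesis unfolding gauss_dens_def by measurable
qed

text \<open>On a probability space the constant 1 is integrable, and |a| \<le> 1 + a^2.\<close>

lemma integrable_of_nn_square:
  fixes g :: "'a \<Rightarrow> real"
  assumes "prob_space M" and g: "g \<in> borel_measurable M" and fin: "(\<integral>\<^sup>+x. ennreal ((g x)\<^sup>2) \<partial>M) < \<infinity>"
  shows "integrable M (\<lambda>x. (g x)\<^sup>2)" "integrable M g"
proof -
  interpret prob_space M by fact
  show 1: "integrable M (\<lambda>x. (g x)\<^sup>2)"
    using g fin by (intro integrableI_bounded) auto
  have "\<bar>a\<bar> \<le> 1 + a\<^sup>2" for a :: real
    using zero_le_power2[of "\<bar>a\<bar> - 1 / 2"] by (simp add: power2_eq_square algebra_simps flip: abs_mult)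
  then show "integrable M g"
    using 1 g by (intro Bochner_Integration.integrable_bound[where g = g and f = "\<lambda>x. 1 + (g x)\<^sup>2"]) auto
qed

lemma normal_expectation_lipschitz:
  assumes t: "0 < t1" "t1 \<le> t2"
    and g: "g \<in> borel_measurable (Rn_lborel n)" and B: "B \<ge> 0"
    and bound: "\<And>t. t1 \<le> t \<Longrightarrow> t \<le> t2 \<Longrightarrow> (\<integral>\<^sup>+x. ennreal ((g x)\<^sup>2) \<partial>iso_normal n m t) \<le> ennreal B"
  shows "\<bar>(\<integral>x. g x \<partial>iso_normal n m t2) - (\<integral>x. g x \<partial>iso_normal n m t1)\<bar> \<le> (t2 - t1) * ((B + 2 * real n * t2\<^sup>2) / (4 * t1\<^sup>2))"
proof -
  let ?R = "Rn_lborel n"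
  interpret R: sigma_finite_measure ?R by (rule sigma_finite_Rn_lborel)
  interpret RL: pair_sigma_finite ?R lborel by standard
  note gauss_dens_measurable [measurable del]
  \<comment> \<open>\<open>K\<close> bounds the mean of (g^2 + (|x - m|^2 - n t)^2) / (4 t^2) for
    all t in the interval: \<open>t2\<close> in the numerator, \<open>t1\<close> in the
    denominator.\<close>
  define K where "K = (B + 2 * real n * t2\<^sup>2) / (4 * t1\<^sup>2)"
  have K0: "K \<ge> 0" using B by (simp add: K_def)
  have fd: "has_bochner_integral ?R (\<lambda>x. gauss_dens n m t x * g x) (\<integral>x. g x \<partial>iso_normal n m t)"
    if "t1 \<le> t" "t \<le> t2" for t
  proof -
    have t0: "t > 0" using that t by simp
    have "(\<integral>\<^sup>+x. ennreal ((g x)\<^sup>2) \<partial>iso_normal n m t) < \<infinity>"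
      using bound[OF that] by (auto intro: le_less_trans)
    then have "integrable (iso_normal n m t) g"
      using g prob_space_iso_normal[OF t0] by (intro integrable_of_nn_square) (auto simp: measurable_iso_normal_eq)
    then show ?thesis
      using g unfolding iso_normal_density[OF t0]
      by (simp add: has_bochner_integral_iff integrable_density integral_density gauss_dens_measurable)
  qed
  have "has_bochner_integral ?R (\<lambda>x. gauss_dens n m t2 x * g x - gauss_dens n m t1 x * g x)
    ((\<integral>x. g x \<partial>iso_normal n m t2) - (\<integral>x. g x \<partial>iso_normal n m t1))"
    using t by (intro has_bochner_integral_diff fd) auto
  then have "ennreal \<bar>(\<integral>x. g x \<partial>iso_normal n m t2) - (\<integral>x. g x \<partial>iso_normal n m t1)\<bar>
     \<le> (\<integral>\<^sup>+x. ennreal (norm (gauss_dens n m t2 x * g x - gauss_dens n m t1 x * g x)) \<partial>?R)"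
    unfolding has_bochner_integral_iff using integral_norm_bound_ennreal[of ?R "\<lambda>x. gauss_dens n m t2 x * g x - gauss_dens n m t1 x * g x"] by simp
  also have "\<dots> = (\<integral>\<^sup>+x. ennreal \<bar>g x\<bar> * ennreal \<bar>gauss_dens n m t2 x - gauss_dens n m t1 x\<bar> \<partial>?R)"
    by (intro nn_integral_cong) (simp add: ennreal_mult'[symmetric] abs_mult[symmetric] algebra_simps)
  also have "\<dots> \<le> (\<integral>\<^sup>+x. ennreal \<bar>g x\<bar> * (\<integral>\<^sup>+t. ennreal (gauss_dens n m t x * (\<bar>sq_dist n x m - real n * t\<bar> / (2 * t\<^sup>2))) * indicator {t1..t2} t \<partial>lborel) \<partial>?R)"
    by (intro nn_integral_mono mult_left_mono gauss_dens_increment t) simp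
  also have "\<dots> \<le> (\<integral>\<^sup>+x. \<integral>\<^sup>+t. ennreal (gauss_dens n m t x * (((g x)\<^sup>2 + (sq_dist n x m - real n * t)\<^sup>2) / (4 * t\<^sup>2))) * indicator {t1..t2} t \<partial>lborel \<partial>?R)"
  proof (rule nn_integral_mono)
    fix x assume x: "x \<in> space ?R"
    define \<phi> where "\<phi> t = gauss_dens n m t x" for t
    have [measurable]: "\<phi> \<in> borel_measurable lborel"
      unfolding \<phi>_def[abs_def] using measurable_Pair2[OF gauss_dens_measurable_pair x] by simp
    have "ennreal \<bar>g x\<bar> * (\<integral>\<^sup>+t. ennreal (gauss_dens n m t x * (\<bar>sq_dist n x m - real n * t\<bar> / (2 * t\<^sup>2))) * indicator {t1..t2} t \<partial>lborel)
      = (\<integral>\<^sup>+t. ennreal \<bar>g x\<bar> * (ennreal (gauss_dens n m t x * (\<bar>sq_dist n x m - real n * t\<bar> / (2 * t\<^sup>2))) * indicator {t1..t2} t) \<partial>lborel)"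
      unfolding \<phi>_def[symmetric] by (intro nn_integral_cmult[symmetric]) measurable
    also have "\<dots> \<le> (\<integral>\<^sup>+t. ennreal (gauss_dens n m t x * (((g x)\<^sup>2 + (sq_dist n x m - real n * t)\<^sup>2) / (4 * t\<^sup>2))) * indicator {t1..t2} t \<partial>lborel)"
    proof (rule nn_integral_mono)
      fix t
      \<comment> \<open>Separates g from the score, so that after exchanging the integrals only
        their two second moments remain.\<close>
      have "2 * (\<bar>g x\<bar> * \<bar>sq_dist n x m - real n * t\<bar>) \<le> (g x)\<^sup>2 + (sq_dist n x m - real n * t)\<^sup>2"
        using sum_squares_bound[of "\<bar>g x\<bar>" "\<bar>sq_dist n x m - real n * t\<bar>"] by simp
      then have "gauss_dens n m t x * (2 * (\<bar>g x\<bar> * \<bar>sq_dist n x m - real n * t\<bar>) / (4 * t\<^sup>2)) \<le> gauss_dens n m t x * (((g x)\<^sup>2 + (sq_dist n x m - real n * t)\<^sup>2) / (4 * t\<^sup>2))"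
        by (intro mult_left_mono divide_right_mono) auto
      then have "\<bar>g x\<bar> * (gauss_dens n m t x * (\<bar>sq_dist n x m - real n * t\<bar> / (2 * t\<^sup>2))) \<le> gauss_dens n m t x * (((g x)\<^sup>2 + (sq_dist n x m - real n * t)\<^sup>2) / (4 * t\<^sup>2))"
        by (simp add: mult_ac)
      then show "ennreal \<bar>g x\<bar> * (ennreal (gauss_dens n m t x * (\<bar>sq_dist n x m - real n * t\<bar> / (2 * t\<^sup>2))) * indicator {t1..t2} t)
         \<le> ennreal (gauss_dens n m t x * (((g x)\<^sup>2 + (sq_dist n x m - real n * t)\<^sup>2) / (4 * t\<^sup>2))) * indicator {t1..t2} t"
        by (auto simp: indicator_def ennreal_mult'[symmetric] intro!: ennreal_leI)
    qed
    finally show "ennreal \<bar>g x\<bar> * (\<integral>\<^sup>+t. ennreal (gauss_dens n m t x * (\<bar>sq_dist n x m - real n * t\<bar> / (2 * t\<^sup>2))) * indicator {t1..t2} t \<partial>lborel)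
      \<le> (\<integral>\<^sup>+t. ennreal (gauss_dens n m t x * (((g x)\<^sup>2 + (sq_dist n x m - real n * t)\<^sup>2) / (4 * t\<^sup>2))) * indicator {t1..t2} t \<partial>lborel)" .
  qed
  also have "\<dots> = (\<integral>\<^sup>+t. \<integral>\<^sup>+x. ennreal (gauss_dens n m t x * (((g x)\<^sup>2 + (sq_dist n x m - real n * t)\<^sup>2) / (4 * t\<^sup>2))) * indicator {t1..t2} t \<partial>?R \<partial>lborel)"
  proof (rule RL.Fubini'[symmetric])
    have [measurable]: "(\<lambda>p. sq_dist n (fst p) m) \<in> borel_measurable (?R \<Otimes>\<^sub>M (lborel :: real measure))"
      "(\<lambda>p. g (fst p)) \<in> borel_measurable (?R \<Otimes>\<^sub>M (lborel :: real measure))"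
      by (rule measurable_compose[OF measurable_fst sq_dist_measurable], rule measurable_compose[OF measurable_fst g])
    note [measurable] = gauss_dens_measurable_pair
    show "(\<lambda>(x, t). ennreal (gauss_dens n m t x * (((g x)\<^sup>2 + (sq_dist n x m - real n * t)\<^sup>2) / (4 * t\<^sup>2))) * indicator {t1..t2} t) \<in> borel_measurable (?R \<Otimes>\<^sub>M lborel)"
      unfolding case_prod_unfold by measurable
  qed
  also have "\<dots> \<le> (\<integral>\<^sup>+t. ennreal K * indicator {t1..t2} t \<partial>lborel)"
  proof (rule nn_integral_mono)
    fix t :: real
    show "(\<integral>\<^sup>+x. ennreal (gauss_dens n m t x * (((g x)\<^sup>2 + (sq_dist n x m - real n * t)\<^sup>2) / (4 * t\<^sup>2))) * indicator {t1..t2} t \<partial>?R) \<le> ennreal K * indicator {t1..t2} t"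
    proof (cases "t \<in> {t1..t2}")
      case True
      then have t0: "t > 0" using t by simp
      have h2: "(\<integral>\<^sup>+x. ennreal ((sq_dist n x m - real n * t)\<^sup>2) \<partial>iso_normal n m t) = ennreal (2 * real n * t\<^sup>2)"
        using has_integral_sq_dist_deviation[OF t0, of n m] by (subst nn_integral_eq_integral) (auto simp: has_bochner_integral_iff)
      have "(\<integral>\<^sup>+x. ennreal (gauss_dens n m t x * (((g x)\<^sup>2 + (sq_dist n x m - real n * t)\<^sup>2) / (4 * t\<^sup>2))) \<partial>?R)
        = (\<integral>\<^sup>+x. ennreal (((g x)\<^sup>2 + (sq_dist n x m - real n * t)\<^sup>2) / (4 * t\<^sup>2)) \<partial>iso_normal n m t)"
        unfolding iso_normal_density[OF t0] using g
        by (subst nn_integral_density) (auto simp: gauss_dens_measurable ennreal_mult'[symmetric])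
      also have "\<dots> = (\<integral>\<^sup>+x. ennreal (1 / (4 * t\<^sup>2)) * (ennreal ((g x)\<^sup>2) + ennreal ((sq_dist n x m - real n * t)\<^sup>2)) \<partial>iso_normal n m t)"
        by (intro nn_integral_cong) (simp add: ennreal_plus[symmetric] ennreal_mult'[symmetric] del: ennreal_plus)
      also have "\<dots> = ennreal (1 / (4 * t\<^sup>2)) * ((\<integral>\<^sup>+x. ennreal ((g x)\<^sup>2) \<partial>iso_normal n m t) + ennreal (2 * real n * t\<^sup>2))"
        using g by (simp add: nn_integral_cmult nn_integral_add measurable_iso_normal_eq h2)
      also have "\<dots> \<le> ennreal (1 / (4 * t\<^sup>2)) * (ennreal B + ennreal (2 * real n * t\<^sup>2))"
        using bound True by (intro mult_left_mono add_right_mono) auto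
      also have "\<dots> = ennreal ((B + 2 * real n * t\<^sup>2) / (4 * t\<^sup>2))"
        using B by (simp add: ennreal_plus[symmetric] ennreal_mult'[symmetric] del: ennreal_plus)
      also have "\<dots> \<le> ennreal K"
        unfolding K_def using True t B by (intro ennreal_leI frac_le add_mono mult_left_mono power_mono) auto
      finally show ?thesis using True by simp
    qed simp
  qed
  also have "\<dots> = ennreal (K * (t2 - t1))"
    using t K0 by (simp add: nn_integral_cmult ennreal_mult')
  finally have "\<bar>(\<integral>x. g x \<partial>iso_normal n m t2) - (\<integral>x. g x \<partial>iso_normal n m t1)\<bar> \<le> K * (t2 - t1)"
    using K0 t by (subst (asm) ennreal_le_iff) auto
  then show ?thesis
    by (simp only: K_def mult.commute)
qed

section \<open>Hat matrices\<close>

lemma resid_sq_eq: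
  assumes "A \<in> carrier_mat n n"
  shows "resid_sq n A u v = (\<Sum>i<n. (u i - (\<Sum>j<n. A $$ (i, j) * v j))\<^sup>2)"
  using assms
  by (auto simp: resid_sq_def Let_def scalar_prod_def power2_eq_square lessThan_atLeast0 intro!: sum.cong)

lemma sum_trace_comm:
  fixes A B :: "real mat"
  assumes "A \<in> carrier_mat n k" "B \<in> carrier_mat k n"
  shows "(\<Sum>i<n. (A * B) $$ (i, i)) = (\<Sum>j<k. (B * A) $$ (j, j))"
proof -
  have "(\<Sum>i<n. (A * B) $$ (i, i)) = (\<Sum>i<n. \<Sum>j<k. A $$ (i, j) * B $$ (j, i))"
    using assms by (auto simp: scalar_prod_def lessThan_atLeast0 intro!: sum.cong)
  also have "\<dots> = (\<Sum>j<k. \<Sum>i<n. B $$ (j, i) * A $$ (i, j))"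
    by (subst sum.swap) (simp add: mult.commute)
  also have "\<dots> = (\<Sum>j<k. (B * A) $$ (j, j))"
    using assms by (auto simp: scalar_prod_def lessThan_atLeast0 intro!: sum.cong)
  finally show ?thesis .
qed

text \<open>With A the selected columns and B the inverse of the Gram matrix, A^T H = A^T gives
  idempotence, the symmetry of B gives that of H, and cyclicity turns tr H into the trace of a k by
  k identity matrix.\<close>

lemma hat_mat_props:
  assumes X: "X \<in> carrier_mat n p" and M: "M \<subseteq> {..<p}" and inv: "invertible_mat (gram X M)"
  shows hat_mat_carrier: "hat_mat X M \<in> carrier_mat n n"
    and hat_mat_projection: "projection n (\<lambda>i j. hat_mat X M $$ (i, j))"
    and hat_mat_trace: "(\<Sum>i<n. hat_mat X M $$ (i, i)) = card M"
proof -
  define A where "A = cols_submat X M"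
  define k where "k = card M"
  have "{j. j < p \<and> j \<in> M} = M" using M by auto
  then have "dim_col A = k" "dim_row A = n"
    using X by (simp_all add: A_def k_def cols_submat_def dim_submatrix)
  then have A: "A \<in> carrier_mat n k" by (rule carrier_matI[rotated])
  have At: "A\<^sup>T \<in> carrier_mat k n" using A by simp
  have G: "gram X M = A\<^sup>T * A" by (simp add: gram_def A_def)
  have Gc: "gram X M \<in> carrier_mat k k" unfolding G using A by simp
  obtain B where B: "mat_inverse (gram X M) = Some B"
  proof (cases "mat_inverse (gram X M)")
    \<comment> \<open>\<open>mat_inverse\<close> returns \<open>None\<close> only for non-units of
      the ring of k by k matrices. The inverse supplied by \<open>invertible_mat\<close> comes
      without dimensions, so they are first read off from the two products.\<close>
    case None
    from inv obtain C where C: "inverts_mat (gram X M) C" "inverts_mat C (gram X M)"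
      by (auto simp: invertible_mat_def)
    have 1: "gram X M * C = 1\<^sub>m k" using C(1) Gc by (simp add: inverts_mat_def)
    have "dim_col C = k" using arg_cong[OF 1, of dim_col] by simp
    have 2: "C * gram X M = 1\<^sub>m (dim_row C)" using C(2) by (simp add: inverts_mat_def)
    have "dim_row C = dim_col (C * gram X M)" by (simp only: 2 index_one_mat)
    then have "dim_row C = k" using Gc by simp
    with \<open>dim_col C = k\<close> have "C \<in> carrier_mat k k" by auto
    then have "gram X M \<in> Units (ring_mat TYPE(real) k ())"
      using 1 2 Gc \<open>dim_row C = k\<close> by (auto simp: Units_def ring_mat_def)
    then show ?thesis using mat_inverse(1)[OF Gc None, where b = "()"] by blast
  qed
  from mat_inverse(2)[OF Gc B] have GB: "gram X M * B = 1\<^sub>m k" and BG: "B * gram X M = 1\<^sub>m k" and Bc: "B \<in> carrier_mat k k"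
    by auto
  have Gt: "(gram X M)\<^sup>T = gram X M"
    unfolding G using A At by (simp add: transpose_mult[OF At A])
  \<comment> \<open>The transpose of B is a left inverse of the symmetric Gram matrix, and B is a
    right inverse.\<close>
  have Bt: "B\<^sup>T = B"
  proof -
    have "B\<^sup>T * gram X M = 1\<^sub>m k"
      using transpose_mult[OF Gc Bc] GB Gt by simp
    then have "B = (B\<^sup>T * gram X M) * B" using Bc by simp
    also have "\<dots> = B\<^sup>T * (gram X M * B)" using Bc Gc by (intro assoc_mult_mat[of _ k k _ k _ k]) auto
    finally show ?thesis using GB Bc by simp
  qed
  define H where "H = hat_mat X M"
  have H: "H = A * B * A\<^sup>T" by (simp add: H_def hat_mat_def B A_def)
  have AB: "A * B \<in> carrier_mat n k" using A Bc by simp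
  have Hc: "H \<in> carrier_mat n n" unfolding H using AB At by simp
  have Ht: "H\<^sup>T = H"
  proof -
    have "H\<^sup>T = A * (A * B)\<^sup>T" unfolding H by (simp add: transpose_mult[OF AB At])
    also have "(A * B)\<^sup>T = B * A\<^sup>T" by (simp add: transpose_mult[OF A Bc] Bt)
    also have "A * (B * A\<^sup>T) = H" unfolding H by (rule assoc_mult_mat[OF A Bc At, symmetric])
    finally show ?thesis .
  qed
  have BAt: "B * A\<^sup>T \<in> carrier_mat k n" using Bc At by simp
  have HH: "H * H = H"
  proof -
    have "A\<^sup>T * H = A\<^sup>T * (A * (B * A\<^sup>T))" unfolding H by (simp only: assoc_mult_mat[OF A Bc At])
    also have "\<dots> = gram X M * (B * A\<^sup>T)" unfolding G by (rule assoc_mult_mat[OF At A BAt, symmetric])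
    also have "\<dots> = gram X M * B * A\<^sup>T" by (rule assoc_mult_mat[OF Gc Bc At, symmetric])
    also have "\<dots> = A\<^sup>T" using At by (simp add: GB)
    finally have "A * B * (A\<^sup>T * H) = H" by (simp only: H)
    moreover have "A * B * A\<^sup>T * H = A * B * (A\<^sup>T * H)" by (rule assoc_mult_mat[OF AB At Hc])
    ultimately show ?thesis by (simp only: H[symmetric])
  qed
  show "hat_mat X M \<in> carrier_mat n n" using Hc by (simp add: H_def)
  show "projection n (\<lambda>i j. hat_mat X M $$ (i, j))"
    unfolding H_def[symmetric]
  proof
    fix i j assume "i < n" "j < n"
    then show "H $$ (i, j) = H $$ (j, i)" using Hc arg_cong[OF Ht, of "\<lambda>C. C $$ (i, j)"] by simp
    have "(\<Sum>l<n. H $$ (i, l) * H $$ (l, j)) = (H * H) $$ (i, j)"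
      using Hc \<open>i < n\<close> \<open>j < n\<close> by (auto simp: scalar_prod_def lessThan_atLeast0 intro!: sum.cong)
    then show "(\<Sum>l<n. H $$ (i, l) * H $$ (l, j)) = H $$ (i, j)" by (simp add: HH)
  qed
  have "(\<Sum>i<n. H $$ (i, i)) = (\<Sum>i<k. (A\<^sup>T * (A * B)) $$ (i, i))"
    unfolding H by (rule sum_trace_comm[OF AB At])
  also have "A\<^sup>T * (A * B) = gram X M * B" unfolding G by (rule assoc_mult_mat[OF At A Bc, symmetric])
  finally show "(\<Sum>i<n. hat_mat X M $$ (i, i)) = card M"
    unfolding GB by (simp add: H_def k_def)
qed

section \<open>Residuals under a projection\<close>

definition rss :: "nat \<Rightarrow> (nat \<Rightarrow> nat \<Rightarrow> real) \<Rightarrow> (nat \<Rightarrow> real) \<Rightarrow> (nat \<Rightarrow> real) \<Rightarrow> real" where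
  "rss n h u v = (\<Sum>i<n. (u i - (\<Sum>j<n. h i j * v j))\<^sup>2)"

definition proj_sq :: "nat \<Rightarrow> (nat \<Rightarrow> nat \<Rightarrow> real) \<Rightarrow> (nat \<Rightarrow> real) \<Rightarrow> (nat \<Rightarrow> real) \<Rightarrow> real" where
  "proj_sq n h m x = (\<Sum>i<n. (\<Sum>j<n. h i j * (x j - m j))\<^sup>2)"

definition tr :: "nat \<Rightarrow> (nat \<Rightarrow> nat \<Rightarrow> real) \<Rightarrow> real" where
  "tr n h = (\<Sum>i<n. h i i)"

lemma rss_nonneg: "rss n h u v \<ge> 0" by (simp add: rss_def sum_nonneg)
lemma proj_sq_nonneg: "proj_sq n h u v \<ge> 0" by (simp add: proj_sq_def sum_nonneg)

context projection
begin

lemma tr_nonneg: "tr n h \<ge> 0"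
  unfolding tr_def using diag_nonneg by (intro sum_nonneg) auto

lemma tr_le: "tr n h \<le> real n"
  unfolding tr_def using sum_bounded_above[of "{..<n}" "\<lambda>i. h i i" 1] diag_le_1 by simp

lemma frobenius: "(\<Sum>i<n. \<Sum>j<n. (h i j)\<^sup>2) = tr n h"
  unfolding tr_def by (intro sum.cong refl row_sq) simp

lemma apply_twice:
  assumes j: "j < n"
  shows "(\<Sum>i<n. h j i * (\<Sum>k<n. h i k * d k)) = (\<Sum>k<n. h j k * d k)"
proof -
  have "(\<Sum>i<n. h j i * (\<Sum>k<n. h i k * d k)) = (\<Sum>k<n. \<Sum>i<n. h j i * h i k * d k)"
    by (subst sum.swap) (simp add: sum_distrib_left mult.assoc)
  also have "\<dots> = (\<Sum>k<n. h j k * d k)"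
    using idem[OF j] by (intro sum.cong refl) (simp add: sum_distrib_right[symmetric])
  finally show ?thesis .
qed

lemma self_adjoint: "(\<Sum>i<n. (\<Sum>j<n. h i j * a j) * b i) = (\<Sum>j<n. a j * (\<Sum>i<n. h j i * b i))"
proof -
  have "(\<Sum>i<n. (\<Sum>j<n. h i j * a j) * b i) = (\<Sum>j<n. \<Sum>i<n. h i j * a j * b i)"
    by (subst sum.swap) (simp add: sum_distrib_right)
  also have "\<dots> = (\<Sum>j<n. \<Sum>i<n. a j * (h j i * b i))"
    by (intro sum.cong refl) (use sym in auto)
  finally show ?thesis by (simp add: sum_distrib_left)
qed

text \<open>u - H v = (u - H u) - H (v - u), where u - H u is orthogonal to the range of H.\<close>

lemma rss_pythagoras: "rss n h u v = rss n h u u + proj_sq n h u v"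
proof -
  define a where "a i = u i - (\<Sum>j<n. h i j * u j)" for i
  define b where "b i = (\<Sum>j<n. h i j * (v j - u j))" for i
  have "(\<Sum>i<n. (\<Sum>j<n. h i j * u j) * b i) = (\<Sum>j<n. u j * (\<Sum>i<n. h j i * b i))"
    by (rule self_adjoint)
  also have "\<dots> = (\<Sum>j<n. u j * b j)"
    unfolding b_def using apply_twice by (intro sum.cong refl) auto
  finally have ortho: "(\<Sum>i<n. a i * b i) = 0" by (simp add: a_def left_diff_distrib sum_subtractf)
  have "u i - (\<Sum>j<n. h i j * v j) = a i - b i" for i
    by (simp add: a_def b_def right_diff_distrib sum_subtractf)
  then have "rss n h u v = (\<Sum>i<n. (a i)\<^sup>2 + (b i)\<^sup>2 - 2 * (a i * b i))"
    unfolding rss_def by (simp add: power2_diff mult.assoc)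
  also have "\<dots> = (\<Sum>i<n. (a i)\<^sup>2) + (\<Sum>i<n. (b i)\<^sup>2)"
    using ortho by (simp add: sum.distrib sum_subtractf sum_distrib_left[symmetric])
  finally show ?thesis by (simp add: rss_def proj_sq_def a_def b_def)
qed

text \<open>A fresh response enters through the identity matrix, whose squared Frobenius norm is
  n.\<close>

lemma has_integral_rss_response:
  assumes v: "v > 0"
  shows "has_bochner_integral (iso_normal n m v) (\<lambda>u. rss n h u y) (rss n h m y + real n * v)"
proof -
  have "has_bochner_integral (iso_normal n m v) (\<lambda>u. \<Sum>i<n. (- (\<Sum>j<n. h i j * y j) + (\<Sum>j<n. (if i = j then 1 else 0) * u j))\<^sup>2)
    ((\<Sum>i<n. (- (\<Sum>j<n. h i j * y j) + (\<Sum>j<n. (if i = j then 1 else 0) * m j))\<^sup>2) + v * (\<Sum>i<n. \<Sum>j<n. (if i = j then 1 else 0)\<^sup>2))"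
    by (rule has_integral_iso_normal_affine_sq[OF v])
  moreover have "(\<Sum>j<n. (if i = j then 1 else 0) * u j) = u i" if "i < n" for i and u :: "nat \<Rightarrow> real"
    using that by (simp add: if_distrib[of "\<lambda>c. c * _"] cong: if_cong)
  moreover have "(\<Sum>i<n. \<Sum>j<n. (if i = j then 1 else 0 :: real)\<^sup>2) = real n"
    by (simp add: if_distrib[of "\<lambda>c. c\<^sup>2"] cong: if_cong)
  ultimately show ?thesis
    by (simp add: rss_def mult.commute)
qed

text \<open>The noise enters through c I - H, whose squared Frobenius norm simplifies because that
  of H is tr H. The value c = 0 serves the distance from \<mu> to H y, and c = (1 + \<alpha>) /
  \<alpha> that from y^- to H y.\<close>

lemma has_integral_rss_noise:
  assumes v: "v > 0"
  shows "has_bochner_integral (iso_normal n (\<lambda>_. 0) v) (\<lambda>e. rss n h (\<lambda>i. m i + c * e i) (\<lambda>i. x i + e i)) 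
    (rss n h m x + v * (c\<^sup>2 * real n - 2 * c * tr n h + tr n h))"
proof -
  have "has_bochner_integral (iso_normal n (\<lambda>_. 0) v) (\<lambda>e. \<Sum>i<n. ((m i - (\<Sum>j<n. h i j * x j)) + (\<Sum>j<n. ((if i = j then c else 0) - h i j) * e j))\<^sup>2)
    ((\<Sum>i<n. ((m i - (\<Sum>j<n. h i j * x j)) + (\<Sum>j<n. ((if i = j then c else 0) - h i j) * 0))\<^sup>2) + v * (\<Sum>i<n. \<Sum>j<n. ((if i = j then c else 0) - h i j)\<^sup>2))"
    by (rule has_integral_iso_normal_affine_sq[OF v])
  moreover have "(\<lambda>e. \<Sum>i<n. ((m i - (\<Sum>j<n. h i j * x j)) + (\<Sum>j<n. ((if i = j then c else 0) - h i j) * e j))\<^sup>2)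
    = (\<lambda>e. rss n h (\<lambda>i. m i + c * e i) (\<lambda>i. x i + e i))"
    unfolding rss_def
  proof (intro ext sum.cong refl)
    fix e i assume "i \<in> {..<n}"
    then have "(\<Sum>j<n. ((if i = j then c else 0) - h i j) * e j) = c * e i - (\<Sum>j<n. h i j * e j)"
      by (simp add: left_diff_distrib sum_subtractf if_distrib[of "\<lambda>c. c * _"] cong: if_cong)
    then show "((m i - (\<Sum>j<n. h i j * x j)) + (\<Sum>j<n. ((if i = j then c else 0) - h i j) * e j))\<^sup>2 = (m i + c * e i - (\<Sum>j<n. h i j * (x j + e j)))\<^sup>2"
      by (intro arg_cong[of _ _ "\<lambda>x. x\<^sup>2"]) (simp add: distrib_left sum.distrib)
  qed
  moreover have "(\<Sum>i<n. \<Sum>j<n. ((if i = j then c else 0) - h i j)\<^sup>2) = c\<^sup>2 * real n - 2 * c * tr n h + tr n h"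
  proof -
    have "(\<Sum>j<n. ((if i = j then c else 0) - h i j)\<^sup>2) = c\<^sup>2 - 2 * c * h i i + (\<Sum>j<n. (h i j)\<^sup>2)" if "i < n" for i
    proof -
      have "(\<Sum>j<n. ((if i = j then c else 0) - h i j)\<^sup>2) = (\<Sum>j<n. (if i = j then c\<^sup>2 - 2 * c * h i j else 0) + (h i j)\<^sup>2)"
        by (intro sum.cong refl) (auto simp: power2_diff)
      also have "\<dots> = c\<^sup>2 - 2 * c * h i i + (\<Sum>j<n. (h i j)\<^sup>2)" using that by (simp add: sum.distrib)
      finally show ?thesis .
    qed
    then show ?thesis by (simp add: sum.distrib sum_subtractf frobenius tr_def sum_distrib_left mult_ac)
  qed
  ultimately show ?thesis
    by (simp add: rss_def)
qed

end

section \<open>Iterated integrals and completed measures\<close>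

lemma has_bochner_integral_pair:
  fixes f :: "'a \<times> 'b \<Rightarrow> real"
  assumes "prob_space M1" "prob_space M2"
    and f: "f \<in> borel_measurable (M1 \<Otimes>\<^sub>M M2)" and nn: "\<And>p. f p \<ge> 0"
    and inner: "\<And>x. x \<in> space M1 \<Longrightarrow> has_bochner_integral M2 (\<lambda>y. f (x, y)) (c x)"
    and outer: "has_bochner_integral M1 c C"
  shows "has_bochner_integral (M1 \<Otimes>\<^sub>M M2) f C"
proof -
  interpret M1: prob_space M1 by fact
  interpret M2: prob_space M2 by fact
  interpret pair_sigma_finite M1 M2 by standard
  have eq: "(\<integral>y. f (x, y) \<partial>M2) = c x" if "x \<in> space M1" for x
    using inner[OF that] by (simp add: has_bochner_integral_iff)
  have int: "integrable (M1 \<Otimes>\<^sub>M M2) f"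
  proof (rule Fubini_integrable[OF f])
    show "integrable M1 (\<lambda>x. \<integral>y. norm (f (x, y)) \<partial>M2)"
      using outer eq nn by (simp add: has_bochner_integral_iff cong: Bochner_Integration.integrable_cong)
    show "AE x in M1. integrable M2 (\<lambda>y. f (x, y))"
      using inner by (auto simp: has_bochner_integral_iff)
  qed
  moreover have "integral\<^sup>L (M1 \<Otimes>\<^sub>M M2) f = C"
    using outer eq integral_fst'[OF int] by (simp add: has_bochner_integral_iff cong: Bochner_Integration.integral_cong)
  ultimately show ?thesis by (simp add: has_bochner_integral_iff)
qed

text \<open>For the prediction errors, where the fresh response is the first component and is
  integrated out first.\<close>

lemma has_bochner_integral_pair_swapped:
  fixes f :: "'a \<times> 'b \<Rightarrow> real"
  assumes "prob_space M1" "prob_space M2"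
    and f: "f \<in> borel_measurable (M1 \<Otimes>\<^sub>M M2)" and nn: "\<And>p. f p \<ge> 0"
    and inner: "\<And>y. y \<in> space M2 \<Longrightarrow> has_bochner_integral M1 (\<lambda>x. f (x, y)) (c y)"
    and outer: "has_bochner_integral M2 c C"
  shows "has_bochner_integral (M1 \<Otimes>\<^sub>M M2) f C"
proof -
  interpret M1: prob_space M1 by fact
  interpret M2: prob_space M2 by fact
  interpret pair_sigma_finite M1 M2 by standard
  have "has_bochner_integral (M2 \<Otimes>\<^sub>M M1) (\<lambda>(y, x). f (x, y)) C"
    using f nn inner outer
    by (intro has_bochner_integral_pair[OF assms(2,1), where c = c]) (auto simp: measurable_split_conv intro: measurable_pair_swap)
  then show ?thesis
    by (subst distr_pair_swap) (rule has_bochner_integral_distr[OF f measurable_pair_swap'], simp add: case_prod_unfold)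
qed

lemma (in complete_measure) borel_measurable_AE_eq:
  fixes f g :: "'a \<Rightarrow> real"
  assumes g: "g \<in> borel_measurable M" and eq: "AE x in M. f x = g x"
  shows "f \<in> borel_measurable M"
proof (rule measurableI)
  fix A :: "real set" assume "A \<in> sets borel"
  then have s: "g -` A \<inter> space M \<in> sets M" using g by (rule measurable_sets[rotated])
  have "AE x in M. x \<in> g -` A \<inter> space M \<longleftrightarrow> x \<in> f -` A \<inter> space M"
    using eq by eventually_elim auto
  from in_sets_AE[OF this s] show "f -` A \<inter> space M \<in> sets M" by auto
qed simp

text \<open>Used with f built from the given selection map and g from its Borel version;
  completeness makes f measurable, since it differs from g on a null set only.\<close>

lemma integral_completion_AE_eq:
  fixes f g :: "'a \<Rightarrow> real"
  assumes g: "g \<in> borel_measurable M" and eq: "AE x in M. f x = g x"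
  shows "integral\<^sup>L (completion M) f = integral\<^sup>L M g"
proof -
  have eq': "AE x in completion M. f x = g x" using AE_completion[OF eq] .
  have "integral\<^sup>L (completion M) f = integral\<^sup>L (completion M) g"
    by (intro integral_cong_AE completion.borel_measurable_AE_eq[OF measurable_completion[OF g] eq'] measurable_completion[OF g] eq')
  then show ?thesis by (simp add: integral_completion[OF g])
qed

section \<open>Prediction error of a measurable selection rule\<close>

lemma rss_cong:
  "(\<And>i. i < n \<Longrightarrow> u i = u' i) \<Longrightarrow> (\<And>i. i < n \<Longrightarrow> v i = v' i) \<Longrightarrow> rss n h u v = rss n h u' v'"
  by (simp add: rss_def)

lemma (in projection) rss_self_le: "rss n h u u \<le> (\<Sum>i<n. (u i)\<^sup>2)"
  using rss_pythagoras[of u "\<lambda>_. 0"] proj_sq_nonneg[of n h u "\<lambda>_. 0"] by (simp add: rss_def)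

text \<open>The argument is the mean of y given s, which deviates from m by (s - m) / (1 +
  \<alpha>).\<close>

lemma proj_sq_shrink:
  assumes "\<alpha> > 0"
  shows "proj_sq n h m (\<lambda>i. (s i + \<alpha> * m i) / (1 + \<alpha>)) = proj_sq n h m s / (1 + \<alpha>)\<^sup>2"
proof -
  have "(s i + \<alpha> * m i) / (1 + \<alpha>) - m i = (s i - m i) / (1 + \<alpha>)" for i
    using assms by (simp add: divide_simps) (simp add: algebra_simps)
  then show ?thesis
    by (simp add: proj_sq_def sum_divide_distrib[symmetric] power_divide)
qed

text \<open>A Borel choice among finitely many projections. Design matrices and column sets are
  forgotten: models are elements of an arbitrary type.\<close>

locale selection_rule =
  fixes n :: nat and S :: "'m set" and h :: "'m \<Rightarrow> nat \<Rightarrow> nat \<Rightarrow> real" and sel :: "(nat \<Rightarrow> real) \<Rightarrow> 'm"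
    and \<mu> :: "nat \<Rightarrow> real"
  assumes fin: "finite S" and ne: "S \<noteq> {}"
    and pr: "\<And>M. M \<in> S \<Longrightarrow> projection n (h M)"
    and sel_measurable: "sel \<in> Rn_lborel n \<rightarrow>\<^sub>M count_space S"
begin

lemma sel_in: "x \<in> Rn n \<Longrightarrow> sel x \<in> S"
  using measurable_space[OF sel_measurable] by simp

lemma proj_sel: "x \<in> Rn n \<Longrightarrow> projection n (h (sel x))"
  using pr sel_in by blast

lemma entry_measurable: "f \<in> M \<rightarrow>\<^sub>M Rn_lborel n \<Longrightarrow> (\<lambda>x. h (sel (f x)) i j) \<in> borel_measurable M"
  using measurable_compose[OF measurable_compose[OF _ sel_measurable], of f M "\<lambda>m. h m i j" borel] by simp

lemma tr_measurable: "f \<in> M \<rightarrow>\<^sub>M Rn_lborel n \<Longrightarrow> (\<lambda>x. tr n (h (sel (f x)))) \<in> borel_measurable M"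
  unfolding tr_def by (intro borel_measurable_sum entry_measurable)

lemma rss_measurable:
  assumes "f \<in> M \<rightarrow>\<^sub>M Rn_lborel n" "\<And>i. i < n \<Longrightarrow> (\<lambda>x. u x i) \<in> borel_measurable M" "\<And>i. i < n \<Longrightarrow> (\<lambda>x. v x i) \<in> borel_measurable M"
  shows "(\<lambda>x. rss n (h (sel (f x))) (u x) (v x)) \<in> borel_measurable M"
  unfolding rss_def using assms
  by (intro borel_measurable_sum borel_measurable_power borel_measurable_diff borel_measurable_times entry_measurable) auto

text \<open>Once the noise is integrated out, the errors depend on the selection only through |\<mu>
  - H \<mu>|^2, |H (x - \<mu>)|^2 and tr H, with H chosen at x.\<close>

definition bias :: "(nat \<Rightarrow> real) \<Rightarrow> real" where "bias x = rss n (h (sel x)) \<mu> \<mu>"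
definition fit :: "(nat \<Rightarrow> real) \<Rightarrow> real" where "fit x = proj_sq n (h (sel x)) \<mu> x"
definition dof :: "(nat \<Rightarrow> real) \<Rightarrow> real" where "dof x = tr n (h (sel x))"

lemma bias_measurable: "bias \<in> borel_measurable (Rn_lborel n)"
  unfolding bias_def[abs_def] by (intro rss_measurable) auto

lemma dof_measurable: "dof \<in> borel_measurable (Rn_lborel n)"
  unfolding dof_def[abs_def] by (intro tr_measurable) auto

lemma fit_measurable: "fit \<in> borel_measurable (Rn_lborel n)"
  unfolding fit_def[abs_def] proj_sq_def
  by (intro borel_measurable_sum borel_measurable_power borel_measurable_diff borel_measurable_times entry_measurable component_measurable_Rn) auto

lemma bias_nonneg: "bias x \<ge> 0" by (simp add: bias_def rss_nonneg)
lemma fit_nonneg: "fit x \<ge> 0" by (simp add: fit_def proj_sq_nonneg)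

lemma bias_le: "x \<in> Rn n \<Longrightarrow> bias x \<le> (\<Sum>i<n. (\<mu> i)\<^sup>2)"
  unfolding bias_def using projection.rss_self_le[OF proj_sel] .

lemma dof_nonneg: "x \<in> Rn n \<Longrightarrow> dof x \<ge> 0"
  unfolding dof_def using projection.tr_nonneg[OF proj_sel] .

lemma dof_le: "x \<in> Rn n \<Longrightarrow> dof x \<le> real n"
  unfolding dof_def using projection.tr_le[OF proj_sel] .

lemma fit_sq_bound:
  assumes "v > 0" "\<kappa> > 0" "\<And>M. M \<in> S \<Longrightarrow> tr n (h M) \<le> \<kappa>"
  shows "(\<integral>\<^sup>+x. ennreal ((fit x)\<^sup>2) \<partial>iso_normal n \<mu> v) \<le> ennreal (16 * v\<^sup>2 * \<kappa>\<^sup>2 * (2 * (ln (card S))\<^sup>2 + 16))"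
  unfolding fit_def proj_sq_def using assms sel_in
  by (intro projection_max_bound fin ne pr) (auto simp: tr_def)

lemma integrable_bias: "v > 0 \<Longrightarrow> integrable (iso_normal n \<mu> v) bias"
  using bias_measurable bias_le bias_nonneg prob_space_iso_normal[of v n \<mu>]
  by (intro finite_measure.integrable_const_bound[where B = "\<Sum>i<n. (\<mu> i)\<^sup>2"]) (auto simp: measurable_iso_normal_eq prob_space_def)

lemma integrable_dof: "v > 0 \<Longrightarrow> integrable (iso_normal n \<mu> v) dof"
  using dof_measurable dof_le dof_nonneg prob_space_iso_normal[of v n \<mu>]
  by (intro finite_measure.integrable_const_bound[where B = "real n"]) (auto simp: measurable_iso_normal_eq prob_space_def)

lemma integrable_fit: "v > 0 \<Longrightarrow> integrable (iso_normal n \<mu> v) fit"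
proof -
  assume v: "v > 0"
  \<comment> \<open>Only finiteness matters here: tr H \<le> n always holds, and n + 1 is positive
    even for n = 0.\<close>
  have "(\<integral>\<^sup>+x. ennreal ((fit x)\<^sup>2) \<partial>iso_normal n \<mu> v) < \<infinity>"
    using fit_sq_bound[OF v, of "real n + 1"] projection.tr_le[OF pr] by (fastforce intro: le_less_trans)
  then show ?thesis
    using v fit_measurable by (intro integrable_of_nn_square prob_space_iso_normal) (auto simp: measurable_iso_normal_eq)
qed

lemma y_star_measurable: "(\<lambda>p. y_star n (fst p) (snd p)) \<in> Rn_lborel n \<Otimes>\<^sub>M Rn_lborel n \<rightarrow>\<^sub>M Rn_lborel n"
proof (rule measurable_RnI)
  fix i assume "i < n"
  then show "(\<lambda>p. y_star n (fst p) (snd p) i) \<in> borel_measurable (Rn_lborel n \<Otimes>\<^sub>M Rn_lborel n)"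
    unfolding y_star_def
    by (simp, intro borel_measurable_add Rn_coord_measurable[OF measurable_fst] Rn_coord_measurable[OF measurable_snd])
qed (simp add: y_star_def)

context
  fixes s2 \<alpha> :: real
  assumes s2: "s2 > 0" and \<alpha>: "\<alpha> > 0"
begin

lemma pos: "\<alpha> * s2 > 0" "(1 + \<alpha>) * s2 > 0" "\<alpha> * s2 / (1 + \<alpha>) > 0"
  using s2 \<alpha> by auto

text \<open>The joint laws of \<open>(y, \<omega>)\<close> and of \<open>(s, e)\<close>.\<close>

abbreviation "PQ \<equiv> iso_normal n \<mu> s2 \<Otimes>\<^sub>M iso_normal n (\<lambda>_. 0) (\<alpha> * s2)"
abbreviation "SE \<equiv> iso_normal n \<mu> ((1 + \<alpha>) * s2) \<Otimes>\<^sub>M iso_normal n (\<lambda>_. 0) (\<alpha> * s2 / (1 + \<alpha>))"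

lemma prob_space_PQ: "prob_space PQ"
  by (intro prob_space_pair prob_space_iso_normal s2 pos)

lemma has_integral_PQ:
  fixes F :: "(nat \<Rightarrow> real) \<times> (nat \<Rightarrow> real) \<Rightarrow> real"
  assumes "F \<in> borel_measurable (Rn_lborel n \<Otimes>\<^sub>M Rn_lborel n)" "has_bochner_integral SE (\<lambda>p. F (unrandomize n \<alpha> \<mu> p)) C"
  shows "has_bochner_integral PQ F C"
  unfolding randomized_eq_distr[OF s2 \<alpha>] using assms unrandomize_measurable
  by (intro has_bochner_integral_distr) (auto simp: measurable_iso_normal_pair_eq)

text \<open>In the last formula y - (s - y) / \<alpha> = ((1 + \<alpha>) y - s) / \<alpha>, and s
  cancels because (1 + \<alpha>) y = s + \<alpha> \<mu> + (1 + \<alpha>) e. So y^- is a function of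
  e alone and independent of the selected model.\<close>

lemma unrandomize_coords:
  assumes "s \<in> Rn n" "unrandomize n \<alpha> \<mu> (s, e) = (y, w)"
  shows "y_star n y w = s" "\<And>i. i < n \<Longrightarrow> y i = (s i + \<alpha> * \<mu> i) / (1 + \<alpha>) + e i"
    "\<And>i. i < n \<Longrightarrow> y_minus n \<alpha> y w i = \<mu> i + (1 + \<alpha>) / \<alpha> * e i"
proof -
  have y: "y = shift_vec n (\<lambda>i. (s i + \<alpha> * \<mu> i) / (1 + \<alpha>)) e" and w: "w = shift_vec n (\<lambda>i. - y i) s"
    using assms(2) by (auto simp: unrandomize_def Let_def)
  show yi: "y i = (s i + \<alpha> * \<mu> i) / (1 + \<alpha>) + e i" if "i < n" for i
    using that by (simp add: y shift_vec_def)
  have wi: "w i = s i - y i" if "i < n" for i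
    using that by (simp add: w shift_vec_def)
  show "y_star n y w = s"
    using assms(1) wi by (auto simp: y_star_def Rn_def PiE_def extensional_def restrict_def)
  show "y_minus n \<alpha> y w i = \<mu> i + (1 + \<alpha>) / \<alpha> * e i" if "i < n" for i
    using that \<alpha> by (simp add: y_minus_def wi yi divide_simps) (simp add: algebra_simps)
qed

text \<open>The selection depends on s alone, so for fixed s the projection is constant and e is
  integrated out; Pythagoras then splits what is left at the mean of y given s.\<close>

lemma has_integral_SE:
  shows "has_bochner_integral SE (\<lambda>(s, e). rss n (h (sel s)) (\<lambda>i. \<mu> i + c * e i) (\<lambda>i. (s i + \<alpha> * \<mu> i) / (1 + \<alpha>) + e i))
    (\<integral>s. bias s + fit s / (1 + \<alpha>)\<^sup>2 + \<alpha> * s2 / (1 + \<alpha>) * (c\<^sup>2 * real n - 2 * c * dof s + dof s) \<partial>iso_normal n \<mu> ((1 + \<alpha>) * s2))"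
proof (rule has_bochner_integral_pair)
  let ?V = "\<lambda>s. bias s + fit s / (1 + \<alpha>)\<^sup>2 + \<alpha> * s2 / (1 + \<alpha>) * (c\<^sup>2 * real n - 2 * c * dof s + dof s)"
  show "prob_space (iso_normal n \<mu> ((1 + \<alpha>) * s2))" "prob_space (iso_normal n (\<lambda>_. 0) (\<alpha> * s2 / (1 + \<alpha>)))"
    by (intro prob_space_iso_normal pos)+
  then interpret prob_space "iso_normal n \<mu> ((1 + \<alpha>) * s2)" by simp
  show "(\<lambda>(s, e). rss n (h (sel s)) (\<lambda>i. \<mu> i + c * e i) (\<lambda>i. (s i + \<alpha> * \<mu> i) / (1 + \<alpha>) + e i)) \<in> borel_measurable SE"
    unfolding measurable_iso_normal_pair_eq case_prod_unfold
    by (intro rss_measurable borel_measurable_add borel_measurable_times borel_measurable_divide borel_measurable_const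
       Rn_coord_measurable[OF measurable_fst] Rn_coord_measurable[OF measurable_snd] measurable_fst)
  show "has_bochner_integral (iso_normal n \<mu> ((1 + \<alpha>) * s2)) ?V (integral\<^sup>L (iso_normal n \<mu> ((1 + \<alpha>) * s2)) ?V)"
    using integrable_bias[OF pos(2)] integrable_fit[OF pos(2)] integrable_dof[OF pos(2)]
    by (intro has_bochner_integral_integrable Bochner_Integration.integrable_add Bochner_Integration.integrable_diff
       integrable_mult_right integrable_divide_zero) auto
  fix s assume "s \<in> space (iso_normal n \<mu> ((1 + \<alpha>) * s2))"
  then have "projection n (h (sel s))" using proj_sel by simp
  then interpret projection n "h (sel s)" .
  have "rss n (h (sel s)) \<mu> (\<lambda>i. (s i + \<alpha> * \<mu> i) / (1 + \<alpha>)) = bias s + fit s / (1 + \<alpha>)\<^sup>2"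
    using rss_pythagoras[of \<mu> "\<lambda>i. (s i + \<alpha> * \<mu> i) / (1 + \<alpha>)"] proj_sq_shrink[OF \<alpha>]
    by (simp add: bias_def fit_def)
  then show "has_bochner_integral (iso_normal n (\<lambda>_. 0) (\<alpha> * s2 / (1 + \<alpha>)))
     (\<lambda>e. case (s, e) of (s, e) \<Rightarrow> rss n (h (sel s)) (\<lambda>i. \<mu> i + c * e i) (\<lambda>i. (s i + \<alpha> * \<mu> i) / (1 + \<alpha>) + e i)) (?V s)"
    using has_integral_rss_noise[OF pos(3), of \<mu> c "\<lambda>i. (s i + \<alpha> * \<mu> i) / (1 + \<alpha>)"] by (simp add: dof_def)
qed (auto simp: rss_nonneg)

text \<open>The mean of |\<mu> - H y|^2 with H selected at y + \<omega>: the randomised error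
  without the noise of the fresh response.\<close>

definition rand_risk :: real where
  "rand_risk = (\<integral>s. bias s + fit s / (1 + \<alpha>)\<^sup>2 + \<alpha> * s2 / (1 + \<alpha>) * dof s \<partial>iso_normal n \<mu> ((1 + \<alpha>) * s2))"

lemma has_integral_risk_PQ:
  "has_bochner_integral PQ (\<lambda>p. rss n (h (sel (y_star n (fst p) (snd p)))) \<mu> (fst p)) rand_risk"
proof (rule has_integral_PQ)
  show "(\<lambda>p. rss n (h (sel (y_star n (fst p) (snd p)))) \<mu> (fst p)) \<in> borel_measurable (Rn_lborel n \<Otimes>\<^sub>M Rn_lborel n)"
    by (intro rss_measurable y_star_measurable Rn_coord_measurable[OF measurable_fst]) auto
  have "has_bochner_integral SE (\<lambda>p. rss n (h (sel (fst p))) (\<lambda>i. \<mu> i + 0 * snd p i) (\<lambda>i. (fst p i + \<alpha> * \<mu> i) / (1 + \<alpha>) + snd p i)) rand_risk"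
    using has_integral_SE[of 0] by (simp add: rand_risk_def case_prod_unfold)
  then show "has_bochner_integral SE (\<lambda>p. rss n (h (sel (y_star n (fst (unrandomize n \<alpha> \<mu> p)) (snd (unrandomize n \<alpha> \<mu> p))))) \<mu> (fst (unrandomize n \<alpha> \<mu> p))) rand_risk"
  proof (subst has_bochner_integral_cong[OF refl _ refl])
    fix p assume p: "p \<in> space SE"
    obtain y w where yw: "unrandomize n \<alpha> \<mu> (fst p, snd p) = (y, w)" by fastforce
    have "fst p \<in> Rn n" using p by (auto simp: space_pair_measure)
    from unrandomize_coords[OF this yw] yw
    show "rss n (h (sel (y_star n (fst (unrandomize n \<alpha> \<mu> p)) (snd (unrandomize n \<alpha> \<mu> p))))) \<mu> (fst (unrandomize n \<alpha> \<mu> p))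
      = rss n (h (sel (fst p))) (\<lambda>i. \<mu> i + 0 * snd p i) (\<lambda>i. (fst p i + \<alpha> * \<mu> i) / (1 + \<alpha>) + snd p i)"
      by (auto intro!: rss_cong)
  qed
qed

lemma has_integral_dof_PQ:
  "has_bochner_integral PQ (\<lambda>p. dof (y_star n (fst p) (snd p))) (\<integral>s. dof s \<partial>iso_normal n \<mu> ((1 + \<alpha>) * s2))"
proof (rule has_integral_PQ)
  show "(\<lambda>p. dof (y_star n (fst p) (snd p))) \<in> borel_measurable (Rn_lborel n \<Otimes>\<^sub>M Rn_lborel n)"
    by (rule measurable_compose[OF y_star_measurable dof_measurable])
  interpret E: prob_space "iso_normal n (\<lambda>_. 0) (\<alpha> * s2 / (1 + \<alpha>))" by (intro prob_space_iso_normal pos)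
  \<comment> \<open>The absolute value makes the integrand nonnegative everywhere, as
    \<open>has_bochner_integral_pair\<close> demands; \<open>dof\<close> is known to be nonnegative
    on \<open>Rn n\<close> only.\<close>
  have "has_bochner_integral SE (\<lambda>p. \<bar>dof (fst p)\<bar>) (\<integral>s. dof s \<partial>iso_normal n \<mu> ((1 + \<alpha>) * s2))"
  proof (rule has_bochner_integral_pair)
    show "prob_space (iso_normal n \<mu> ((1 + \<alpha>) * s2))" "prob_space (iso_normal n (\<lambda>_. 0) (\<alpha> * s2 / (1 + \<alpha>)))"
      by (intro prob_space_iso_normal pos)+
    show "(\<lambda>p. \<bar>dof (fst p)\<bar>) \<in> borel_measurable SE"
      unfolding measurable_iso_normal_pair_eq
      by (intro borel_measurable_abs measurable_compose[OF measurable_fst dof_measurable])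
    show "has_bochner_integral (iso_normal n \<mu> ((1 + \<alpha>) * s2)) dof (\<integral>s. dof s \<partial>iso_normal n \<mu> ((1 + \<alpha>) * s2))"
      by (intro has_bochner_integral_integrable integrable_dof pos)
    show "has_bochner_integral (iso_normal n (\<lambda>_. 0) (\<alpha> * s2 / (1 + \<alpha>))) (\<lambda>y. \<bar>dof (fst (s, y))\<bar>) (dof s)"
      if "s \<in> space (iso_normal n \<mu> ((1 + \<alpha>) * s2))" for s
      using dof_nonneg[of s] that has_bochner_integral_prob_const[OF E.prob_space_axioms, of "dof s"] by simp
  qed simp
  then show "has_bochner_integral SE (\<lambda>p. dof (y_star n (fst (unrandomize n \<alpha> \<mu> p)) (snd (unrandomize n \<alpha> \<mu> p)))) (\<integral>s. dof s \<partial>iso_normal n \<mu> ((1 + \<alpha>) * s2))"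
  proof (subst has_bochner_integral_cong[OF refl _ refl])
    fix p assume p: "p \<in> space SE"
    obtain y w where yw: "unrandomize n \<alpha> \<mu> (fst p, snd p) = (y, w)" by fastforce
    have "fst p \<in> Rn n" using p by (auto simp: space_pair_measure)
    from unrandomize_coords(1)[OF this yw] yw dof_nonneg[OF this]
    show "dof (y_star n (fst (unrandomize n \<alpha> \<mu> p)) (snd (unrandomize n \<alpha> \<mu> p))) = \<bar>dof (fst p)\<bar>"
      by simp
  qed
qed

text \<open>Unbiasedness. For c = (1 + \<alpha>) / \<alpha> the variance of e times c is \<sigma>^2.
  So the cross term is -2 \<sigma>^2 tr H, which the penalty cancels, and the c^2 term is c n
  \<sigma>^2 = n \<sigma>^2 / \<alpha> + n \<sigma>^2, of which the final correction leaves n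
  \<sigma>^2.\<close>

lemma has_integral_err_hat:
  "has_bochner_integral PQ (\<lambda>p. rss n (h (sel (y_star n (fst p) (snd p)))) (y_minus n \<alpha> (fst p) (snd p)) (fst p)
      + 2 * dof (y_star n (fst p) (snd p)) * s2 - (1 / \<alpha>) * real n * s2) (rand_risk + real n * s2)"
proof -
  let ?N = "iso_normal n \<mu> ((1 + \<alpha>) * s2)"
  interpret N: prob_space ?N by (intro prob_space_iso_normal pos)
  define D where "D = (\<integral>s. dof s \<partial>?N)"
  define c where "c = (1 + \<alpha>) / \<alpha>"
  have c: "\<alpha> * s2 / (1 + \<alpha>) * c = s2" using s2 \<alpha> by (simp add: c_def)
  have "\<alpha> * s2 / (1 + \<alpha>) * (c\<^sup>2 * real n - 2 * c * d + d) = \<alpha> * s2 / (1 + \<alpha>) * c * (c * real n - 2 * d) + \<alpha> * s2 / (1 + \<alpha>) * d" for d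
    by (simp add: power2_eq_square algebra_simps)
  then have "\<alpha> * s2 / (1 + \<alpha>) * (c\<^sup>2 * real n - 2 * c * d + d) = s2 * c * real n - 2 * s2 * d + \<alpha> * s2 / (1 + \<alpha>) * d" for d
    unfolding c by (simp add: algebra_simps)
  then have "(\<integral>s. bias s + fit s / (1 + \<alpha>)\<^sup>2 + \<alpha> * s2 / (1 + \<alpha>) * (c\<^sup>2 * real n - 2 * c * dof s + dof s) \<partial>?N)
    = (\<integral>s. bias s + fit s / (1 + \<alpha>)\<^sup>2 + (s2 * c * real n - 2 * s2 * dof s + \<alpha> * s2 / (1 + \<alpha>) * dof s) \<partial>?N)"
    by (simp only:)
  also have "\<dots> = (\<integral>s. (bias s + fit s / (1 + \<alpha>)\<^sup>2 + \<alpha> * s2 / (1 + \<alpha>) * dof s) + s2 * c * real n - 2 * s2 * dof s \<partial>?N)"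
    by (rule Bochner_Integration.integral_cong) simp_all
  also have "\<dots> = rand_risk + s2 * c * real n - 2 * s2 * D"
    using integrable_bias[OF pos(2)] integrable_fit[OF pos(2)] integrable_dof[OF pos(2)]
    by (simp add: rand_risk_def D_def N.prob_space[simplified])
  finally have val: "(\<integral>s. bias s + fit s / (1 + \<alpha>)\<^sup>2 + \<alpha> * s2 / (1 + \<alpha>) * (c\<^sup>2 * real n - 2 * c * dof s + dof s) \<partial>?N) = rand_risk + s2 * c * real n - 2 * s2 * D" .
  have "has_bochner_integral PQ (\<lambda>p. rss n (h (sel (y_star n (fst p) (snd p)))) (y_minus n \<alpha> (fst p) (snd p)) (fst p)) (rand_risk + s2 * c * real n - 2 * s2 * D)"
  proof (rule has_integral_PQ)
    show "(\<lambda>p. rss n (h (sel (y_star n (fst p) (snd p)))) (y_minus n \<alpha> (fst p) (snd p)) (fst p)) \<in> borel_measurable (Rn_lborel n \<Otimes>\<^sub>M Rn_lborel n)"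
    proof (intro rss_measurable y_star_measurable Rn_coord_measurable[OF measurable_fst])
      fix i assume "i < n"
      then show "(\<lambda>p. y_minus n \<alpha> (fst p) (snd p) i) \<in> borel_measurable (Rn_lborel n \<Otimes>\<^sub>M Rn_lborel n)"
        unfolding y_minus_def
        by (simp, intro borel_measurable_diff borel_measurable_divide borel_measurable_const Rn_coord_measurable[OF measurable_fst] Rn_coord_measurable[OF measurable_snd])
    qed auto
    show "has_bochner_integral SE (\<lambda>p. rss n (h (sel (y_star n (fst (unrandomize n \<alpha> \<mu> p)) (snd (unrandomize n \<alpha> \<mu> p))))) (y_minus n \<alpha> (fst (unrandomize n \<alpha> \<mu> p)) (snd (unrandomize n \<alpha> \<mu> p))) (fst (unrandomize n \<alpha> \<mu> p))) (rand_risk + s2 * c * real n - 2 * s2 * D)"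
      unfolding val[symmetric]
    proof (subst has_bochner_integral_cong[OF refl _ refl])
      fix p assume p: "p \<in> space SE"
      obtain y w where yw: "unrandomize n \<alpha> \<mu> (fst p, snd p) = (y, w)" by fastforce
      have "fst p \<in> Rn n" using p by (auto simp: space_pair_measure)
      from unrandomize_coords[OF this yw] yw
      show "rss n (h (sel (y_star n (fst (unrandomize n \<alpha> \<mu> p)) (snd (unrandomize n \<alpha> \<mu> p))))) (y_minus n \<alpha> (fst (unrandomize n \<alpha> \<mu> p)) (snd (unrandomize n \<alpha> \<mu> p))) (fst (unrandomize n \<alpha> \<mu> p))
        = (case p of (s, e) \<Rightarrow> rss n (h (sel s)) (\<lambda>i. \<mu> i + c * e i) (\<lambda>i. (s i + \<alpha> * \<mu> i) / (1 + \<alpha>) + e i))"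
        by (auto simp: c_def case_prod_unfold intro!: rss_cong)
    qed (rule has_integral_SE)
  qed
  then have "has_bochner_integral PQ (\<lambda>p. rss n (h (sel (y_star n (fst p) (snd p)))) (y_minus n \<alpha> (fst p) (snd p)) (fst p)
      + 2 * dof (y_star n (fst p) (snd p)) * s2 - (1 / \<alpha>) * real n * s2) ((rand_risk + s2 * c * real n - 2 * s2 * D) + 2 * D * s2 - (1 / \<alpha>) * real n * s2)"
    unfolding D_def
    by (intro has_bochner_integral_add has_bochner_integral_diff has_bochner_integral_mult_left has_bochner_integral_mult_right
      has_integral_dof_PQ has_bochner_integral_prob_const prob_space_PQ)
  moreover have "(rand_risk + s2 * c * real n - 2 * s2 * D) + 2 * D * s2 - (1 / \<alpha>) * real n * s2 = rand_risk + real n * s2"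
  proof -
    have "c = 1 / \<alpha> + 1" using \<alpha> by (simp add: c_def add_divide_distrib)
    then show ?thesis by (simp add: algebra_simps)
  qed
  ultimately show ?thesis by (simp only:)
qed

lemma has_integral_Err_rand:
  "has_bochner_integral (iso_normal n \<mu> s2 \<Otimes>\<^sub>M PQ) (\<lambda>(u, p). rss n (h (sel (y_star n (fst p) (snd p)))) u (fst p)) (rand_risk + real n * s2)"
proof (rule has_bochner_integral_pair_swapped)
  show "prob_space (iso_normal n \<mu> s2)" "prob_space PQ" by (intro prob_space_iso_normal s2 prob_space_PQ)+
  have "sets (iso_normal n \<mu> s2 \<Otimes>\<^sub>M PQ) = sets (Rn_lborel n \<Otimes>\<^sub>M (Rn_lborel n \<Otimes>\<^sub>M Rn_lborel n))"
    by (intro sets_pair_measure_cong sets_iso_normal)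
  then have *: "measurable (iso_normal n \<mu> s2 \<Otimes>\<^sub>M PQ) M = measurable (Rn_lborel n \<Otimes>\<^sub>M (Rn_lborel n \<Otimes>\<^sub>M Rn_lborel n)) M" for M :: "real measure"
    by (intro measurable_cong_sets) auto
  show "(\<lambda>(u, p). rss n (h (sel (y_star n (fst p) (snd p)))) u (fst p)) \<in> borel_measurable (iso_normal n \<mu> s2 \<Otimes>\<^sub>M PQ)"
    unfolding * case_prod_unfold
    by (intro rss_measurable measurable_compose[OF measurable_snd y_star_measurable] Rn_coord_measurable[OF measurable_fst] Rn_coord_measurable[OF measurable_compose[OF measurable_snd measurable_fst]])
  show "has_bochner_integral PQ (\<lambda>p. rss n (h (sel (y_star n (fst p) (snd p)))) \<mu> (fst p) + real n * s2) (rand_risk + real n * s2)"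
    by (intro has_bochner_integral_add has_integral_risk_PQ has_bochner_integral_prob_const prob_space_PQ)
  fix p assume "p \<in> space PQ"
  then have "p \<in> space (Rn_lborel n \<Otimes>\<^sub>M Rn_lborel n)" by (simp add: space_pair_measure)
  from measurable_space[OF y_star_measurable this] have "projection n (h (sel (y_star n (fst p) (snd p))))"
    using proj_sel by simp
  then show "has_bochner_integral (iso_normal n \<mu> s2) (\<lambda>u. case (u, p) of (u, p) \<Rightarrow> rss n (h (sel (y_star n (fst p) (snd p)))) u (fst p))
     (rss n (h (sel (y_star n (fst p) (snd p)))) \<mu> (fst p) + real n * s2)"
    using projection.has_integral_rss_response s2 by simp
qed (auto simp: rss_nonneg)

text \<open>Without randomisation the selection depends on y itself, and Pythagoras alone turns
  |\<mu> - H y|^2 into \<open>bias\<close> plus \<open>fit\<close>.\<close>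

lemma has_integral_Err:
  "has_bochner_integral (iso_normal n \<mu> s2 \<Otimes>\<^sub>M iso_normal n \<mu> s2) (\<lambda>(u, y). rss n (h (sel y)) u y)
    ((\<integral>y. bias y + fit y \<partial>iso_normal n \<mu> s2) + real n * s2)"
proof (rule has_bochner_integral_pair_swapped)
  show P: "prob_space (iso_normal n \<mu> s2)" "prob_space (iso_normal n \<mu> s2)" by (intro prob_space_iso_normal s2)+
  show "(\<lambda>(u, y). rss n (h (sel y)) u y) \<in> borel_measurable (iso_normal n \<mu> s2 \<Otimes>\<^sub>M iso_normal n \<mu> s2)"
    unfolding measurable_iso_normal_pair_eq case_prod_unfold
    by (intro rss_measurable measurable_snd Rn_coord_measurable[OF measurable_fst] Rn_coord_measurable[OF measurable_snd])
  show "has_bochner_integral (iso_normal n \<mu> s2) (\<lambda>y. bias y + fit y + real n * s2) ((\<integral>y. bias y + fit y \<partial>iso_normal n \<mu> s2) + real n * s2)"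
    using integrable_bias[OF s2] integrable_fit[OF s2] P
    by (intro has_bochner_integral_add[of _ "\<lambda>y. bias y + fit y"] has_bochner_integral_prob_const has_bochner_integral_integrable) auto
  fix y assume "y \<in> space (iso_normal n \<mu> s2)"
  then have "projection n (h (sel y))" using proj_sel by simp
  then interpret projection n "h (sel y)" .
  show "has_bochner_integral (iso_normal n \<mu> s2) (\<lambda>u. case (u, y) of (u, y) \<Rightarrow> rss n (h (sel y)) u y) (bias y + fit y + real n * s2)"
    using has_integral_rss_response[OF s2, of \<mu> y] rss_pythagoras[of \<mu> y] by (simp add: bias_def fit_def)
qed (auto simp: rss_nonneg)

text \<open>The difference has four sources: the change of variance in the means of
  \<open>bias\<close> and of \<open>fit\<close>, the factor 1 / (1 + \<alpha>)^2 on
  \<open>fit\<close>, and the trace term. The first two give equal halves of the quotient in the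
  constant, the third gives 2 (1 + c), the fourth \<open>s2\<close>.\<close>

lemma rand_risk_diff_bound:
  assumes n: "n \<ge> 1" and \<delta>: "\<alpha> < \<delta>" and c: "c \<ge> 0"
    and bb: "\<And>t. s2 \<le> t \<Longrightarrow> t \<le> (1 + \<delta>) * s2 \<Longrightarrow> (\<integral>\<^sup>+x. ennreal ((bias x)\<^sup>2) \<partial>iso_normal n \<mu> t) \<le> ennreal (c * real n)"
    and fb: "\<And>t. s2 \<le> t \<Longrightarrow> t \<le> (1 + \<delta>) * s2 \<Longrightarrow> (\<integral>\<^sup>+x. ennreal ((fit x)\<^sup>2) \<partial>iso_normal n \<mu> t) \<le> ennreal (c * real n)"
  shows "\<bar>rand_risk - (\<integral>y. bias y + fit y \<partial>iso_normal n \<mu> s2)\<bar> \<le> 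
    ((c + 2 * ((1 + \<delta>) * s2)\<^sup>2) / (2 * s2) + 2 * (1 + c) + s2) * \<alpha> * real n"
proof -
  define \<tau> where "\<tau> = (1 + \<alpha>) * s2"
  define T where "T = (1 + \<delta>) * s2"
  have t: "s2 \<le> \<tau>" "\<tau> \<le> T" "\<tau> > 0" using \<alpha> \<delta> s2 pos(2) by (auto simp: \<tau>_def T_def)
  interpret N: prob_space "iso_normal n \<mu> \<tau>" by (rule prob_space_iso_normal[OF t(3)])
  define K where "K = (c + 2 * T\<^sup>2) / (4 * s2)"
  have lip: "\<bar>(\<integral>x. g x \<partial>iso_normal n \<mu> \<tau>) - (\<integral>x. g x \<partial>iso_normal n \<mu> s2)\<bar> \<le> \<alpha> * real n * K"
    if "g \<in> borel_measurable (Rn_lborel n)" and b: "\<And>t. s2 \<le> t \<Longrightarrow> t \<le> T \<Longrightarrow> (\<integral>\<^sup>+x. ennreal ((g x)\<^sup>2) \<partial>iso_normal n \<mu> t) \<le> ennreal (c * real n)" for g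
  proof -
    have "\<bar>(\<integral>x. g x \<partial>iso_normal n \<mu> \<tau>) - (\<integral>x. g x \<partial>iso_normal n \<mu> s2)\<bar> \<le> (\<tau> - s2) * ((c * real n + 2 * real n * \<tau>\<^sup>2) / (4 * s2\<^sup>2))"
      using that(1) t c by (intro normal_expectation_lipschitz s2 b) auto
    also have "\<dots> \<le> (\<tau> - s2) * ((c * real n + 2 * real n * T\<^sup>2) / (4 * s2\<^sup>2))"
      using t by (intro mult_left_mono divide_right_mono add_left_mono power_mono) auto
    \<comment> \<open>The variance moves by \<alpha> \<open>s2\<close>, which cancels one of the two
      factors \<open>s2\<close> in the denominator.\<close>
    also have "\<dots> = \<alpha> * real n * K"
      using s2 by (simp add: \<tau>_def K_def power2_eq_square field_simps)
    finally show ?thesis .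
  qed
  have ib: "integrable (iso_normal n \<mu> \<tau>) bias" "integrable (iso_normal n \<mu> \<tau>) fit" "integrable (iso_normal n \<mu> \<tau>) dof"
    using t by (auto intro: integrable_bias integrable_fit integrable_dof)
  define A where "A t = (\<integral>x. bias x \<partial>iso_normal n \<mu> t)" for t
  define B where "B t = (\<integral>x. fit x \<partial>iso_normal n \<mu> t)" for t
  define D where "D = (\<integral>x. dof x \<partial>iso_normal n \<mu> \<tau>)"
  have r1: "rand_risk = A \<tau> + B \<tau> / (1 + \<alpha>)\<^sup>2 + \<alpha> * s2 / (1 + \<alpha>) * D"
    using ib by (simp add: rand_risk_def A_def B_def D_def \<tau>_def)
  have r2: "(\<integral>y. bias y + fit y \<partial>iso_normal n \<mu> s2) = A s2 + B s2"
    using integrable_bias[OF s2] integrable_fit[OF s2] by (simp add: A_def B_def)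
  have A: "\<bar>A \<tau> - A s2\<bar> \<le> \<alpha> * real n * K" unfolding A_def using bb by (intro lip bias_measurable) (auto simp: T_def)
  have B: "\<bar>B \<tau> - B s2\<bar> \<le> \<alpha> * real n * K" unfolding B_def using fb by (intro lip fit_measurable) (auto simp: T_def)
  have B0: "B \<tau> \<ge> 0" unfolding B_def using fit_nonneg by (intro Bochner_Integration.integral_nonneg)
  have B1: "B \<tau> \<le> (1 + c) * real n"
  proof -
    have bnd: "(\<integral>\<^sup>+x. ennreal ((fit x)\<^sup>2) \<partial>iso_normal n \<mu> \<tau>) \<le> ennreal (c * real n)"
      using fb t by (simp add: T_def)
    have fi: "integrable (iso_normal n \<mu> \<tau>) (\<lambda>x. (fit x)\<^sup>2)"
      using fit_measurable bnd by (intro integrable_of_nn_square N.prob_space_axioms) (auto simp: measurable_iso_normal_eq intro: le_less_trans)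
    have "ennreal (\<integral>x. (fit x)\<^sup>2 \<partial>iso_normal n \<mu> \<tau>) \<le> ennreal (c * real n)"
      using bnd fi by (subst nn_integral_eq_integral[symmetric]) auto
    then have f2: "(\<integral>x. (fit x)\<^sup>2 \<partial>iso_normal n \<mu> \<tau>) \<le> c * real n"
      using c by (subst (asm) ennreal_le_iff) auto
    \<comment> \<open>Bounds the mean of \<open>fit\<close> by its second moment without a square
      root; n \<ge> 1 absorbs the constant.\<close>
    have "a \<le> 1 + a\<^sup>2" for a :: real
      using zero_le_power2[of "a - 1 / 2"] zero_le_power2[of a] by (simp add: power2_eq_square algebra_simps)
    then have "B \<tau> \<le> (\<integral>x. 1 + (fit x)\<^sup>2 \<partial>iso_normal n \<mu> \<tau>)"
      unfolding B_def using fi ib by (intro integral_mono) auto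
    also have "\<dots> = 1 + (\<integral>x. (fit x)\<^sup>2 \<partial>iso_normal n \<mu> \<tau>)"
      using fi by (simp add: N.prob_space[simplified])
    also have "\<dots> \<le> (1 + c) * real n" using f2 n by (simp add: algebra_simps)
    finally show ?thesis .
  qed
  have B2: "\<bar>B \<tau> / (1 + \<alpha>)\<^sup>2 - B \<tau>\<bar> \<le> 2 * (1 + c) * \<alpha> * real n"
  proof -
    have "1 - 1 / (1 + \<alpha>)\<^sup>2 \<le> 2 * \<alpha>" "1 / (1 + \<alpha>)\<^sup>2 \<le> 1"
    proof -
      \<comment> \<open>The desired inequality multiplied by (1 + \<alpha>)^2.\<close>
      have "(1 - 2 * \<alpha>) * (1 + \<alpha>)\<^sup>2 = 1 - \<alpha>\<^sup>2 * (3 + 2 * \<alpha>)" by (simp add: power2_eq_square algebra_simps)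
      also have "\<dots> \<le> 1" using \<alpha> by simp
      finally show "1 - 1 / (1 + \<alpha>)\<^sup>2 \<le> 2 * \<alpha>" using \<alpha> by (simp add: field_simps)
      show "1 / (1 + \<alpha>)\<^sup>2 \<le> 1" using \<alpha> one_le_power[of "1 + \<alpha>" 2] by simp
    qed
    then have "B \<tau> * (1 - 1 / (1 + \<alpha>)\<^sup>2) \<le> (1 + c) * real n * (2 * \<alpha>)" "B \<tau> * (1 - 1 / (1 + \<alpha>)\<^sup>2) \<ge> 0"
      using B0 B1 c by (auto intro!: mult_mono mult_nonneg_nonneg)
    then show ?thesis by (simp add: algebra_simps)
  qed
  have D: "\<bar>\<alpha> * s2 / (1 + \<alpha>) * D\<bar> \<le> s2 * \<alpha> * real n"
  proof -
    have "D \<le> (\<integral>x. real n \<partial>iso_normal n \<mu> \<tau>)" unfolding D_def using dof_le ib by (intro integral_mono) auto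
    then have D1: "D \<le> real n" by (simp add: N.prob_space[simplified])
    have D0: "D \<ge> 0" unfolding D_def using dof_nonneg by (intro Bochner_Integration.integral_nonneg_AE AE_I2) auto
    have "\<alpha> * s2 / (1 + \<alpha>) \<le> s2 * \<alpha>" using \<alpha> s2 by (simp add: field_simps)
    then have "\<alpha> * s2 / (1 + \<alpha>) * D \<le> s2 * \<alpha> * real n" using D1 D0 s2 \<alpha> by (intro mult_mono) auto
    then show ?thesis using mult_nonneg_nonneg[OF less_imp_le[OF pos(3)] D0] by (simp only: abs_of_nonneg)
  qed
  have "\<bar>rand_risk - (\<integral>y. bias y + fit y \<partial>iso_normal n \<mu> s2)\<bar> \<le> \<alpha> * real n * K + \<alpha> * real n * K + 2 * (1 + c) * \<alpha> * real n + s2 * \<alpha> * real n"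
  proof -
    have "\<bar>a + b'' + d - (a' + b')\<bar> \<le> e1 + e2 + e3 + e4"
      if "\<bar>a - a'\<bar> \<le> e1" "\<bar>b - b'\<bar> \<le> e2" "\<bar>b'' - b\<bar> \<le> e3" "\<bar>d\<bar> \<le> e4" for a a' b b' b'' d e1 e2 e3 e4 :: real
      using that by linarith
    from this[OF A B B2 D] show ?thesis unfolding r1 r2 .
  qed
  also have "\<dots> = (2 * K + 2 * (1 + c) + s2) * \<alpha> * real n" by (simp add: algebra_simps)
  also have "2 * K = (c + 2 * T\<^sup>2) / (2 * s2)" using s2 by (simp add: K_def field_simps)
  finally show ?thesis by (simp only: T_def)
qed

end

end

section \<open>Measurable version of a selection map\<close>

text \<open>Boxes with sides from a countable basis of the line form a countable family, and every
  open set is the union of the boxes it contains.\<close>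

lemma openin_Rn_top_sets:
  assumes U: "openin (Rn_top n) U"
  shows "U \<in> sets (Rn_lborel n)"
proof -
  obtain B :: "real set set" where B: "countable B" "topological_basis B"
    using ex_countable_basis by blast
  define F where "F = {f \<in> Pi\<^sub>E {..<n} (\<lambda>_. B). Pi\<^sub>E {..<n} f \<subseteq> U}"
  have "countable F"
    unfolding F_def using B(1) by (intro countable_Collect countable_PiE) auto
  moreover have "Pi\<^sub>E {..<n} f \<in> sets (Rn_lborel n)" if "f \<in> F" for f
    unfolding Rn_lborel_def using that topological_basis_open[OF B(2)]
    by (intro sets_PiM_I_finite) (auto simp: F_def PiE_iff intro!: borel_open)
  moreover have "U = (\<Union>f\<in>F. Pi\<^sub>E {..<n} f)"
  proof (intro equalityI subsetI)
    fix x assume "x \<in> U"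
    then obtain V where V: "\<forall>i\<in>{..<n}. open (V i)" "x \<in> Pi\<^sub>E {..<n} V" "Pi\<^sub>E {..<n} V \<subseteq> U"
      using U unfolding Rn_top_def openin_product_topology_alt by auto
    have "\<exists>b\<in>B. x i \<in> b \<and> b \<subseteq> V i" if "i < n" for i
      using topological_basisE[OF B(2), of "V i" "x i"] V that by (metis PiE_mem lessThan_iff)
    then obtain b where b: "\<And>i. i < n \<Longrightarrow> b i \<in> B \<and> x i \<in> b i \<and> b i \<subseteq> V i" by metis
    have "Pi\<^sub>E {..<n} (restrict b {..<n}) \<subseteq> Pi\<^sub>E {..<n} V" using b by (intro PiE_mono) auto
    then have "restrict b {..<n} \<in> F" using b V(3) by (auto simp: F_def)
    moreover have "x \<in> Pi\<^sub>E {..<n} (restrict b {..<n})" using V(2) b by (auto simp: PiE_def Pi_def)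
    ultimately show "x \<in> (\<Union>f\<in>F. Pi\<^sub>E {..<n} f)" by blast
  qed (auto simp: F_def)
  ultimately show ?thesis by (metis sets.countable_UN'')
qed

text \<open>Off the frontiers each region coincides with its interior, which is open and hence
  Borel. On the null set \<open>N\<close> of all frontiers the default \<open>M0\<close> is
  selected, which keeps every preimage Borel.\<close>

lemma borel_selection_exists:
  assumes fin: "finite S" and M0: "M0 \<in> S" and img: "Mhat ` Rn n = S"
    and bd: "\<And>M. M \<in> S \<Longrightarrow> Rn_top n frontier_of sel_region n Mhat M \<in> null_sets (Rn_lborel n)"
  obtains sel N where "sel \<in> Rn_lborel n \<rightarrow>\<^sub>M count_space S" "N \<in> null_sets (Rn_lborel n)"
    "\<And>x. x \<in> Rn n \<Longrightarrow> x \<notin> N \<Longrightarrow> sel x = Mhat x"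
proof -
  define N where "N = (\<Union>M\<in>S. Rn_top n frontier_of sel_region n Mhat M)"
  have N: "N \<in> null_sets (Rn_lborel n)"
    unfolding N_def using fin bd by (intro null_sets_UN' countable_finite)
  then have NR: "N \<subseteq> Rn n" using sets.sets_into_space by fastforce
  define sel where "sel x = (if x \<in> N then M0 else Mhat x)" for x
  have top: "topspace (Rn_top n) = Rn n" by (simp add: Rn_top_def Rn_def)
  have "sel -` {M} \<inter> Rn n \<in> sets (Rn_lborel n)" if M: "M \<in> S" for M
  proof -
    let ?I = "Rn_top n interior_of sel_region n Mhat M"
    have sub: "sel_region n Mhat M \<subseteq> topspace (Rn_top n)" by (auto simp: top sel_region_def)
    have "x \<in> ?I \<longleftrightarrow> Mhat x = M" if x: "x \<in> Rn n" "x \<notin> N" for x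
    proof
      show "x \<in> ?I \<Longrightarrow> Mhat x = M" using subsetD[OF interior_of_subset, of x "Rn_top n" "sel_region n Mhat M"] by (simp add: sel_region_def)
      assume "Mhat x = M"
      then have "x \<in> Rn_top n closure_of sel_region n Mhat M"
        using closure_of_subset[OF sub] x by (auto simp: sel_region_def)
      then show "x \<in> ?I" using x M by (auto simp: N_def frontier_of_def)
    qed
    then have iff: "x \<in> Rn n \<Longrightarrow> x \<notin> N \<Longrightarrow> x \<in> ?I \<longleftrightarrow> Mhat x = M" for x .
    have "x \<in> sel -` {M} \<inter> Rn n \<longleftrightarrow> x \<in> (if M = M0 then N else {}) \<union> (Rn n \<inter> ?I - N)" for x
    proof (cases "x \<in> N")
      case True
      then have "x \<in> Rn n" using NR by blast
      with True show ?thesis by (simp add: sel_def eq_commute)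
    next
      case False
      then show ?thesis using iff[of x] by (auto simp: sel_def)
    qed
    then have "sel -` {M} \<inter> Rn n = (if M = M0 then N else {}) \<union> (Rn n \<inter> ?I - N)"
      by blast
    moreover have "?I \<in> sets (Rn_lborel n)" by (intro openin_Rn_top_sets) simp
    moreover have "Rn n \<in> sets (Rn_lborel n)" using sets.top[of "Rn_lborel n"] by simp
    ultimately show ?thesis using N by auto
  qed
  then have "sel \<in> Rn_lborel n \<rightarrow>\<^sub>M count_space S"
    using fin M0 img by (auto simp: measurable_count_space_eq2 sel_def)
  with N show ?thesis by (intro that[of sel N]) (auto simp: sel_def)
qed

section \<open>Null sets under the joint laws\<close>

lemma iso_normal_null_sets:
  assumes "N \<in> null_sets (Rn_lborel n)" "v > 0"
  shows "AE x in iso_normal n m v. x \<notin> N"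
proof -
  have "absolutely_continuous (Rn_lborel n) (iso_normal n m v)"
    unfolding iso_normal_density[OF assms(2)] by (intro absolutely_continuousI_density) measurable
  then show ?thesis using assms(1) by (intro AE_not_in) (auto simp: absolutely_continuous_def)
qed

lemma AE_pair_snd:
  assumes "sigma_finite_measure M2" and P: "AE y in M2. P y"
  shows "AE q in M1 \<Otimes>\<^sub>M M2. P (snd q)"
proof -
  interpret sigma_finite_measure M2 by fact
  obtain N where N: "{y \<in> space M2. \<not> P y} \<subseteq> N" "N \<in> sets M2" "emeasure M2 N = 0"
    using P by (elim AE_E) auto
  show ?thesis
  proof (rule AE_I[of _ _ "space M1 \<times> N"])
    show "emeasure (M1 \<Otimes>\<^sub>M M2) (space M1 \<times> N) = 0"
      using N by (simp add: emeasure_pair_measure_Times)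
  qed (use N in \<open>auto simp: space_pair_measure\<close>)
qed

lemma AE_pair_fst:
  assumes "sigma_finite_measure M2" and P: "AE x in M1. P x"
  shows "AE q in M1 \<Otimes>\<^sub>M M2. P (fst q)"
proof -
  interpret sigma_finite_measure M2 by fact
  obtain N where N: "{x \<in> space M1. \<not> P x} \<subseteq> N" "N \<in> sets M1" "emeasure M1 N = 0"
    using P by (elim AE_E) auto
  show ?thesis
  proof (rule AE_I[of _ _ "N \<times> space M2"])
    show "emeasure (M1 \<Otimes>\<^sub>M M2) (N \<times> space M2) = 0"
      using N by (simp add: emeasure_pair_measure_Times)
  qed (use N in \<open>auto simp: space_pair_measure\<close>)
qed

context selection_rule
begin

context
  fixes s2 \<alpha> :: real and N :: "(nat \<Rightarrow> real) set"
  assumes s2: "s2 > 0" and \<alpha>: "\<alpha> > 0" and N: "N \<in> null_sets (Rn_lborel n)"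
begin

text \<open>In the coordinates (s, e) the randomised response is the first component, whose law has
  a density, so it almost surely avoids a Lebesgue null set.\<close>

lemma AE_PQ_y_star: "AE p in PQ s2 \<alpha>. y_star n (fst p) (snd p) \<notin> N"
proof -
  have Ns: "N \<in> sets (Rn_lborel n)" using N by auto
  have um: "unrandomize n \<alpha> \<mu> \<in> SE s2 \<alpha> \<rightarrow>\<^sub>M Rn_lborel n \<Otimes>\<^sub>M Rn_lborel n"
    using unrandomize_measurable by (simp add: measurable_iso_normal_pair_eq)
  have "AE q in SE s2 \<alpha>. fst q \<notin> N"
    by (intro AE_pair_fst prob_space_imp_sigma_finite prob_space_iso_normal iso_normal_null_sets N pos s2 \<alpha>)
  then have "AE q in SE s2 \<alpha>. y_star n (fst (unrandomize n \<alpha> \<mu> q)) (snd (unrandomize n \<alpha> \<mu> q)) \<notin> N"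
  proof (rule AE_mp[OF _ AE_I2], intro impI)
    fix q assume q: "q \<in> space (SE s2 \<alpha>)" and qN: "fst q \<notin> N"
    obtain y w where yw: "unrandomize n \<alpha> \<mu> (fst q, snd q) = (y, w)" by fastforce
    have "fst q \<in> Rn n" using q by (auto simp: space_pair_measure)
    from unrandomize_coords(1)[OF s2 \<alpha> this yw] yw qN
    show "y_star n (fst (unrandomize n \<alpha> \<mu> q)) (snd (unrandomize n \<alpha> \<mu> q)) \<notin> N" by simp
  qed
  moreover have "{p \<in> space (Rn_lborel n \<Otimes>\<^sub>M Rn_lborel n). y_star n (fst p) (snd p) \<notin> N} \<in> sets (Rn_lborel n \<Otimes>\<^sub>M Rn_lborel n)"
  proof -
    have "(\<lambda>p. y_star n (fst p) (snd p)) -` (Rn n - N) \<inter> space (Rn_lborel n \<Otimes>\<^sub>M Rn_lborel n) \<in> sets (Rn_lborel n \<Otimes>\<^sub>M Rn_lborel n)"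
      using Ns sets.top[of "Rn_lborel n"] by (intro measurable_sets[OF y_star_measurable]) auto
    moreover have "(\<lambda>p. y_star n (fst p) (snd p)) -` (Rn n - N) \<inter> space (Rn_lborel n \<Otimes>\<^sub>M Rn_lborel n)
      = {p \<in> space (Rn_lborel n \<Otimes>\<^sub>M Rn_lborel n). y_star n (fst p) (snd p) \<notin> N}"
      using measurable_space[OF y_star_measurable] by auto
    ultimately show ?thesis by simp
  qed
  ultimately show ?thesis
    unfolding randomized_eq_distr[OF s2 \<alpha>] by (subst AE_distr_iff[OF um]) auto
qed

lemma AE_snd_iso_normal: "AE p in iso_normal n \<mu> s2 \<Otimes>\<^sub>M iso_normal n \<mu> s2. snd p \<notin> N"
  by (intro AE_pair_snd prob_space_imp_sigma_finite prob_space_iso_normal iso_normal_null_sets N s2)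

lemma AE_snd_PQ: "AE q in iso_normal n \<mu> s2 \<Otimes>\<^sub>M PQ s2 \<alpha>. y_star n (fst (snd q)) (snd (snd q)) \<notin> N"
  using AE_PQ_y_star by (intro AE_pair_snd prob_space_imp_sigma_finite prob_space_PQ s2 \<alpha>)

end

end

section \<open>Uniformity along the sequence of problems\<close>

text \<open>A subset of \<open>{..<p}\<close> with at most k elements is coded by k values in
  \<open>{..p}\<close>; the extra value p is padding, removed by the intersection with
  \<open>{..<p}\<close>.\<close>

lemma card_bounded_subsets_le:
  assumes S: "S \<subseteq> Pow {..<p}" and k: "\<And>M. M \<in> S \<Longrightarrow> card M \<le> k"
  shows "card S \<le> (p + 1) ^ k"
proof -
  let ?F = "Pi\<^sub>E {..<k} (\<lambda>_. {..p})"
  have "S \<subseteq> (\<lambda>f. f ` {..<k} \<inter> {..<p}) ` ?F"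
  proof
    fix M assume M: "M \<in> S"
    then have Mp: "M \<subseteq> {..<p}" using S by auto
    then have "finite M" by (rule finite_subset) simp
    then obtain g where g: "bij_betw g {..<card M} M"
      using ex_bij_betw_nat_finite[of M] by (auto simp: lessThan_atLeast0)
    define f where "f = (\<lambda>i\<in>{..<k}. if i < card M then g i else p)"
    have gM: "g i \<in> M" if "i < card M" for i using g that by (auto simp: bij_betw_def)
    then have "g i \<le> p" if "i < card M" for i using Mp that by (meson less_imp_le lessThan_iff subsetD)
    then have "f \<in> ?F" by (auto simp: f_def)
    moreover have "f ` {..<k} \<inter> {..<p} = M"
    proof (intro equalityI subsetI)
      fix x assume "x \<in> M"
      then obtain i where "i < card M" "x = g i" using g by (auto simp: bij_betw_def)
      then show "x \<in> f ` {..<k} \<inter> {..<p}" using k[OF M] \<open>x \<in> M\<close> Mp by (auto simp: f_def image_iff intro!: bexI[of _ i])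
    qed (use gM in \<open>auto simp: f_def split: if_splits\<close>)
    ultimately show "M \<in> (\<lambda>f. f ` {..<k} \<inter> {..<p}) ` ?F" by blast
  qed
  moreover have "finite ?F" by (intro finite_PiE) auto
  ultimately have "card S \<le> card ?F" by (rule surj_card_le[rotated])
  then show ?thesis by (simp add: card_PiE)
qed

text \<open>Turns an eventual bound into one for all n \<ge> 1: the finitely many exceptional n have
  constants of their own, and the sum of their absolute values dominates each.\<close>

lemma uniform_constant:
  fixes P :: "nat \<Rightarrow> real \<Rightarrow> bool"
  assumes ev: "\<forall>\<^sub>F n in sequentially. P n c0" and each: "\<And>n. n \<ge> 1 \<Longrightarrow> \<exists>c. P n c"
    and mono: "\<And>n c c'. P n c \<Longrightarrow> c \<le> c' \<Longrightarrow> P n c'"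
  shows "\<exists>c\<ge>0. \<forall>n\<ge>1. P n c"
proof -
  obtain n0 where n0: "\<And>n. n \<ge> n0 \<Longrightarrow> P n c0" using ev by (auto simp: eventually_sequentially)
  obtain f where f: "\<And>n. n \<ge> 1 \<Longrightarrow> P n (f n)" using each by metis
  define c where "c = \<bar>c0\<bar> + (\<Sum>n<n0. \<bar>f n\<bar>)"
  have "P n c" if "n \<ge> 1" for n
  proof (cases "n \<ge> n0")
    case True
    have "0 \<le> (\<Sum>n<n0. \<bar>f n\<bar>)" by (simp add: sum_nonneg)
    then have "c0 \<le> c" unfolding c_def by linarith
    then show ?thesis using mono[OF n0[OF True]] by blast
  next
    case False
    then have "\<bar>f n\<bar> \<le> (\<Sum>n<n0. \<bar>f n\<bar>)" by (intro member_le_sum) auto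
    then show ?thesis using mono[OF f[OF that]] by (simp add: c_def)
  qed
  moreover have "c \<ge> 0" unfolding c_def by (simp add: sum_nonneg)
  ultimately show ?thesis by blast
qed

text \<open>For \<open>p \<le> 1\<close> the growth condition says nothing about \<open>K\<close>, since then \<open>ln p = 0\<close>; this is why
  \<open>min K p\<close> replaces \<open>K\<close>.\<close>

lemma model_complexity_le:
  fixes p K N :: nat
  defines "k \<equiv> min K p" and "\<kappa> \<equiv> max 1 (real (min K p))"
  assumes n: "n \<ge> 1" and N: "1 \<le> N" "N \<le> (p + 1) ^ k"
    and C: "C \<ge> 0" "(real K)\<^sup>2 * ln (real p) \<le> C * sqrt (real n)"
  shows "\<kappa>\<^sup>2 * (2 * (ln (real N))\<^sup>2 + 16) \<le> (40 * C\<^sup>2 + 32) * real n"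
proof -
  have L0: "ln (real N) \<ge> 0" using N(1) by simp
  have L: "ln (real N) \<le> real k * ln (real (p + 1))"
  proof -
    have "ln (real N) \<le> ln (real ((p + 1) ^ k))" using N by (subst ln_le_cancel_iff) (auto simp: of_nat_le_iff simp del: of_nat_power)
    then show ?thesis by (simp add: ln_realpow)
  qed
  have ge: "32 \<le> (40 * C\<^sup>2 + 32) * real n"
    using n by (intro order_trans[of 32 "32 * 1" "(40 * C\<^sup>2 + 32) * real n"] mult_mono) auto
  \<comment> \<open>For k = 0 there is one model, for p = k = 1 there are at most two; only from p
    \<ge> 2 on does the growth condition come in.\<close>
  consider "k = 0" | "p = 1" "k = 1" | "p \<ge> 2" "k \<ge> 1"
    unfolding k_def by fastforce
  then show ?thesis
  proof cases
    case 1
    then have "ln (real N) = 0" "\<kappa> = 1" using L L0 by (auto simp: \<kappa>_def k_def)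
    then show ?thesis using ge by simp
  next
    case 2
    then have "ln (real N) \<le> 1" using L ln_le_minus_one[of 2] by simp
    then have "(ln (real N))\<^sup>2 \<le> 1" using L0 by (simp add: power_le_one)
    moreover have "\<kappa> = 1" using 2 by (simp add: \<kappa>_def k_def)
    ultimately show ?thesis using ge by simp
  next
    case 3
    then have \<kappa>: "\<kappa> = real k" by (simp add: \<kappa>_def k_def)
    have kK: "real k \<le> real K" by (simp add: k_def)
    define l where "l = ln (real p)"
    \<comment> \<open>The bound ln 2 \<ge> 1/2 follows from e \<le> 3 \<le> 4.\<close>
    have "2 * ln (2::real) = ln 4" using ln_realpow[of 2 2] by simp
    moreover have "1 \<le> ln (4::real)" using ln_ge_iff[of 4 1] exp_le by simp
    ultimately have "1 / 2 \<le> ln (2::real)" by simp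
    also have "\<dots> \<le> l" unfolding l_def using 3 by (subst ln_le_cancel_iff) auto
    finally have l: "1 / 2 \<le> l" .
    have "ln (real (p + 1)) \<le> ln (real p ^ 2)"
    proof -
      have "p + 1 \<le> p * p" using 3 by (induction p) (auto simp: algebra_simps)
      then have "real (p + 1) \<le> real p ^ 2" by (metis of_nat_le_iff of_nat_mult power2_eq_square)
      then show ?thesis using 3 by (subst ln_le_cancel_iff) auto
    qed
    also have "\<dots> = 2 * l" using 3 by (simp add: l_def ln_realpow)
    finally have "real k * ln (real (p + 1)) \<le> real k * (2 * l)" by (intro mult_left_mono) auto
    with L have L': "ln (real N) \<le> 2 * (real k * l)" by simp
    \<comment> \<open>The quantity bounded by the growth condition. Counting models gives \<kappa>^2
      (ln N)^2 \<le> 4 a^2, and l \<ge> 1/2 gives \<kappa>^2 \<le> 2 a, hence 16 \<kappa>^2 \<le> 32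
      (1 + a^2); the factor of a^2 adds up to 8 + 32 = 40.\<close>
    define a where "a = (real k)\<^sup>2 * l"
    have a0: "a \<ge> 0" using l by (simp add: a_def)
    have "a \<le> (real K)\<^sup>2 * l" unfolding a_def using l kK by (intro mult_right_mono power_mono) auto
    then have "a \<le> C * sqrt (real n)" using C(2) by (simp add: l_def)
    then have "a\<^sup>2 \<le> (C * sqrt (real n))\<^sup>2" using a0 by (intro power_mono)
    then have a2: "a\<^sup>2 \<le> C\<^sup>2 * real n" by (simp add: power_mult_distrib)
    have "\<kappa>\<^sup>2 * (ln (real N))\<^sup>2 \<le> (real k)\<^sup>2 * (2 * (real k * l))\<^sup>2"
      unfolding \<kappa> using L' L0 by (intro mult_left_mono power_mono) auto
    also have "\<dots> = 4 * a\<^sup>2" by (simp add: a_def power2_eq_square algebra_simps)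
    finally have t1: "\<kappa>\<^sup>2 * (ln (real N))\<^sup>2 \<le> 4 * a\<^sup>2" .
    have "\<kappa>\<^sup>2 * (1 / 2) \<le> a" unfolding \<kappa> a_def using l by (intro mult_left_mono) auto
    moreover have "a \<le> 1 + a\<^sup>2"
      using zero_le_power2[of "a - 1 / 2"] zero_le_power2[of a] by (simp add: power2_eq_square algebra_simps)
    ultimately have "16 * \<kappa>\<^sup>2 \<le> 32 + 32 * a\<^sup>2" by simp
    with t1 have "\<kappa>\<^sup>2 * (2 * (ln (real N))\<^sup>2 + 16) \<le> 32 + 40 * a\<^sup>2" by (simp add: distrib_left)
    also have "\<dots> \<le> 32 * real n + 40 * (C\<^sup>2 * real n)" using a2 n by simp
    finally show ?thesis by (simp add: algebra_simps)
  qed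
qed

section \<open>A single problem of the sequence\<close>

locale model_selection =
  fixes n p :: nat and X :: "real mat" and \<mu> :: "nat \<Rightarrow> real" and S :: "nat set set" and Mhat :: "(nat \<Rightarrow> real) \<Rightarrow> nat set"
  assumes X: "X \<in> carrier_mat n p" and S: "S \<subseteq> Pow {..<p}" and img: "Mhat ` Rn n = S"
    and bd: "\<And>M. M \<in> S \<Longrightarrow> Rn_top n frontier_of sel_region n Mhat M \<in> null_sets (Rn_lborel n)"
    and inv: "\<And>M. M \<in> S \<Longrightarrow> invertible_mat (gram X M)"
begin

abbreviation h :: "nat set \<Rightarrow> nat \<Rightarrow> nat \<Rightarrow> real" where "h M i j \<equiv> hat_mat X M $$ (i, j)"

lemma finite_S: "finite S"
  using S by (rule finite_subset) simp

lemma S_nonempty: "S \<noteq> {}"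
proof -
  have "(\<lambda>i\<in>{..<n}. 0) \<in> Rn n" by (simp add: Rn_def)
  then show ?thesis using img by blast
qed

lemma hat:
  assumes "M \<in> S"
  shows "hat_mat X M \<in> carrier_mat n n" "projection n (h M)" "tr n (h M) = card M"
proof -
  have "M \<subseteq> {..<p}" using S assms by auto
  from hat_mat_props[OF X this inv[OF assms]]
  show "hat_mat X M \<in> carrier_mat n n" "projection n (h M)" "tr n (h M) = card M"
    by (simp_all add: tr_def)
qed

lemma resid_sq_hat: "M \<in> S \<Longrightarrow> resid_sq n (hat_mat X M) u v = rss n (h M) u v"
  unfolding rss_def by (intro resid_sq_eq hat)

lemma mat_trace_hat: "M \<in> S \<Longrightarrow> mat_trace (hat_mat X M) = tr n (h M)"
  using hat(1)[of M] by (simp add: mat_trace_def tr_def)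

lemma borel_rule_exists:
  obtains sel N where "selection_rule n S h sel" "N \<in> null_sets (Rn_lborel n)" "\<And>x. x \<in> Rn n \<Longrightarrow> x \<notin> N \<Longrightarrow> sel x = Mhat x"
proof -
  obtain M0 where "M0 \<in> S" using S_nonempty by blast
  from borel_selection_exists[OF finite_S this img bd] obtain sel N
    where *: "sel \<in> Rn_lborel n \<rightarrow>\<^sub>M count_space S" "N \<in> null_sets (Rn_lborel n)" "\<And>x. x \<in> Rn n \<Longrightarrow> x \<notin> N \<Longrightarrow> sel x = Mhat x"
    by metis
  have "selection_rule n S h sel" by (rule selection_rule.intro) (use finite_S S_nonempty hat * in auto)
  with * show ?thesis by (intro that)
qed

text \<open>The last bound holds for every variance but is not controlled in n; it is meant for the
  finitely many n that the accuracy assumption leaves open.\<close>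

lemma bias_moment_eq:
  assumes "selection_rule n S h sel" "N \<in> null_sets (Rn_lborel n)" and eq: "\<And>x. x \<in> Rn n \<Longrightarrow> x \<notin> N \<Longrightarrow> sel x = Mhat x" and t: "t > 0"
  shows "bias_moment n X \<mu> Mhat t = (\<integral>y. (selection_rule.bias n h sel \<mu> y)\<^sup>2 \<partial>iso_normal n \<mu> t)"
    "integrable (iso_normal n \<mu> t) (\<lambda>y. (selection_rule.bias n h sel \<mu> y)\<^sup>2)"
    "bias_moment n X \<mu> Mhat t \<le> (\<Sum>i<n. (\<mu> i)\<^sup>2)\<^sup>2"
proof -
  interpret selection_rule n S h sel \<mu> by fact
  interpret P: prob_space "iso_normal n \<mu> t" by (rule prob_space_iso_normal[OF t])
  have m: "(\<lambda>y. (bias y)\<^sup>2) \<in> borel_measurable (iso_normal n \<mu> t)"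
    unfolding measurable_iso_normal_eq by (intro borel_measurable_power bias_measurable)
  have "AE y in iso_normal n \<mu> t. (resid_sq n (hat_mat X (Mhat y)) \<mu> \<mu>)\<^sup>2 = (bias y)\<^sup>2"
    using iso_normal_null_sets[OF assms(2) t, of \<mu>] AE_space
  proof eventually_elim
    case (elim y)
    then show ?case using eq[of y] sel_in[of y] by (simp add: bias_def resid_sq_hat)
  qed
  from integral_completion_AE_eq[OF m this] show 1: "bias_moment n X \<mu> Mhat t = (\<integral>y. (bias y)\<^sup>2 \<partial>iso_normal n \<mu> t)"
    by (simp add: bias_moment_def)
  have b: "(bias y)\<^sup>2 \<le> (\<Sum>i<n. (\<mu> i)\<^sup>2)\<^sup>2" if "y \<in> Rn n" for y
    using bias_le[OF that] bias_nonneg by (intro power_mono) auto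
  show 2: "integrable (iso_normal n \<mu> t) (\<lambda>y. (bias y)\<^sup>2)"
    using m b by (intro P.integrable_const_bound[where B = "(\<Sum>i<n. (\<mu> i)\<^sup>2)\<^sup>2"]) auto
  have "(\<integral>y. (bias y)\<^sup>2 \<partial>iso_normal n \<mu> t) \<le> (\<integral>y. (\<Sum>i<n. (\<mu> i)\<^sup>2)\<^sup>2 \<partial>iso_normal n \<mu> t)"
    using 2 b by (intro integral_mono) auto
  then show "bias_moment n X \<mu> Mhat t \<le> (\<Sum>i<n. (\<mu> i)\<^sup>2)\<^sup>2"
    by (simp add: 1 P.prob_space[simplified])
qed

lemma bias_moment_le: "t > 0 \<Longrightarrow> bias_moment n X \<mu> Mhat t \<le> (\<Sum>i<n. (\<mu> i)\<^sup>2)\<^sup>2"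
  using borel_rule_exists bias_moment_eq(3) by metis

text \<open>A single \<open>c\<close> bounds the second moments of \<open>bias\<close> and
  \<open>fit\<close> over the whole range of variances. Each error is evaluated with the Borel rule,
  which changes the integrands on null sets only.\<close>

lemma error_comparison:
  assumes n: "n \<ge> 1" and s2: "s2 > 0" and \<alpha>: "\<alpha> > 0" "\<alpha> < \<delta>" and c: "c \<ge> 0"
    and \<kappa>: "\<kappa> > 0" "\<And>M. M \<in> S \<Longrightarrow> real (card M) \<le> \<kappa>"
    and bm: "\<And>t. s2 \<le> t \<Longrightarrow> t \<le> (1 + \<delta>) * s2 \<Longrightarrow> bias_moment n X \<mu> Mhat t \<le> c * real n"
    and mc: "16 * ((1 + \<delta>) * s2)\<^sup>2 * (\<kappa>\<^sup>2 * (2 * (ln (card S))\<^sup>2 + 16)) \<le> c * real n"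
  shows "expected_err_hat n X \<mu> Mhat s2 \<alpha> = Err_rand n X \<mu> Mhat s2 \<alpha>"
    "\<bar>Err_rand n X \<mu> Mhat s2 \<alpha> - Err n X \<mu> Mhat s2\<bar> \<le> ((c + 2 * ((1 + \<delta>) * s2)\<^sup>2) / (2 * s2) + 2 * (1 + c) + s2) * \<alpha> * real n"
proof -
  obtain sel N where sel: "selection_rule n S h sel" and N: "N \<in> null_sets (Rn_lborel n)" and eq: "\<And>x. x \<in> Rn n \<Longrightarrow> x \<notin> N \<Longrightarrow> sel x = Mhat x"
    using borel_rule_exists by metis
  interpret selection_rule n S h sel \<mu> by fact
  let ?PQ = "iso_normal n \<mu> s2 \<Otimes>\<^sub>M iso_normal n (\<lambda>_. 0) (\<alpha> * s2)"
  have ys: "y_star n y w \<in> Rn n" for y w by (simp add: y_star_def Rn_def)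
  note H = has_bochner_integral_integral_eq
  note M = borel_measurable_has_bochner_integral
  have "AE p in ?PQ. (case p of (y, w) \<Rightarrow> err_hat n X Mhat s2 \<alpha> y w) =
    rss n (h (sel (y_star n (fst p) (snd p)))) (y_minus n \<alpha> (fst p) (snd p)) (fst p)
      + 2 * dof (y_star n (fst p) (snd p)) * s2 - (1 / \<alpha>) * real n * s2"
    using AE_PQ_y_star[OF s2 \<alpha>(1) N]
  proof eventually_elim
    case (elim p)
    then have "sel (y_star n (fst p) (snd p)) = Mhat (y_star n (fst p) (snd p))" by (intro eq ys)
    then show ?case
      using sel_in[OF ys[of "fst p" "snd p"]] by (simp add: err_hat_def Let_def case_prod_unfold resid_sq_hat mat_trace_hat dof_def)
  qed
  from integral_completion_AE_eq[OF M[OF has_integral_err_hat[OF s2 \<alpha>(1)]] this]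
  have e1: "expected_err_hat n X \<mu> Mhat s2 \<alpha> = rand_risk s2 \<alpha> + real n * s2"
    unfolding expected_err_hat_def using H[OF has_integral_err_hat[OF s2 \<alpha>(1)]] by simp
  have "AE q in iso_normal n \<mu> s2 \<Otimes>\<^sub>M ?PQ. (case q of (u, y, w) \<Rightarrow> resid_sq n (hat_mat X (Mhat (y_star n y w))) u y) =
    (case q of (u, p) \<Rightarrow> rss n (h (sel (y_star n (fst p) (snd p)))) u (fst p))"
    using AE_snd_PQ[OF s2 \<alpha>(1) N]
  proof eventually_elim
    case (elim q)
    then have "sel (y_star n (fst (snd q)) (snd (snd q))) = Mhat (y_star n (fst (snd q)) (snd (snd q)))" by (intro eq ys)
    then show ?case
      using sel_in[OF ys[of "fst (snd q)" "snd (snd q)"]] by (simp add: case_prod_unfold resid_sq_hat)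
  qed
  from integral_completion_AE_eq[OF M[OF has_integral_Err_rand[OF s2 \<alpha>(1)]] this]
  have e2: "Err_rand n X \<mu> Mhat s2 \<alpha> = rand_risk s2 \<alpha> + real n * s2"
    unfolding Err_rand_def using H[OF has_integral_Err_rand[OF s2 \<alpha>(1)]] by simp
  have "AE q in iso_normal n \<mu> s2 \<Otimes>\<^sub>M iso_normal n \<mu> s2. (case q of (u, y) \<Rightarrow> resid_sq n (hat_mat X (Mhat y)) u y) = (case q of (u, y) \<Rightarrow> rss n (h (sel y)) u y)"
    using AE_snd_iso_normal[OF s2 \<alpha>(1) N] AE_space
  proof eventually_elim
    case (elim q)
    then have "snd q \<in> Rn n" by (auto simp: space_pair_measure)
    then show ?case
      using elim(1) eq[of "snd q"] sel_in[of "snd q"] by (simp add: case_prod_unfold resid_sq_hat)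
  qed
  from integral_completion_AE_eq[OF M[OF has_integral_Err[OF s2 \<alpha>(1)]] this]
  have e3: "Err n X \<mu> Mhat s2 = (\<integral>y. bias y + fit y \<partial>iso_normal n \<mu> s2) + real n * s2"
    unfolding Err_def using H[OF has_integral_Err[OF s2 \<alpha>(1)]] by simp
  show "expected_err_hat n X \<mu> Mhat s2 \<alpha> = Err_rand n X \<mu> Mhat s2 \<alpha>" by (simp add: e1 e2)
  have "\<bar>rand_risk s2 \<alpha> - (\<integral>y. bias y + fit y \<partial>iso_normal n \<mu> s2)\<bar> \<le> 
    ((c + 2 * ((1 + \<delta>) * s2)\<^sup>2) / (2 * s2) + 2 * (1 + c) + s2) * \<alpha> * real n"
  proof (rule rand_risk_diff_bound[OF s2 \<alpha>(1) n \<alpha>(2) c])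
    fix t assume t: "s2 \<le> t" "t \<le> (1 + \<delta>) * s2"
    then have t0: "t > 0" using s2 by simp
    show "(\<integral>\<^sup>+x. ennreal ((bias x)\<^sup>2) \<partial>iso_normal n \<mu> t) \<le> ennreal (c * real n)"
      using bias_moment_eq[OF sel N eq t0] bm[OF t] by (subst nn_integral_eq_integral) (auto intro!: ennreal_leI)
    have "(\<integral>\<^sup>+x. ennreal ((fit x)\<^sup>2) \<partial>iso_normal n \<mu> t) \<le> ennreal (16 * t\<^sup>2 * \<kappa>\<^sup>2 * (2 * (ln (card S))\<^sup>2 + 16))"
      using \<kappa> by (intro fit_sq_bound t0) (auto simp: hat)
    also have "\<dots> \<le> ennreal (c * real n)"
    proof (rule ennreal_leI)
      have "16 * t\<^sup>2 * \<kappa>\<^sup>2 * (2 * (ln (card S))\<^sup>2 + 16) = 16 * t\<^sup>2 * (\<kappa>\<^sup>2 * (2 * (ln (card S))\<^sup>2 + 16))" by simp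
      also have "\<dots> \<le> 16 * ((1 + \<delta>) * s2)\<^sup>2 * (\<kappa>\<^sup>2 * (2 * (ln (card S))\<^sup>2 + 16))"
        using t t0 by (intro mult_right_mono mult_left_mono power_mono) auto
      finally show "16 * t\<^sup>2 * \<kappa>\<^sup>2 * (2 * (ln (card S))\<^sup>2 + 16) \<le> c * real n" using mc by simp
    qed
    finally show "(\<integral>\<^sup>+x. ennreal ((fit x)\<^sup>2) \<partial>iso_normal n \<mu> t) \<le> ennreal (c * real n)" .
  qed
  then show "\<bar>Err_rand n X \<mu> Mhat s2 \<alpha> - Err n X \<mu> Mhat s2\<bar> \<le> ((c + 2 * ((1 + \<delta>) * s2)\<^sup>2) / (2 * s2) + 2 * (1 + c) + s2) * \<alpha> * real n"
    by (simp add: e2 e3)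
qed

end

theorem theorem3p5:
  fixes \<sigma> \<delta> :: real
    and p K :: "nat \<Rightarrow> nat"
    and X :: "nat \<Rightarrow> real mat"
    and \<mu> :: "nat \<Rightarrow> nat \<Rightarrow> real"
    and Models :: "nat \<Rightarrow> nat set set"
    and Mhat :: "nat \<Rightarrow> (nat \<Rightarrow> real) \<Rightarrow> nat set"
  assumes sigma_pos: "\<sigma> > 0" and delta_pos: "\<delta> > 0"
    and design: "\<And>n. n \<ge> 1 \<Longrightarrow> X n \<in> carrier_mat n (p n)"
    and models: "\<And>n. n \<ge> 1 \<Longrightarrow> Models n \<subseteq> Pow {..<p n}"
    and surj: "\<And>n. n \<ge> 1 \<Longrightarrow> Mhat n ` Rn n = Models n"
    and interior: "\<And>n M. n \<ge> 1 \<Longrightarrow> M \<in> Models n \<Longrightarrow>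
      Rn_top n interior_of sel_region n (Mhat n) M \<noteq> {}"
    and boundary: "\<And>n M. n \<ge> 1 \<Longrightarrow> M \<in> Models n \<Longrightarrow>
      Rn_top n frontier_of sel_region n (Mhat n) M \<in> null_sets (Rn_lborel n)"
    and gram_invertible: "\<And>n M. n \<ge> 1 \<Longrightarrow> M \<in> Models n \<Longrightarrow> invertible_mat (gram (X n) M)"
    and rank_le: "\<And>n M. n \<ge> 1 \<Longrightarrow> M \<in> Models n \<Longrightarrow>
      vec_space.rank n (hat_mat (X n) M) \<le> card M"
    and size_le: "\<And>n M. n \<ge> 1 \<Longrightarrow> M \<in> Models n \<Longrightarrow> card M \<le> K n"
    and growth: "(\<lambda>n. (real (K n))\<^sup>2 * ln (real (p n))) \<in> O(\<lambda>n. sqrt (real n))"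
    and accuracy: "\<exists>c. \<forall>\<^sub>F n in sequentially. \<forall>\<tau>\<in>{\<sigma>\<^sup>2..(1 + \<delta>) * \<sigma>\<^sup>2}.
      bias_moment n (X n) (\<mu> n) (Mhat n) \<tau> \<le> c * real n"
  shows "\<exists>C. \<forall>n\<ge>1. \<forall>\<alpha>. 0 < \<alpha> \<and> \<alpha> < \<delta> \<longrightarrow>
    (1 / real n) * \<bar>expected_err_hat n (X n) (\<mu> n) (Mhat n) (\<sigma>\<^sup>2) \<alpha> - Err n (X n) (\<mu> n) (Mhat n) (\<sigma>\<^sup>2)\<bar>
      = (1 / real n) * \<bar>Err_rand n (X n) (\<mu> n) (Mhat n) (\<sigma>\<^sup>2) \<alpha> - Err n (X n) (\<mu> n) (Mhat n) (\<sigma>\<^sup>2)\<bar>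
    \<and> (1 / real n) * \<bar>Err_rand n (X n) (\<mu> n) (Mhat n) (\<sigma>\<^sup>2) \<alpha> - Err n (X n) (\<mu> n) (Mhat n) (\<sigma>\<^sup>2)\<bar>
      \<le> C * \<alpha>"
proof -
  define s2 where "s2 = \<sigma>\<^sup>2"
  have s2: "s2 > 0" using sigma_pos by (simp add: s2_def)
  define T where "T = (1 + \<delta>) * s2"
  \<comment> \<open>The lower bound 1 keeps \<kappa> positive even if the empty model is the only
    one.\<close>
  define \<kappa> where "\<kappa> n = max 1 (real (min (K n) (p n)))" for n
  define D where "D n = 16 * T\<^sup>2 * ((\<kappa> n)\<^sup>2 * (2 * (ln (card (Models n)))\<^sup>2 + 16))" for n
  have ms: "model_selection n (p n) (X n) (Models n) (Mhat n)" if "n \<ge> 1" for n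
    using that design models surj boundary gram_invertible by unfold_locales auto
  have card_M: "card M \<le> min (K n) (p n)" if "n \<ge> 1" "M \<in> Models n" for n M
    using size_le[OF that] card_mono[of "{..<p n}" M] models[OF that(1)] that(2) by auto
  \<comment> \<open>The two demands on the constant: the accuracy bound, and a bound on
    \<open>D n\<close>, which dominates the second moment of \<open>fit\<close> for all variances up
    to \<open>T\<close>.\<close>
  define P where "P n c \<longleftrightarrow> (\<forall>\<tau>\<in>{s2..T}. bias_moment n (X n) (\<mu> n) (Mhat n) \<tau> \<le> c * real n) \<and> D n \<le> c * real n" for n c
  have "\<exists>c\<ge>0. \<forall>n\<ge>1. P n c"
  proof -
    obtain c1 where c1: "\<forall>\<^sub>F n in sequentially. \<forall>\<tau>\<in>{s2..T}. bias_moment n (X n) (\<mu> n) (Mhat n) \<tau> \<le> c1 * real n"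
      using accuracy by (auto simp: s2_def T_def)
    obtain C where C: "C > 0" "\<forall>\<^sub>F n in sequentially. norm ((real (K n))\<^sup>2 * ln (real (p n))) \<le> C * norm (sqrt (real n))"
      using growth by (elim landau_o.bigE)
    define c2 where "c2 = 16 * T\<^sup>2 * (40 * C\<^sup>2 + 32)"
    have "\<forall>\<^sub>F n in sequentially. D n \<le> c2 * real n"
      using C(2) eventually_ge_at_top[of 1]
    proof eventually_elim
      case (elim n)
      interpret model_selection n "p n" "X n" "\<mu> n" "Models n" "Mhat n" by (rule ms[OF elim(2)])
      have "(\<kappa> n)\<^sup>2 * (2 * (ln (card (Models n)))\<^sup>2 + 16) \<le> (40 * C\<^sup>2 + 32) * real n"
        unfolding \<kappa>_def
      proof (rule model_complexity_le[OF elim(2)])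
        show "1 \<le> card (Models n)" using finite_S S_nonempty by (simp add: Suc_leI card_gt_0_iff)
        show "card (Models n) \<le> (p n + 1) ^ min (K n) (p n)"
          using S card_M[OF elim(2)] by (rule card_bounded_subsets_le)
        show "(real (K n))\<^sup>2 * ln (real (p n)) \<le> C * sqrt (real n)" using elim(1) by simp
      qed (use C in simp)
      then have "16 * T\<^sup>2 * ((\<kappa> n)\<^sup>2 * (2 * (ln (card (Models n)))\<^sup>2 + 16)) \<le> 16 * T\<^sup>2 * ((40 * C\<^sup>2 + 32) * real n)"
        by (intro mult_left_mono) auto
      then show ?case by (simp add: D_def c2_def mult.assoc)
    qed
    with c1 have "\<forall>\<^sub>F n in sequentially. P n (max c1 c2)"
    proof eventually_elim
      case (elim n)
      have "c1 * real n \<le> max c1 c2 * real n" "c2 * real n \<le> max c1 c2 * real n" by (auto intro: mult_right_mono)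
      then show ?case using elim by (auto simp: P_def intro: order_trans)
    qed
    then show ?thesis
    proof (rule uniform_constant)
      fix n :: nat assume n: "n \<ge> 1"
      interpret model_selection n "p n" "X n" "\<mu> n" "Models n" "Mhat n" by (rule ms[OF n])
      \<comment> \<open>For a single n any finite bound will do, since n \<ge> 1 makes it a multiple
        of n.\<close>
      define c where "c = (\<Sum>i<n. (\<mu> n i)\<^sup>2)\<^sup>2 + D n"
      have D0: "D n \<ge> 0" by (simp add: D_def)
      then have "c * 1 \<le> c * real n" using n by (intro mult_left_mono) (auto simp: c_def)
      moreover have "(\<Sum>i<n. (\<mu> n i)\<^sup>2)\<^sup>2 \<le> c" "D n \<le> c" using D0 by (simp_all add: c_def)
      ultimately have "(\<Sum>i<n. (\<mu> n i)\<^sup>2)\<^sup>2 \<le> c * real n" "D n \<le> c * real n" by linarith+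
      have "P n c"
        unfolding P_def
      proof (intro conjI ballI)
        fix \<tau> assume "\<tau> \<in> {s2..T}"
        then have "\<tau> > 0" using s2 by simp
        from order_trans[OF bias_moment_le[OF this] \<open>(\<Sum>i<n. (\<mu> n i)\<^sup>2)\<^sup>2 \<le> c * real n\<close>]
        show "bias_moment n (X n) (\<mu> n) (Mhat n) \<tau> \<le> c * real n" .
      qed fact
      then show "\<exists>c. P n c" ..
    next
      fix n c c' assume "P n c" "c \<le> (c' :: real)"
      moreover from this have "c * real n \<le> c' * real n" by (intro mult_right_mono) auto
      ultimately show "P n c'" by (auto simp: P_def intro: order_trans)
    qed
  qed
  then obtain c where c: "c \<ge> 0" "\<And>n. n \<ge> 1 \<Longrightarrow> P n c" by blast
  define C where "C = (c + 2 * T\<^sup>2) / (2 * s2) + 2 * (1 + c) + s2"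
  show ?thesis
  proof (intro exI[of _ C] allI impI)
    fix n :: nat and \<alpha> :: real assume n: "1 \<le> n" and \<alpha>: "0 < \<alpha> \<and> \<alpha> < \<delta>"
    interpret model_selection n "p n" "X n" "\<mu> n" "Models n" "Mhat n" by (rule ms[OF n])
    have \<kappa>: "\<kappa> n > 0" "\<And>M. M \<in> Models n \<Longrightarrow> real (card M) \<le> \<kappa> n"
      using card_M[OF n] by (auto simp: \<kappa>_def le_max_iff_disj)
    have bm: "bias_moment n (X n) (\<mu> n) (Mhat n) t \<le> c * real n" if "s2 \<le> t" "t \<le> (1 + \<delta>) * s2" for t
      using c(2)[OF n] that by (auto simp: P_def T_def)
    have mc: "16 * ((1 + \<delta>) * s2)\<^sup>2 * ((\<kappa> n)\<^sup>2 * (2 * (ln (card (Models n)))\<^sup>2 + 16)) \<le> c * real n"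
      using c(2)[OF n] by (simp add: P_def D_def T_def)
    note cmp = error_comparison[OF n s2 conjunct1[OF \<alpha>] conjunct2[OF \<alpha>] c(1) \<kappa> bm mc]
    have "(1 / real n) * \<bar>Err_rand n (X n) (\<mu> n) (Mhat n) s2 \<alpha> - Err n (X n) (\<mu> n) (Mhat n) s2\<bar> \<le> (1 / real n) * (C * \<alpha> * real n)"
      using cmp(2) by (intro mult_left_mono) (simp_all add: C_def T_def)
    also have "\<dots> = C * \<alpha>" using n by simp
    finally show "(1 / real n) * \<bar>expected_err_hat n (X n) (\<mu> n) (Mhat n) (\<sigma>\<^sup>2) \<alpha> - Err n (X n) (\<mu> n) (Mhat n) (\<sigma>\<^sup>2)\<bar>
      = (1 / real n) * \<bar>Err_rand n (X n) (\<mu> n) (Mhat n) (\<sigma>\<^sup>2) \<alpha> - Err n (X n) (\<mu> n) (Mhat n) (\<sigma>\<^sup>2)\<bar>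
    \<and> (1 / real n) * \<bar>Err_rand n (X n) (\<mu> n) (Mhat n) (\<sigma>\<^sup>2) \<alpha> - Err n (X n) (\<mu> n) (Mhat n) (\<sigma>\<^sup>2)\<bar>
      \<le> C * \<alpha>"
      using cmp(1) by (simp only: s2_def[symmetric])
  qed
qed

end
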